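(* Let $K$ be a nonempty compact Hausdorff space satisfying at least one of the following conditions: (1) $K$ is a corona of character $\chi(K)<\mathfrak p$; (2) $K$ is perfectly normal; (3) $w(K)\le\omega_1<\mathfrak p$; (4) $w(K)\le\omega_1=\mathfrak c$. Then $K$ is homeomorphic to the Higson corona of a finitary coarse space $(X,\mathcal E)$ with $|X|=\omega$. Moreover, under the assumption $\mathsf\Delta^\circ_\omega=\mathfrak c$, the space $K$ is homeomorphic to the Higson corona of a cellular finitary coarse space $(X,\mathcal E)$ with $|X|=\omega$.
   Context: An entourage on a set $X$ is a subset $E\subseteq X\times X$ containing the diagonal $\Delta_X$; $E^{-1}=\{(y,x):(x,y)\in E\}$, $E\circ F=\{(x,z):\exists y\in X,\ (x,y)\in E,\ (y,z)\in F\}$, $E[x]=\{y\in X:(x,y)\in E\}$. A coarse space $(X,\mathcal E)$ is a set $X$ with a family $\mathcal E$ of entourages (its coarse structure) such that $\bigcup\mathcal E=X\times X$; for all $E,F\in\mathcal E$ there is $G\in\mathcal E$ with $E\circ F^{-1}\subseteq G$; and $\Delta_X\subseteq E\subseteq F\in\mathcal E$ implies $E\in\mathcal E$. A base of $\mathcal E$ is a subfamily $\mathcal B\subseteq\mathcal E$ such that each $E\in\mathcal E$ is contained in some $B\in\mathcal B$. A set $B\subseteq X$ is bounded if $B\subseteq E[x]$ for some $E\in\mathcal E$, $x\in X$. The coarse space is finitary if $\sup_{x\in X}|E[x]|$ is finite for every $E\in\mathcal E$, and cellular if $\mathcal E$ has a base consisting of equivalence relations. A subset $D\subseteq X$ is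 $\mathcal E$-discrete if for any $E\in\mathcal E$ there is a bounded set $B\subseteq X$ such that $D\cap E[x]=\{x\}$ for every $x\in D\setminus B$. A function $\varphi:X\to\mathbb R$ is slowly oscillating if for every $\varepsilon>0$ and $E\in\mathcal E$ there is a bounded set $B\subseteq X$ with $\mathrm{diam}\,\varphi(E[x])<\varepsilon$ for all $x\in X\setminus B$. Let $\mathsf{so}(X,\mathcal E;\mathbb R)$ be the set of all bounded slowly oscillating functions $X\to\mathbb R$. The Higson compactification $h_{\mathbb R}(X,\mathcal E)$ is the closure of the image of the injective map $X\to\mathbb R^{\mathsf{so}(X,\mathcal E;\mathbb R)}$, $x\mapsto(f(x))_f$ (product topology); $X$ is identified with its image. The Higson corona of $(X,\mathcal E)$ is $h_{\mathbb R}(X,\mathcal E)\setminus\bigcup\{\bar B:B\subseteq X\text{ bounded}\}$ (closures in $h_{\mathbb R}(X,\mathcal E)$); for a finitary coarse space it equals $h_{\mathbb R}(X,\mathcal E)\setminus X$. A corona is a compact Hausdorff space homeomorphic to $c\mathbb N\setminus\mathbb N$ for some compact Hausdorff space $c\mathbb N$ in which $\mathbb N$ is the (countable, discrete) set of isolated points and is dense. $w(K)$ is the weight of $K$; $\chi(K)=\sup_{x\in K}\chi(x;K)$, where $\chi(x;K)$ is the smallest cardinality of a neighborhood base at $x$. A space is perfectly normal if it is normal and each closed subset is $G_\delta$. $\mathfrak c$ is the cardinality of the continuum. $\mathfrak p$ is the smallest cardinality of a family $\mathcal F$ of infinite subsets of $\omega$ such that all finite intersections of members of $\mathcal F$ are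 infinite and for every infinite $I\subseteq\omega$ there is $F\in\mathcal F$ with $I\setminus F$ infinite. $\mathsf\Delta^\circ_\omega$ is the smallest cardinality of a base of a cellular finitary coarse structure $\mathcal E$ on $\omega$ such that $\omega$ contains no infinite $\mathcal E$-discrete subsets. *)

theory Defs
  imports "HOL-Analysis.Analysis"
begin

unbundle cardinal_syntax

section \<open>Coarse spaces\<close>

definition coarse_space :: "'b set \<Rightarrow> ('b \<times> 'b) set set \<Rightarrow> bool" where
  "coarse_space X \<E> \<longleftrightarrow>
     (\<forall>E\<in>\<E>. Id_on X \<subseteq> E \<and> E \<subseteq> X \<times> X) \<and>
     \<Union>\<E> = X \<times> X \<and>
     (\<forall>E\<in>\<E>. \<forall>F\<in>\<E>. \<exists>G\<in>\<E>. E O F\<inverse> \<subseteq> G) \<and>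
     (\<forall>E F. Id_on X \<subseteq> E \<longrightarrow> E \<subseteq> F \<longrightarrow> F \<in> \<E> \<longrightarrow> E \<in> \<E>)"

definition coarse_base :: "('b \<times> 'b) set set \<Rightarrow> ('b \<times> 'b) set set \<Rightarrow> bool" where
  "coarse_base \<E> \<B> \<longleftrightarrow> \<B> \<subseteq> \<E> \<and> (\<forall>E\<in>\<E>. \<exists>B\<in>\<B>. E \<subseteq> B)"

definition coarse_bounded :: "'b set \<Rightarrow> ('b \<times> 'b) set set \<Rightarrow> 'b set \<Rightarrow> bool" where
  "coarse_bounded X \<E> B \<longleftrightarrow> B \<subseteq> X \<and> (\<exists>E\<in>\<E>. \<exists>x\<in>X. B \<subseteq> E `` {x})"

definition finitary :: "'b set \<Rightarrow> ('b \<times> 'b) set set \<Rightarrow> bool" where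
  "finitary X \<E> \<longleftrightarrow> (\<forall>E\<in>\<E>. \<exists>n::nat. \<forall>x\<in>X. finite (E `` {x}) \<and> card (E `` {x}) \<le> n)"

definition cellular :: "'b set \<Rightarrow> ('b \<times> 'b) set set \<Rightarrow> bool" where
  "cellular X \<E> \<longleftrightarrow> (\<exists>\<B>. coarse_base \<E> \<B> \<and> (\<forall>B\<in>\<B>. equiv X B))"

definition coarse_discrete :: "'b set \<Rightarrow> ('b \<times> 'b) set set \<Rightarrow> 'b set \<Rightarrow> bool" where
  "coarse_discrete X \<E> D \<longleftrightarrow> D \<subseteq> X \<and>
     (\<forall>E\<in>\<E>. \<exists>B. coarse_bounded X \<E> B \<and> (\<forall>x\<in>D - B. D \<inter> E `` {x} = {x}))"


section \<open>The Higson corona\<close>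

text \<open>Boundedness of the images is required explicitly because \<^const>\<open>diameter\<close> has no
  meaningful value on unbounded sets.\<close>

definition slowly_oscillating :: "'b set \<Rightarrow> ('b \<times> 'b) set set \<Rightarrow> ('b \<Rightarrow> real) \<Rightarrow> bool" where
  "slowly_oscillating X \<E> \<phi> \<longleftrightarrow>
     (\<forall>\<epsilon>>0. \<forall>E\<in>\<E>. \<exists>B. coarse_bounded X \<E> B \<and>
        (\<forall>x\<in>X - B. bounded (\<phi> ` (E `` {x})) \<and> diameter (\<phi> ` (E `` {x})) < \<epsilon>))"

text \<open>Functions on the carrier \<open>X\<close> are represented by functions that are \<^const>\<open>undefined\<close>
  outside \<open>X\<close>.\<close>

definition so :: "'b set \<Rightarrow> ('b \<times> 'b) set set \<Rightarrow> ('b \<Rightarrow> real) set" where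
  "so X \<E> = {\<phi> \<in> X \<rightarrow>\<^sub>E UNIV. bounded (\<phi> ` X) \<and> slowly_oscillating X \<E> \<phi>}"

definition so_power :: "'b set \<Rightarrow> ('b \<times> 'b) set set \<Rightarrow> (('b \<Rightarrow> real) \<Rightarrow> real) topology" where
  "so_power X \<E> = powertop_real (so X \<E>)"

definition higson_embed :: "'b set \<Rightarrow> ('b \<times> 'b) set set \<Rightarrow> 'b \<Rightarrow> (('b \<Rightarrow> real) \<Rightarrow> real)" where
  "higson_embed X \<E> x = (\<lambda>\<phi>\<in>so X \<E>. \<phi> x)"

definition higson_compactification ::
    "'b set \<Rightarrow> ('b \<times> 'b) set set \<Rightarrow> (('b \<Rightarrow> real) \<Rightarrow> real) topology" where
  "higson_compactification X \<E> =
     subtopology (so_power X \<E>) (so_power X \<E> closure_of (higson_embed X \<E> ` X))"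

definition higson_corona ::
    "'b set \<Rightarrow> ('b \<times> 'b) set set \<Rightarrow> (('b \<Rightarrow> real) \<Rightarrow> real) topology" where
  "higson_corona X \<E> =
     subtopology (higson_compactification X \<E>)
       (topspace (higson_compactification X \<E>) -
        \<Union> {higson_compactification X \<E> closure_of (higson_embed X \<E> ` B) |B. coarse_bounded X \<E> B})"


section \<open>Cardinals\<close>

text \<open>The smallest cardinality of a member of the class \<open>\<C>\<close>. For empty \<open>\<C>\<close>, where there is no
  such cardinal, the value is the cardinal zero (the empty relation); in particular, a statement
  that the smallest cardinality is a given nonzero cardinal entails that \<open>\<C>\<close> is nonempty.\<close>

definition least_card :: "'c set set \<Rightarrow> 'c rel" where
  "least_card \<C> = (if \<C> = {} then {} else |SOME A. A \<in> \<C> \<and> (\<forall>B\<in>\<C>. |A| \<le>o |B| )| )"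

lemma least_card:
  assumes "\<C> \<noteq> {}"
  obtains A where "A \<in> \<C>" "least_card \<C> = |A|" "\<And>B. B \<in> \<C> \<Longrightarrow> least_card \<C> \<le>o |B|"
proof -
  have "\<exists>r\<in>card_of ` \<C>. \<forall>r'\<in>card_of ` \<C>. r \<le>o r'"
    using assms by (intro exists_minim_Card_order) (auto simp: card_of_Card_order)
  then have "\<exists>A. A \<in> \<C> \<and> (\<forall>B\<in>\<C>. |A| \<le>o |B| )" by blast
  from someI_ex[OF this] show thesis
    using assms that unfolding least_card_def by auto
qed

abbreviation \<omega>\<^sub>1 :: "nat set rel" where
  "\<omega>\<^sub>1 \<equiv> cardSuc natLeq"

abbreviation continuum :: "real rel" where
  "continuum \<equiv> |UNIV :: real set|"

definition pseudointersection_number :: "nat set rel" where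
  "pseudointersection_number = least_card {\<F>.
     (\<forall>F\<in>\<F>. infinite F) \<and>
     (\<forall>\<G>. \<G> \<subseteq> \<F> \<longrightarrow> finite \<G> \<longrightarrow> \<G> \<noteq> {} \<longrightarrow> infinite (\<Inter>\<G>)) \<and>
     (\<forall>I. infinite I \<longrightarrow> (\<exists>F\<in>\<F>. infinite (I - F)))}"

definition Delta_cellular :: "(nat \<times> nat) set rel" where
  "Delta_cellular = least_card {\<B>. \<exists>\<E>.
     coarse_space UNIV \<E> \<and> cellular UNIV \<E> \<and> finitary UNIV \<E> \<and>
     \<not> (\<exists>D. infinite D \<and> coarse_discrete UNIV \<E> D) \<and>
     coarse_base \<E> \<B>}"


section \<open>Cardinal invariants and classes of topological spaces\<close>

definition topological_base :: "'a topology \<Rightarrow> 'a set set \<Rightarrow> bool" where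
  "topological_base K \<B> \<longleftrightarrow>
     (\<forall>V\<in>\<B>. openin K V) \<and>
     (\<forall>U x. openin K U \<and> x \<in> U \<longrightarrow> (\<exists>V\<in>\<B>. x \<in> V \<and> V \<subseteq> U))"

definition weight :: "'a topology \<Rightarrow> 'a set rel" where
  "weight K = least_card {\<B>. topological_base K \<B>}"

definition nbhd_base :: "'a topology \<Rightarrow> 'a \<Rightarrow> 'a set set \<Rightarrow> bool" where
  "nbhd_base K x \<B> \<longleftrightarrow>
     (\<forall>V\<in>\<B>. V \<subseteq> topspace K \<and> x \<in> K interior_of V) \<and>
     (\<forall>U. openin K U \<and> x \<in> U \<longrightarrow> (\<exists>V\<in>\<B>. V \<subseteq> U))"

definition character_at :: "'a topology \<Rightarrow> 'a \<Rightarrow> 'a set rel" where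
  "character_at K x = least_card {\<B>. nbhd_base K x \<B>}"

text \<open>The supremum of the cardinals \<^term>\<open>character_at K x\<close> as their least upper bound; it is
  represented on \<^typ>\<open>'a set\<close>, the type on which all of them live.\<close>

definition character :: "'a topology \<Rightarrow> 'a set rel" where
  "character K = least_card {A. \<forall>x\<in>topspace K. character_at K x \<le>o |A|}"

definition perfectly_normal_space :: "'a topology \<Rightarrow> bool" where
  "perfectly_normal_space K \<longleftrightarrow> normal_space K \<and> (\<forall>C. closedin K C \<longrightarrow> gdelta_in K C)"

text \<open>The compact space \<open>C\<close>, which is \<open>c\<nat>\<close> in the usual notation, may be taken on the type
  \<^typ>\<open>nat + 'a\<close> without loss of generality: its points are those of \<open>\<nat>\<close> (the range of
  \<^const>\<open>Inl\<close>) and those of a remainder in bijection with \<^term>\<open>topspace K\<close>.\<close>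

definition is_corona :: "'a topology \<Rightarrow> bool" where
  "is_corona K \<longleftrightarrow> compact_space K \<and> Hausdorff_space K \<and>
     (\<exists>C :: (nat + 'a) topology.
        compact_space C \<and> Hausdorff_space C \<and>
        range Inl = {x \<in> topspace C. openin C {x}} \<and>
        C closure_of range Inl = topspace C \<and>
        K homeomorphic_space subtopology C (topspace C - range Inl))"

end

theory Submission
  imports Defs "HOL-Library.Countable_Set_Type"
begin

text \<open>
  A compactification of \<open>\<nat>\<close> with remainder \<open>K\<close> is coded by real sequences \<open>s\<^sub>f\<close>, for \<open>f\<close> in a
  separating family of continuous functions on \<open>K\<close>, such that the limit points of
  \<open>n \<mapsto> (s\<^sub>f(n))\<^sub>f\<close> are exactly the points \<open>(f(x))\<^sub>f\<close>, \<open>x \<in> K\<close>. If all \<open>s\<^sub>f\<close> oscillate slowly with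
  respect to a finitary coarse structure, and any two sets \<open>A, B \<subseteq> \<nat>\<close> with a common limit point
  \<open>x \<in> K\<close> are joined by an entourage containing infinitely many pairs of \<open>A \<times> B\<close>, then every bounded
  slowly oscillating function has a limit at each \<open>x \<in> K\<close>, and the Higson corona is \<open>K\<close>.

  When every limit point of a set is the limit of a subsequence, sequences in \<open>A\<close> and \<open>B\<close> converging
  to \<open>x\<close> are matched. Taking all entourages along which the \<open>s\<^sub>f\<close> oscillate slowly gives a finitary
  structure. A cellular one arises by a recursion of length \<open>\<c>\<close> through all pairs \<open>(A, B)\<close>:
  as long as fewer than \<open>\<Delta>\<^sup>\<circ>\<^sub>\<omega>\<close> matchings were chosen, infinite sets contain infinite discrete subsets,
  so that the new matching can be taken sparse enough to keep the generated structure finitary.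
  Subsequences exist for characters below \<open>\<p>\<close> by the definition of \<open>\<p>\<close>, and for countable characters
  by diagonalisation.

  For weight at most \<open>\<omega>\<^sub>1\<close> the sequences \<open>s\<^sub>f\<close> are built by a recursion of length \<open>\<omega>\<^sub>1\<close> in which every
  stage is metrizable; under CH the matchings are chosen in the same recursion. A perfectly normal
  \<open>K\<close> has a dense set of size at most \<open>\<omega>\<^sub>1\<close>, hence an irreducible quotient of weight at most \<open>\<omega>\<^sub>1\<close>;
  the sequences for the quotient extend to all of \<open>C(K)\<close> because each closed set is determined by
  countably many functions, and irreducibility shows that no point of \<open>K\<close> is lost.
\<close>

section \<open>Joining classes along pairings\<close>

text \<open>Two demands conflict. Pairings must be so plentiful that every bounded function slow
  along them has a limit at each point of \<open>K\<close>. Yet finitely many of them may generate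
  only classes of bounded size, and every coding sequence must be slow along all of them. A new
  pairing is safe for the classes if, up to finitely many exceptions, its points lie in different
  classes of any old finite join; this is what sparseness buys, and why \<open>thinnable\<close> is
  carried along. A new sequence is safe for the old pairings if it factors through a map merging
  their pairs: for countably many pairings and sequences there is a finite-to-one retraction of
  \<nat> that merges all but finitely many pairs of each pairing and changes every old sequence by a
  null sequence (\<open>collapse_classes\<close>). Hence the stages of the recursion of length
  \<open>\<omega>\<^sub>1\<close> are kept countable. In the perfectly normal case a new sequence
  might lose limit points, so the extension step keeps only \<open>approx_in\<close>;
  \<open>approx_onto\<close> is recovered at the end from a dense set of points, each singled out by
  functions coded at the start.\<close>

definition uniformly_finite :: "('b \<times> 'b) set \<Rightarrow> bool" where
  "uniformly_finite R \<longleftrightarrow> (\<exists>k::nat. \<forall>x. finite (R `` {x}) \<and> card (R `` {x}) \<le> k)"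

text \<open>Bounding only finite unions makes this a property of finite character, so a transfinite
  recursion needs no argument at limit stages. The bound may grow with the number of
  pairings.\<close>

definition pairing_family :: "('b \<times> 'b) set set \<Rightarrow> bool" where
  "pairing_family \<P> \<longleftrightarrow> (\<forall>\<pi>\<in>\<P>. sym \<pi>) \<and> (\<forall>S\<subseteq>\<P>. finite S \<longrightarrow> uniformly_finite ((\<Union>S)\<^sup>*))"

lemma uniformly_finite_mono:
  assumes "uniformly_finite R" "Q \<subseteq> R"
  shows "uniformly_finite Q"
proof -
  obtain k where k: "\<And>x. finite (R `` {x}) \<and> card (R `` {x}) \<le> k"
    using assms unfolding uniformly_finite_def by auto
  have "finite (Q `` {x}) \<and> card (Q `` {x}) \<le> k" for x
    using k[of x] assms(2) card_mono[of "R `` {x}" "Q `` {x}"] finite_subset[of "Q `` {x}" "R `` {x}"]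
    by (auto intro: order_trans)
  then show ?thesis
    unfolding uniformly_finite_def by blast
qed

lemma uniformly_finite_finite_Image:
  assumes "uniformly_finite R" "finite T"
  shows "finite (R `` T)"
proof -
  have "R `` T = (\<Union>x\<in>T. R `` {x})" by auto
  moreover have "finite (R `` {x})" for x
    using assms(1) unfolding uniformly_finite_def by blast
  ultimately show ?thesis
    using assms(2) by simp
qed

lemma pairing_family_sym: "pairing_family \<P> \<Longrightarrow> S \<subseteq> \<P> \<Longrightarrow> sym ((\<Union>S)\<^sup>*)"
  unfolding pairing_family_def by (intro sym_rtrancl symI) (meson UnionE UnionI subsetD symD)

lemma pairing_family_subset: "pairing_family \<P> \<Longrightarrow> \<Q> \<subseteq> \<P> \<Longrightarrow> pairing_family \<Q>"
  unfolding pairing_family_def by blast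

lemma pairing_familyD:
  assumes "pairing_family \<P>" "S \<subseteq> \<P>" "finite S"
  shows "uniformly_finite ((\<Union>S)\<^sup>*)"
  using assms unfolding pairing_family_def by blast

lemma pairing_family_image:
  assumes "\<And>S. S \<subseteq> J \<Longrightarrow> finite S \<Longrightarrow> pairing_family (p ` S)"
  shows "pairing_family (p ` J)"
  unfolding pairing_family_def
proof (intro conjI ballI allI impI)
  fix \<pi> assume "\<pi> \<in> p ` J"
  then obtain j where "j \<in> J" "\<pi> = p j" by auto
  with assms[of "{j}"] show "sym \<pi>"
    unfolding pairing_family_def by auto
next
  fix S assume "S \<subseteq> p ` J" "finite S"
  then obtain J' where "J' \<subseteq> J" "finite J'" "S = p ` J'"
    using finite_subset_image by metis
  with assms[of J'] show "uniformly_finite ((\<Union>S)\<^sup>*)"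
    using pairing_familyD by blast
qed

lemma rtrancl_Image_closed:
  assumes "x \<in> C" "R `` C \<subseteq> C"
  shows "R\<^sup>* `` {x} \<subseteq> C"
  using Image_closed_trancl[OF assms(2)] assms(1) by blast

text \<open>Off the finite \<open>R\<close>-saturation of \<open>T\<close>, each class of
  \<open>R\<close> contains at most one point of \<open>Q\<close>, and that point has one partner.
  So a joined class is one old class, or two old classes glued along a single edge, or lies in the
  saturation of \<open>T\<close>; hence the bound \<open>card C + 2 * k\<close>.\<close>

lemma uniformly_finite_join:
  assumes fin: "uniformly_finite R" and R: "refl R" "sym R" "trans R"
    and Q: "sym Q" and T: "finite T"
    and inside: "\<And>a b. (a, b) \<in> Q \<Longrightarrow> a \<in> R `` T \<Longrightarrow> b \<in> R `` T"
    and outside: "\<And>a b. (a, b) \<in> Q \<Longrightarrow> a \<notin> R `` T \<Longrightarrow> R `` {a} \<inter> Domain Q = {a} \<and> Q `` {a} = {b}"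
  shows "uniformly_finite ((R \<union> Q)\<^sup>*)"
proof -
  obtain k where k: "\<And>x. finite (R `` {x}) \<and> card (R `` {x}) \<le> k"
    using fin unfolding uniformly_finite_def by auto
  define C where "C = R `` T"
  have finC: "finite C"
    unfolding C_def by (rule uniformly_finite_finite_Image[OF fin T])
  have CR: "R `` C \<subseteq> C"
    unfolding C_def using R(3) by (auto elim: transE)
  have CQ: "Q `` C \<subseteq> C"
    unfolding C_def using inside by blast
  have "finite ((R \<union> Q)\<^sup>* `` {x}) \<and> card ((R \<union> Q)\<^sup>* `` {x}) \<le> card C + 2 * k" for x
  proof -
    have *: "finite ((R \<union> Q)\<^sup>* `` {x}) \<and> card ((R \<union> Q)\<^sup>* `` {x}) \<le> card D"
      if "x \<in> D" "(R \<union> Q) `` D \<subseteq> D" "finite D" for D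
      using rtrancl_Image_closed[OF that(1,2)] that(3) finite_subset card_mono by metis
    consider "x \<in> C" | "x \<notin> C" "R `` {x} \<inter> Domain Q = {}" | y where "x \<notin> C" "(x, y) \<in> R" "y \<in> Domain Q"
      by blast
    then show ?thesis
    proof cases
      case 1
      then show ?thesis
        using *[of C] CR CQ finC by fastforce
    next
      case 2
      have "x \<in> R `` {x}" using R(1) by (auto simp: refl_on_def)
      moreover have "(R \<union> Q) `` (R `` {x}) \<subseteq> R `` {x}"
        using 2 R(3) by (auto elim: transE)
      ultimately show ?thesis
        using *[of "R `` {x}"] k[of x] by auto
    next
      case 3
      then obtain z where z: "(y, z) \<in> Q" by blast
      have y: "y \<notin> C"
        using 3 CR symD[OF R(2) 3(2)] by blast
      have z': "z \<notin> C"
        using y CQ symD[OF Q z] by blast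
      have zy: "(z, y) \<in> Q" by (rule symD[OF Q z])
      have oy: "R `` {y} \<inter> Domain Q = {y}" "Q `` {y} = {z}"
        using outside[OF z] y C_def by auto
      have oz: "R `` {z} \<inter> Domain Q = {z}" "Q `` {z} = {y}"
        using outside[OF zy] z' C_def by auto
      \<comment> \<open>\<open>y\<close> and \<open>z\<close> are the only points of their classes
        touched by \<open>Q\<close>, and they are partners of each other alone, so the union of the
        two classes is closed under both relations.\<close>
      define D where "D = R `` {y} \<union> R `` {z}"
      have "y \<in> D" "z \<in> D"
        unfolding D_def using R(1) by (auto simp: refl_on_def)
      have "x \<in> D"
        unfolding D_def using 3 symD[OF R(2)] by blast
      moreover have "R `` D \<subseteq> D"
        unfolding D_def using R(3) by (auto elim: transE)
      moreover have "Q `` D \<subseteq> D"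
      proof
        fix v assume "v \<in> Q `` D"
        then obtain w where w: "w \<in> D" "(w, v) \<in> Q" by auto
        then have "w = y \<or> w = z"
          using oy(1) oz(1) unfolding D_def by blast
        then have "v \<in> Q `` {y} \<union> Q `` {z}"
          using w by blast
        then show "v \<in> D"
          unfolding oy(2) oz(2) using \<open>y \<in> D\<close> \<open>z \<in> D\<close> by auto
      qed
      moreover have "finite D" "card D \<le> 2 * k"
        unfolding D_def using k[of y] k[of z] card_Un_le[of "R `` {y}" "R `` {z}"] by auto
      ultimately have "finite ((R \<union> Q)\<^sup>* `` {x}) \<and> card ((R \<union> Q)\<^sup>* `` {x}) \<le> card D" "card D \<le> 2 * k"
        using *[of D] by (auto simp: Un_Image)
      then show ?thesis by linarith
    qed
  qed
  then show ?thesis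
    unfolding uniformly_finite_def by blast
qed

text \<open>The combinatorial form of: every infinite set contains an infinite subset that is
  discrete for the coarse structure generated by \<P>.\<close>

definition thinnable :: "('b \<times> 'b) set set \<Rightarrow> bool" where
  "thinnable \<P> \<longleftrightarrow> (\<forall>A. infinite A \<longrightarrow> (\<exists>D\<subseteq>A. infinite D \<and>
     (\<forall>S\<subseteq>\<P>. finite S \<longrightarrow> finite {a\<in>D. (\<Union>S)\<^sup>* `` {a} \<inter> D \<noteq> {a}})))"

lemma thinnableE:
  assumes "thinnable \<P>" "infinite A"
  obtains D where "D \<subseteq> A" "infinite D"
    "\<And>S. S \<subseteq> \<P> \<Longrightarrow> finite S \<Longrightarrow> finite {a\<in>D. (\<Union>S)\<^sup>* `` {a} \<inter> D \<noteq> {a}}"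
  using assms(1)[unfolded thinnable_def, rule_format, OF assms(2)] by blast

text \<open>A relation inside a finite join generates nothing new: a join that uses it lies in the
  join of the other members together with \<open>S\<close>.\<close>

lemma pairing_family_insert_link:
  assumes \<P>: "pairing_family \<P>" and S: "S \<subseteq> \<P>" "finite S"
    and \<pi>: "sym \<pi>" "\<pi> \<subseteq> (\<Union>S)\<^sup>*"
  shows "pairing_family (insert \<pi> \<P>)"
  unfolding pairing_family_def
proof (intro conjI ballI allI impI)
  fix \<rho> assume "\<rho> \<in> insert \<pi> \<P>"
  then show "sym \<rho>"
    using \<P> \<pi> unfolding pairing_family_def by auto
next
  fix S' assume S': "S' \<subseteq> insert \<pi> \<P>" "finite S'"
  define S'' where "S'' = (S' - {\<pi>}) \<union> S"
  have "\<Union>S' \<subseteq> (\<Union>S'')\<^sup>*"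
  proof -
    have "\<pi> \<subseteq> (\<Union>S'')\<^sup>*"
      using \<pi>(2) rtrancl_mono[of "\<Union>S" "\<Union>S''"] unfolding S''_def by blast
    moreover have "\<Union>(S' - {\<pi>}) \<subseteq> (\<Union>S'')\<^sup>*"
      unfolding S''_def by auto
    ultimately show ?thesis by blast
  qed
  then have "(\<Union>S')\<^sup>* \<subseteq> (\<Union>S'')\<^sup>*"
    by (rule rtrancl_subset_rtrancl)
  moreover have "uniformly_finite ((\<Union>S'')\<^sup>*)"
    using \<P> S S' unfolding S''_def by (intro pairing_familyD[of \<P>]) auto
  ultimately show "uniformly_finite ((\<Union>S')\<^sup>*)"
    by (rule uniformly_finite_mono[rotated])
qed

lemma pairing_family_insert_thin:
  assumes \<P>: "pairing_family \<P>" and \<pi>: "sym \<pi>" "single_valued \<pi>"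
    and thin: "\<And>S. S \<subseteq> \<P> \<Longrightarrow> finite S \<Longrightarrow>
      finite {a \<in> Domain \<pi>. (\<Union>S)\<^sup>* `` {a} \<inter> Domain \<pi> \<noteq> {a}}"
  shows "pairing_family (insert \<pi> \<P>)"
  unfolding pairing_family_def
proof (intro conjI ballI allI impI)
  fix \<rho> assume "\<rho> \<in> insert \<pi> \<P>"
  then show "sym \<rho>"
    using \<P> \<pi> unfolding pairing_family_def by auto
next
  fix S' assume S': "S' \<subseteq> insert \<pi> \<P>" "finite S'"
  define S where "S = S' - {\<pi>}"
  define R where "R = (\<Union>S)\<^sup>*"
  have S: "S \<subseteq> \<P>" "finite S" unfolding S_def using S' by auto
  have uf: "uniformly_finite R"
    unfolding R_def using pairing_familyD[OF \<P> S] .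
  have R: "refl R" "sym R" "trans R"
    unfolding R_def using pairing_family_sym[OF \<P> S(1)] by (auto simp: refl_rtrancl trans_rtrancl)
  define Bad where "Bad = {a \<in> Domain \<pi>. R `` {a} \<inter> Domain \<pi> \<noteq> {a}}"
  \<comment> \<open>The partners of bad points are added so that the exceptional set is closed under
    \<pi>.\<close>
  define T where "T = Bad \<union> \<pi> `` Bad"
  have "finite Bad" unfolding Bad_def R_def by (rule thin[OF S])
  have "\<pi> `` Bad \<subseteq> (\<lambda>a. THE b. (a, b) \<in> \<pi>) ` Bad"
  proof
    fix b assume "b \<in> \<pi> `` Bad"
    then obtain a where a: "a \<in> Bad" "(a, b) \<in> \<pi>" by auto
    then have "(THE b. (a, b) \<in> \<pi>) = b"
      using \<pi>(2) by (auto simp: single_valued_def)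
    then show "b \<in> (\<lambda>a. THE b. (a, b) \<in> \<pi>) ` Bad" using a by force
  qed
  then have "finite T"
    unfolding T_def using \<open>finite Bad\<close> finite_surj[of Bad] by auto
  have Tdom: "T \<subseteq> Domain \<pi>"
    unfolding T_def Bad_def using symD[OF \<pi>(1)] by blast
  have TT: "\<pi> `` T \<subseteq> T"
    unfolding T_def using symD[OF \<pi>(1)] single_valuedD[OF \<pi>(2)] by blast
  have TR: "T \<subseteq> R `` T" using R(1) by (auto simp: refl_on_def)
  have "uniformly_finite ((R \<union> \<pi>)\<^sup>*)"
  proof (rule uniformly_finite_join[OF uf R \<pi>(1) \<open>finite T\<close>])
    fix a b assume ab: "(a, b) \<in> \<pi>"
    have inT: "a \<in> T" if aT: "a \<in> R `` T"
    proof (cases "a \<in> Bad")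
      case True then show ?thesis by (simp add: T_def)
    next
      case False
      \<comment> \<open>A point of the domain that is not bad is the only domain point in its class.
        As \<open>t\<close> is a domain point of that class, it must be \<open>a\<close>.\<close>
      obtain t where t: "t \<in> T" "(t, a) \<in> R" using aT by auto
      have "t \<in> R `` {a} \<inter> Domain \<pi>" using t symD[OF R(2) t(2)] Tdom by blast
      then have "t = a" using False ab unfolding Bad_def by blast
      then show ?thesis using t by simp
    qed
    then show "b \<in> R `` T" if "a \<in> R `` T"
      using that TT TR ab by blast
    assume "a \<notin> R `` T"
    then have "a \<notin> Bad" using TR T_def by blast
    then show "R `` {a} \<inter> Domain \<pi> = {a} \<and> \<pi> `` {a} = {b}"
      using ab \<pi>(2) unfolding Bad_def single_valued_def by blast
  qed
  moreover have "(\<Union>S')\<^sup>* \<subseteq> (R \<union> \<pi>)\<^sup>*"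
    by (rule rtrancl_mono) (auto simp: R_def S_def)
  ultimately show "uniformly_finite ((\<Union>S')\<^sup>*)"
    by (rule uniformly_finite_mono)
qed

text \<open>A dichotomy. If some finite join already links \<open>A\<close> and \<open>B\<close>
  infinitely often, its restriction to them costs nothing. Otherwise every finite join links them
  only finitely often, so thin subsets of \<open>A\<close> and \<open>B\<close> stay thin when put
  together and can be matched along their enumerations.\<close>

lemma pairing_family_extend:
  fixes A B :: "nat set"
  assumes \<P>: "pairing_family \<P>" and thin: "thinnable \<P>" and A: "infinite A" and B: "infinite B"
  obtains \<pi> where "sym \<pi>" "\<pi> \<subseteq> A \<times> B \<union> B \<times> A" "infinite (\<pi> \<inter> A \<times> B)" "pairing_family (insert \<pi> \<P>)"
proof (cases "\<exists>S\<subseteq>\<P>. finite S \<and> infinite ((\<Union>S)\<^sup>* \<inter> A \<times> B)")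
  case True
  then obtain S where S: "S \<subseteq> \<P>" "finite S" "infinite ((\<Union>S)\<^sup>* \<inter> A \<times> B)" by blast
  define \<pi> where "\<pi> = (\<Union>S)\<^sup>* \<inter> (A \<times> B \<union> B \<times> A)"
  have sym: "sym \<pi>"
    unfolding \<pi>_def using pairing_family_sym[OF \<P> S(1)] by (auto simp: sym_def)
  show thesis
  proof (rule that[OF sym])
    show "infinite (\<pi> \<inter> A \<times> B)"
      using S(3) by (rule contrapos_nn) (auto simp: \<pi>_def elim!: finite_subset[rotated])
    show "pairing_family (insert \<pi> \<P>)"
      by (rule pairing_family_insert_link[OF \<P> S(1,2) sym]) (auto simp: \<pi>_def)
  qed (auto simp: \<pi>_def)
next
  case False
  then have fin: "\<And>S. S \<subseteq> \<P> \<Longrightarrow> finite S \<Longrightarrow> finite ((\<Union>S)\<^sup>* \<inter> A \<times> B)" by blast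
  obtain A' where A': "A' \<subseteq> A" "infinite A'"
    "\<And>S. S \<subseteq> \<P> \<Longrightarrow> finite S \<Longrightarrow> finite {a\<in>A'. (\<Union>S)\<^sup>* `` {a} \<inter> A' \<noteq> {a}}"
    by (rule thinnableE[OF thin A]) blast
  obtain B' where B': "B' \<subseteq> B" "infinite B'"
    "\<And>S. S \<subseteq> \<P> \<Longrightarrow> finite S \<Longrightarrow> finite {a\<in>B'. (\<Union>S)\<^sup>* `` {a} \<inter> B' \<noteq> {a}}"
    by (rule thinnableE[OF thin B]) blast
  have "finite (A \<inter> B)"
  proof -
    \<comment> \<open>The join of no pairings is the identity, so the case assumption also bounds
      the overlap of \<open>A\<close> and \<open>B\<close>.\<close>
    have "A \<inter> B \<subseteq> fst ` ((\<Union>{})\<^sup>* \<inter> A \<times> B)" by force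
    then show ?thesis using fin[of "{}"] by (meson empty_subsetI finite.emptyI finite_imageI finite_subset)
  qed
  define B'' where "B'' = B' - A'"
  have "B' - (A \<inter> B) \<subseteq> B''" unfolding B''_def using A' B' by auto
  then have B'': "B'' \<subseteq> B'" "infinite B''" "A' \<inter> B'' = {}"
    using B'(2) \<open>finite (A \<inter> B)\<close> Diff_infinite_finite[of "A \<inter> B" B'] finite_subset[of "B' - (A \<inter> B)" B'']
    unfolding B''_def by blast+
  define u where "u = enumerate A'"
  define v where "v = enumerate B''"
  have u: "bij_betw u UNIV A'" and v: "bij_betw v UNIV B''"
    unfolding u_def v_def using A'(2) B''(2) bij_enumerate by auto
  define \<pi> where "\<pi> = range (\<lambda>n. (u n, v n)) \<union> range (\<lambda>n. (v n, u n))"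
  have inj: "u i = u j \<longleftrightarrow> i = j" "v i = v j \<longleftrightarrow> i = j" and ne: "u i \<noteq> v j" "v j \<noteq> u i" for i j
    using u v B''(3) unfolding bij_betw_def inj_def by blast+
  have "u i \<in> A'" "v i \<in> B''" for i
    using u v unfolding bij_betw_def by auto
  then have mem: "u i \<in> A" "v i \<in> B" for i
    using A'(1) B'(1) B''(1) by (meson subsetD)+
  have sym: "sym \<pi>" unfolding \<pi>_def by (auto simp: sym_def)
  have sv: "single_valued \<pi>"
    unfolding \<pi>_def by (auto simp: single_valued_def inj ne)
  have dom: "Domain \<pi> = A' \<union> B''"
    using u v unfolding \<pi>_def bij_betw_def by auto
  show thesis
  proof (rule that[OF sym])
    show "\<pi> \<subseteq> A \<times> B \<union> B \<times> A"
      using mem unfolding \<pi>_def by auto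
    have "range (\<lambda>n. (u n, v n)) \<subseteq> \<pi> \<inter> A \<times> B"
      using mem unfolding \<pi>_def by auto
    moreover have "infinite (range (\<lambda>n. (u n, v n)))"
      by (rule range_inj_infinite) (auto simp: inj_def inj)
    ultimately show "infinite (\<pi> \<inter> A \<times> B)"
      using finite_subset by blast
    show "pairing_family (insert \<pi> \<P>)"
    proof (rule pairing_family_insert_thin[OF \<P> sym sv])
      fix S assume S: "S \<subseteq> \<P>" "finite S"
      define R where "R = (\<Union>S)\<^sup>*"
      have symR: "sym R" unfolding R_def by (rule pairing_family_sym[OF \<P> S(1)])
      have refl: "(a, a) \<in> R" for a unfolding R_def by auto
      \<comment> \<open>Two distinct domain points in one class lie both in \<open>A'\<close>, both
        in \<open>B'\<close>, or one on each side; the last kind is finite by the case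
        assumption.\<close>
      have "{a \<in> Domain \<pi>. R `` {a} \<inter> Domain \<pi> \<noteq> {a}} \<subseteq>
          {a\<in>A'. R `` {a} \<inter> A' \<noteq> {a}} \<union> {a\<in>B'. R `` {a} \<inter> B' \<noteq> {a}} \<union> (fst ` (R \<inter> A \<times> B) \<union> snd ` (R \<inter> A \<times> B))"
        (is "?L \<subseteq> ?R")
      proof
        fix a assume a: "a \<in> ?L"
        then obtain c where c: "c \<in> A' \<union> B''" "(a, c) \<in> R" "c \<noteq> a" "a \<in> A' \<union> B''"
          using refl unfolding dom by blast
        have "(c, a) \<in> R" by (rule symD[OF symR c(2)])
        then have "(a, c) \<in> R \<inter> A \<times> B \<or> (c, a) \<in> R \<inter> A \<times> B \<or> a \<in> A' \<and> c \<in> A' \<or> a \<in> B' \<and> c \<in> B'"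
          using c A'(1) B'(1) B''(1) by blast
        then show "a \<in> ?R"
        proof (elim disjE)
          assume "(a, c) \<in> R \<inter> A \<times> B"
          then show ?thesis using image_eqI[of a fst "(a, c)"] by simp
        next
          assume "(c, a) \<in> R \<inter> A \<times> B"
          then show ?thesis using image_eqI[of a snd "(c, a)"] by simp
        qed (use c in blast)+
      qed
      moreover have "finite ?R"
        using A'(3)[OF S] B'(3)[OF S] fin[OF S] unfolding R_def by (intro finite_UnI finite_imageI)
      ultimately show "finite {a \<in> Domain \<pi>. (\<Union>S)\<^sup>* `` {a} \<inter> Domain \<pi> \<noteq> {a}}"
        unfolding R_def by (rule finite_subset)
    qed
  qed
qed

section \<open>Sequences approximating a compact space\<close>

text \<open>
  A pair \<open>(f, s)\<close> couples a function on \<open>K\<close> with the sequence that stands for its values on \<open>\<nat>\<close>.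
  The predicates below involve only finitely many pairs at a time, so they pass to unions of chains.
\<close>

type_synonym 'a coding = "(('a \<Rightarrow> real) \<times> (nat \<Rightarrow> real)) set"

abbreviation dev :: "('a \<Rightarrow> real) \<times> (nat \<Rightarrow> real) \<Rightarrow> nat \<Rightarrow> 'a \<Rightarrow> real" where
  "dev g n x \<equiv> \<bar>snd g n - fst g x\<bar>"

text \<open>For continuous functions on a compact space, \<open>approx_in\<close> and
  \<open>approx_onto\<close> are the two inclusions behind the statement that the limit points of
  the coded sequence are exactly the value vectors of points of the space.\<close>

definition approx_in :: "'a set \<Rightarrow> 'a coding \<Rightarrow> bool" where
  "approx_in T G \<longleftrightarrow> (\<forall>S\<subseteq>G. finite S \<longrightarrow> (\<forall>\<epsilon>>0. \<forall>\<^sub>F n in sequentially.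
     \<exists>x\<in>T. \<forall>g\<in>S. dev g n x < \<epsilon>))"

definition clusters :: "'a coding \<Rightarrow> nat set \<Rightarrow> 'a \<Rightarrow> bool" where
  "clusters G A x \<longleftrightarrow> (\<forall>S\<subseteq>G. finite S \<longrightarrow> (\<forall>\<epsilon>>0. \<exists>\<^sub>F n in sequentially.
     n \<in> A \<and> (\<forall>g\<in>S. dev g n x < \<epsilon>)))"

definition approx_onto :: "'a set \<Rightarrow> 'a coding \<Rightarrow> bool" where
  "approx_onto T G \<longleftrightarrow> (\<forall>x\<in>T. clusters G UNIV x)"

definition converges :: "'a coding \<Rightarrow> nat set \<Rightarrow> 'a \<Rightarrow> bool" where
  "converges G A x \<longleftrightarrow> (\<forall>g\<in>G. \<forall>\<epsilon>>0. \<forall>\<^sub>F n in sequentially. n \<in> A \<longrightarrow> dev g n x < \<epsilon>)"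

text \<open>When \<open>R\<close> has finite sections in both directions, this is slow oscillation
  along \<open>R\<close>: exceptions inside a bounded set become finitely many exceptional
  pairs.\<close>

definition slow_on :: "(nat \<Rightarrow> real) \<Rightarrow> (nat \<times> nat) set \<Rightarrow> bool" where
  "slow_on s R \<longleftrightarrow> (\<forall>\<epsilon>>0. finite {p \<in> R. \<epsilon> \<le> \<bar>s (fst p) - s (snd p)\<bar>})"

lemma approx_in_subset: "approx_in T G \<Longrightarrow> H \<subseteq> G \<Longrightarrow> approx_in T H"
  unfolding approx_in_def by (meson order_trans)

lemma clusters_subset: "clusters G A x \<Longrightarrow> H \<subseteq> G \<Longrightarrow> clusters H A x"
  unfolding clusters_def by (meson order_trans)

lemma approx_inD:
  "approx_in T G \<Longrightarrow> S \<subseteq> G \<Longrightarrow> finite S \<Longrightarrow> \<epsilon> > 0 \<Longrightarrow>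
    \<forall>\<^sub>F n in sequentially. \<exists>x\<in>T. \<forall>g\<in>S. dev g n x < \<epsilon>"
  unfolding approx_in_def by blast

lemma clustersD:
  "clusters G A x \<Longrightarrow> S \<subseteq> G \<Longrightarrow> finite S \<Longrightarrow> \<epsilon> > 0 \<Longrightarrow>
    \<exists>\<^sub>F n in sequentially. n \<in> A \<and> (\<forall>g\<in>S. dev g n x < \<epsilon>)"
  unfolding clusters_def by blast

lemma slow_on_subset: "slow_on s R \<Longrightarrow> Q \<subseteq> R \<Longrightarrow> slow_on s Q"
  unfolding slow_on_def by (auto elim!: finite_subset[rotated])

lemma slow_on_union: "slow_on s R \<Longrightarrow> slow_on s Q \<Longrightarrow> slow_on s (R \<union> Q)"
proof (unfold slow_on_def, intro allI impI)
  fix \<epsilon> :: real assume "\<forall>\<epsilon>>0. finite {p \<in> R. \<epsilon> \<le> \<bar>s (fst p) - s (snd p)\<bar>}"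
    "\<forall>\<epsilon>>0. finite {p \<in> Q. \<epsilon> \<le> \<bar>s (fst p) - s (snd p)\<bar>}" "0 < \<epsilon>"
  then have "finite ({p \<in> R. \<epsilon> \<le> \<bar>s (fst p) - s (snd p)\<bar>} \<union> {p \<in> Q. \<epsilon> \<le> \<bar>s (fst p) - s (snd p)\<bar>})"
    by auto
  then show "finite {p \<in> R \<union> Q. \<epsilon> \<le> \<bar>s (fst p) - s (snd p)\<bar>}"
    by (rule finite_subset[rotated]) auto
qed

lemma slow_on_finite: "finite R \<Longrightarrow> slow_on s R"
  unfolding slow_on_def by auto

lemma slow_on_Union: "finite S \<Longrightarrow> (\<And>\<pi>. \<pi> \<in> S \<Longrightarrow> slow_on s \<pi>) \<Longrightarrow> slow_on s (\<Union>S)"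
  by (induction S rule: finite_induct) (auto intro: slow_on_union slow_on_finite)

text \<open>A class has at most \<open>k\<close> points, so two of its points are joined by a chain
  of at most \<open>k * k\<close> edges inside the class. Only finitely many classes contain an edge
  with a large jump; elsewhere the small jumps add up.\<close>

lemma slow_on_rtrancl:
  assumes fin: "uniformly_finite (R\<^sup>*)" and sym: "sym R" and slow: "slow_on s R"
  shows "slow_on s (R\<^sup>*)"
  unfolding slow_on_def
proof (intro allI impI)
  fix \<epsilon> :: real assume \<epsilon>: "0 < \<epsilon>"
  obtain k where k: "\<And>x. finite (R\<^sup>* `` {x}) \<and> card (R\<^sup>* `` {x}) \<le> k"
    using fin unfolding uniformly_finite_def by auto
  \<comment> \<open>\<open>k * k\<close> bounds the number of edges in a class, hence the length of
    a chain; the extra 1 makes the final estimate strict.\<close>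
  define \<delta> where "\<delta> = \<epsilon> / (real (k * k) + 1)"
  have \<delta>: "\<delta> > 0" unfolding \<delta>_def using \<epsilon> by (simp add: add_nonneg_pos)
  define X where "X = {p \<in> R. \<delta> \<le> \<bar>s (fst p) - s (snd p)\<bar>}"
  have "finite X" using slow \<delta> unfolding slow_on_def X_def by blast
  define B where "B = R\<^sup>* `` (fst ` X)"
  have B: "finite B"
    unfolding B_def by (rule uniformly_finite_finite_Image[OF fin]) (simp add: \<open>finite X\<close>)
  have symR: "sym (R\<^sup>*)" by (rule sym_rtrancl[OF sym])
  have small: "\<bar>s x - s y\<bar> < \<epsilon>" if x: "x \<notin> B" and xy: "(x, y) \<in> R\<^sup>*" for x y
  proof -
    define C where "C = R\<^sup>* `` {x}"
    have finC: "finite C" "card C \<le> k" unfolding C_def using k by auto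
    define Q where "Q = R \<inter> C \<times> C"
    have "finite Q" unfolding Q_def using finC by auto
    have "card Q \<le> card (C \<times> C)" unfolding Q_def using finC by (intro card_mono) auto
    also have "\<dots> \<le> k * k" using finC by (simp add: card_cartesian_product mult_le_mono)
    finally have cQ: "card Q \<le> k * k" .
    have xC: "x \<in> C" unfolding C_def by auto
    have Qxy: "(x, y) \<in> Q\<^sup>*" using xy
    proof (induction rule: rtrancl_induct)
      case (step y z)
      then have "(y, z) \<in> Q" unfolding Q_def C_def by auto
      then show ?case using step by auto
    qed auto
    have nX: "\<bar>s a - s b\<bar> < \<delta>" if "(a, b) \<in> Q" for a b
    proof (rule ccontr)
      assume "\<not> ?thesis"
      then have "(a, b) \<in> X" using that unfolding X_def Q_def by auto
      then have "a \<in> fst ` X" by force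
      moreover have "(a, x) \<in> R\<^sup>*" using that symD[OF symR] unfolding Q_def C_def by blast
      ultimately show False using x unfolding B_def by blast
    qed
    have pw: "\<bar>s a - s b\<bar> \<le> real n * \<delta>" if "(a, b) \<in> Q ^^ n" for n a b
      using that
    proof (induction n arbitrary: b)
      case (Suc n)
      then obtain c where c: "(a, c) \<in> Q ^^ n" "(c, b) \<in> Q" by auto
      have "\<bar>s a - s b\<bar> \<le> \<bar>s a - s c\<bar> + \<bar>s c - s b\<bar>" by linarith
      also have "\<dots> \<le> real n * \<delta> + \<delta>" using Suc.IH[OF c(1)] nX[OF c(2)] by linarith
      finally show ?case by (simp add: algebra_simps)
    qed auto
    obtain n where n: "n \<le> card Q" "(x, y) \<in> Q ^^ n"
      using Qxy rtrancl_finite_eq_relpow[OF \<open>finite Q\<close>] by auto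
    have "\<bar>s x - s y\<bar> \<le> real n * \<delta>" by (rule pw[OF n(2)])
    also have "\<dots> \<le> real (k * k) * \<delta>" using n(1) cQ \<delta> by (intro mult_right_mono) (simp_all add: of_nat_mono del: of_nat_mult)
    also have "\<dots> < (real (k * k) + 1) * \<delta>" using \<delta> by (simp add: algebra_simps)
    also have "\<dots> = \<epsilon>" unfolding \<delta>_def using of_nat_0_le_iff[of "k * k"] by (simp del: of_nat_mult)
    finally show ?thesis .
  qed
  have "{p \<in> R\<^sup>*. \<epsilon> \<le> \<bar>s (fst p) - s (snd p)\<bar>} \<subseteq> B \<times> R\<^sup>* `` B"
  proof
    fix p assume p: "p \<in> {p \<in> R\<^sup>*. \<epsilon> \<le> \<bar>s (fst p) - s (snd p)\<bar>}"
    then have "fst p \<in> B" using small[of "fst p" "snd p"] by force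
    then show "p \<in> B \<times> R\<^sup>* `` B" using p by (cases p) auto
  qed
  then show "finite {p \<in> R\<^sup>*. \<epsilon> \<le> \<bar>s (fst p) - s (snd p)\<bar>}"
    using B uniformly_finite_finite_Image[OF fin B] by (meson finite_SigmaI finite_subset)
qed

text \<open>Both ends of a pair tend to \<open>x\<close>, so a pair with a large jump has an end
  below some \<open>N\<close>. Symmetry of \<open>R\<close> makes these pairs finite in number,
  whichever end it is.\<close>

lemma converges_slow_on:
  assumes R: "R \<subseteq> A \<times> B \<union> B \<times> A" "sym R" "uniformly_finite R"
    and A: "converges G A x" and B: "converges G B x" and g: "g \<in> G"
  shows "slow_on (snd g) R"
  unfolding slow_on_def
proof (intro allI impI)
  fix \<epsilon> :: real assume \<epsilon>: "0 < \<epsilon>"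
  have "\<forall>\<^sub>F n in sequentially. n \<in> A \<longrightarrow> dev g n x < \<epsilon>/2"
    "\<forall>\<^sub>F n in sequentially. n \<in> B \<longrightarrow> dev g n x < \<epsilon>/2"
    using A B g \<epsilon> half_gt_zero[OF \<epsilon>] unfolding converges_def by blast+
  then have "\<forall>\<^sub>F n in sequentially. n \<in> A \<union> B \<longrightarrow> dev g n x < \<epsilon>/2"
    by eventually_elim blast
  then obtain N where N: "\<And>n. n \<ge> N \<Longrightarrow> n \<in> A \<union> B \<Longrightarrow> dev g n x < \<epsilon>/2"
    unfolding eventually_sequentially by blast
  have "{p \<in> R. \<epsilon> \<le> \<bar>snd g (fst p) - snd g (snd p)\<bar>} \<subseteq> {..<N} \<times> R `` {..<N} \<union> R `` {..<N} \<times> {..<N}"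
  proof
    fix p assume p: "p \<in> {p \<in> R. \<epsilon> \<le> \<bar>snd g (fst p) - snd g (snd p)\<bar>}"
    obtain a b where ab: "p = (a, b)" by (cases p)
    have abR: "(a, b) \<in> R" using p ab by simp
    have "a < N \<or> b < N"
    proof (rule ccontr)
      assume "\<not> ?thesis"
      then have "dev g a x < \<epsilon>/2" "dev g b x < \<epsilon>/2"
        using N[of a] N[of b] abR R(1) by auto
      then have "\<bar>snd g a - snd g b\<bar> < \<epsilon>" by linarith
      then show False using p ab by auto
    qed
    then show "p \<in> {..<N} \<times> R `` {..<N} \<union> R `` {..<N} \<times> {..<N}"
      using abR symD[OF R(2) abR] unfolding ab by blast
  qed
  then show "finite {p \<in> R. \<epsilon> \<le> \<bar>snd g (fst p) - snd g (snd p)\<bar>}"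
    using uniformly_finite_finite_Image[OF R(3)] by (meson finite_SigmaI finite_UnI finite_lessThan finite_subset)
qed

section \<open>Thin sets and collapsing maps for countable families\<close>

lemma countable_exhaustion:
  assumes "countable X"
  obtains S :: "nat \<Rightarrow> 'b set" where "\<And>i j. i \<le> j \<Longrightarrow> S i \<subseteq> S j" "\<And>k. finite (S k)" "\<And>k. S k \<subseteq> X"
    "\<And>F. F \<subseteq> X \<Longrightarrow> finite F \<Longrightarrow> \<exists>k. F \<subseteq> S k"
proof -
  define S where "S k = {x \<in> X. to_nat_on X x < k}" for k
  have inj: "inj_on (to_nat_on X) X" using assms by auto
  show thesis
  proof
    show "S i \<subseteq> S j" if "i \<le> j" for i j using that unfolding S_def by auto
    have "S k \<subseteq> X" "to_nat_on X ` S k \<subseteq> {..<k}" for k unfolding S_def by auto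
    then show "finite (S k)" "S k \<subseteq> X" for k
      using inj by (meson finite_lessThan finite_subset inj_on_finite inj_on_subset)+
    show "\<exists>k. F \<subseteq> S k" if F: "F \<subseteq> X" "finite F" for F
    proof -
      obtain k where "\<And>x. x \<in> F \<Longrightarrow> to_nat_on X x < k"
        using F(2) finite_nat_set_iff_bounded[of "to_nat_on X ` F"] by auto
      then have "F \<subseteq> S k" unfolding S_def using F by auto
      then show ?thesis ..
    qed
  qed
qed

text \<open>Choose \<open>a k\<close> outside the finitely many points that \<open>R k\<close>
  relates to earlier choices. As the \<open>R k\<close> increase, two distinct chosen points can be
  related by \<open>R k\<close> only if both have index below \<open>k\<close>.\<close>

lemma thinnable_countable:
  fixes \<P> :: "(nat \<times> nat) set set"
  assumes \<P>: "pairing_family \<P>" "countable \<P>"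
  shows "thinnable \<P>"
  unfolding thinnable_def
proof (intro allI impI)
  fix A :: "nat set" assume A: "infinite A"
  obtain S :: "nat \<Rightarrow> (nat \<times> nat) set set" where S: "\<And>i j. i \<le> j \<Longrightarrow> S i \<subseteq> S j" "\<And>k. finite (S k)" "\<And>k. S k \<subseteq> \<P>"
    "\<And>F. F \<subseteq> \<P> \<Longrightarrow> finite F \<Longrightarrow> \<exists>k. F \<subseteq> S k"
    using countable_exhaustion[OF \<P>(2)] by metis
  define R where "R k = (\<Union>(S k))\<^sup>*" for k
  have Rmono: "R i \<subseteq> R j" if "i \<le> j" for i j
    unfolding R_def using S(1)[OF that] by (intro rtrancl_mono) auto
  have symR: "sym (R k)" for k
    unfolding R_def using pairing_family_sym[OF \<P>(1) S(3)] .
  have "\<exists>a. \<forall>k. a k \<in> A \<and> a k \<notin> R k `` (a ` {..<k})"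
  proof (rule dependent_wf_choice[of less_than])
    fix f :: "nat \<Rightarrow> nat" and k
    have "finite (R k `` (f ` {..<k}))"
      unfolding R_def using pairing_familyD[OF \<P>(1) S(3) S(2)] by (rule uniformly_finite_finite_Image) simp
    then have "A - R k `` (f ` {..<k}) \<noteq> {}"
      using A by (metis Diff_infinite_finite finite.emptyI)
    then show "\<exists>r. r \<in> A \<and> r \<notin> R k `` (f ` {..<k})" by blast
  next
    fix f g :: "nat \<Rightarrow> nat" and k r
    assume "\<And>z. (z, k) \<in> less_than \<Longrightarrow> f z = g z"
    then have "f ` {..<k} = g ` {..<k}" by (intro image_cong) auto
    then show "(r \<in> A \<and> r \<notin> R k `` (f ` {..<k})) = (r \<in> A \<and> r \<notin> R k `` (g ` {..<k}))" by simp
  qed simp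
  then obtain a where a: "\<And>k. a k \<in> A" "\<And>k. a k \<notin> R k `` (a ` {..<k})" by blast
  have apart: "(a i, a j) \<notin> R k" if "k \<le> max i j" "i \<noteq> j" for i j k
  proof
    assume *: "(a i, a j) \<in> R k"
    show False
    proof (cases "i < j")
      case True
      then have "(a i, a j) \<in> R j" using * Rmono[of k j] that by auto
      then show False using a(2)[of j] True by blast
    next
      case False
      then have "(a j, a i) \<in> R i" using symD[OF symR *] Rmono[of k i] that by auto
      then show False using a(2)[of i] False that by auto
    qed
  qed
  have "inj a"
  proof (rule injI, rule ccontr)
    fix i j assume "a i = a j" "i \<noteq> j"
    then show False using apart[of 0 i j] by (simp add: R_def)
  qed
  show "\<exists>D\<subseteq>A. infinite D \<and> (\<forall>S\<subseteq>\<P>. finite S \<longrightarrow> finite {a\<in>D. (\<Union>S)\<^sup>* `` {a} \<inter> D \<noteq> {a}})"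
  proof (intro exI[of _ "range a"] conjI allI impI)
    show "range a \<subseteq> A" using a(1) by auto
    show "infinite (range a)" using \<open>inj a\<close> by (rule range_inj_infinite)
    fix S' assume S': "S' \<subseteq> \<P>" "finite S'"
    then obtain k where "S' \<subseteq> S k" using S(4) by blast
    then have sub: "(\<Union>S')\<^sup>* \<subseteq> R k" unfolding R_def by (intro rtrancl_mono) auto
    have "{b\<in>range a. (\<Union>S')\<^sup>* `` {b} \<inter> range a \<noteq> {b}} \<subseteq> a ` {..<k}"
    proof
      fix b assume b: "b \<in> {b\<in>range a. (\<Union>S')\<^sup>* `` {b} \<inter> range a \<noteq> {b}}"
      then obtain i where i: "b = a i" by auto
      have "a i \<in> (\<Union>S')\<^sup>* `` {a i} \<inter> range a" by simp
      moreover have "(\<Union>S')\<^sup>* `` {a i} \<inter> range a \<noteq> {a i}" using b i by simp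
      ultimately obtain c where "c \<in> (\<Union>S')\<^sup>* `` {a i} \<inter> range a" "c \<noteq> a i" by blast
      then obtain j where "(a i, a j) \<in> (\<Union>S')\<^sup>*" "a j \<noteq> a i" by auto
      then have "\<not> k \<le> max i j" using apart[of k i j] sub by auto
      then show "b \<in> a ` {..<k}" using i by auto
    qed
    then show "finite {b\<in>range a. (\<Union>S')\<^sup>* `` {b} \<inter> range a \<noteq> {b}}"
      by (rule finite_subset) simp
  qed
qed

text \<open>Finite sets \<open>B k\<close>, saturated for every \<open>R i\<close> with i \<le> k,
  exhaust the naturals and for k > 0 swallow each class of \<open>R k\<close> on which a sequence of
  \<open>HS k\<close> jumps by at least 1/(k+1). A point outside \<open>B k\<close> but in
  \<open>B (Suc k)\<close> is sent to the least element of its class for \<open>R k\<close>. Later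
  levels use larger classes, so each pairing is merged from some level on, while the tolerated jumps
  tend to 0.\<close>

lemma collapse_classes:
  fixes \<P> :: "(nat \<times> nat) set set"
  assumes \<P>: "pairing_family \<P>" "countable \<P>" and H: "countable H"
    and slow: "\<And>s \<pi>. s \<in> H \<Longrightarrow> \<pi> \<in> \<P> \<Longrightarrow> slow_on s \<pi>"
  obtains r :: "nat \<Rightarrow> nat" where "\<And>n. r (r n) = r n" "\<And>m. finite {n. r n = m}"
    "\<And>\<pi>. \<pi> \<in> \<P> \<Longrightarrow> finite {p \<in> \<pi>. r (fst p) \<noteq> r (snd p)}"
    "\<And>s \<epsilon>. s \<in> H \<Longrightarrow> \<epsilon> > 0 \<Longrightarrow> \<forall>\<^sub>F n in sequentially. \<bar>s n - s (r n)\<bar> < \<epsilon>"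
proof -
  obtain PS :: "nat \<Rightarrow> (nat \<times> nat) set set" where PS: "\<And>i j. i \<le> j \<Longrightarrow> PS i \<subseteq> PS j" "\<And>k. finite (PS k)" "\<And>k. PS k \<subseteq> \<P>"
    "\<And>F. F \<subseteq> \<P> \<Longrightarrow> finite F \<Longrightarrow> \<exists>k. F \<subseteq> PS k"
    by (rule countable_exhaustion[OF \<P>(2)]) (rule that)
  obtain HS :: "nat \<Rightarrow> (nat \<Rightarrow> real) set" where HS: "\<And>i j. i \<le> j \<Longrightarrow> HS i \<subseteq> HS j" "\<And>k. finite (HS k)" "\<And>k. HS k \<subseteq> H"
    "\<And>F. F \<subseteq> H \<Longrightarrow> finite F \<Longrightarrow> \<exists>k. F \<subseteq> HS k"
    by (rule countable_exhaustion[OF H]) (rule that)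
  define R where "R k = (\<Union>(PS k))\<^sup>*" for k
  have Rmono: "R i \<subseteq> R j" if "i \<le> j" for i j
    unfolding R_def using PS(1)[OF that] by (intro rtrancl_mono) auto
  have Rsym: "(y, x) \<in> R k" if "(x, y) \<in> R k" for x y k
    using pairing_family_sym[OF \<P>(1) PS(3)] that unfolding R_def by (rule symD)
  have Rtrans: "(x, z) \<in> R k" if "(x, y) \<in> R k" "(y, z) \<in> R k" for x y z k
    using that unfolding R_def by auto
  have Rrefl: "(x, x) \<in> R k" for x k unfolding R_def by auto
  have Rfin: "uniformly_finite (R k)" for k
    unfolding R_def using pairing_familyD[OF \<P>(1) PS(3) PS(2)] .
  have Rslow: "slow_on s (R k)" if "s \<in> H" for s k
    unfolding R_def
  proof (rule slow_on_rtrancl)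
    show "uniformly_finite ((\<Union>(PS k))\<^sup>*)" using Rfin unfolding R_def .
    show "sym (\<Union>(PS k))"
      using \<P>(1) PS(3)[of k] unfolding pairing_family_def by (intro symI) (meson UnionE UnionI subsetD symD)
    show "slow_on s (\<Union>(PS k))"
      using slow[OF that] PS(2)[of k] PS(3)[of k] by (intro slow_on_Union) auto
  qed
  define X where "X k = (\<Union>s\<in>HS k. {p \<in> R k. 1 / real (k + 1) \<le> \<bar>s (fst p) - s (snd p)\<bar>})" for k
  have X: "finite (X k)" for k
    unfolding X_def using HS(2)[of k] HS(3)[of k] Rslow[of _ k]
    by (intro finite_UN_I) (auto simp: slow_on_def)
  \<comment> \<open>Each stage keeps the old points, adds the starts of the large jumps, and
    includes \<open>{..k}\<close> so that every number enters at some stage; saturation makes the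
    result a union of classes.\<close>
  define B where "B = rec_nat {} (\<lambda>k b. R (Suc k) `` (b \<union> fst ` X (Suc k) \<union> {..k}))"
  have B0: "B 0 = {}" and BS: "B (Suc k) = R (Suc k) `` (B k \<union> fst ` X (Suc k) \<union> {..k})" for k
    unfolding B_def by simp_all
  have Bfin: "finite (B k)" for k
    by (induction k) (auto simp: B0 BS intro!: uniformly_finite_finite_Image[OF Rfin] X)
  have Bmono1: "B k \<subseteq> B (Suc k)" for k
    unfolding BS using Rrefl by blast
  have Bmono: "B i \<subseteq> B j" if "i \<le> j" for i j
    using that Bmono1 by (rule lift_Suc_mono_le[rotated])
  have Bsat: "y \<in> B j" if "x \<in> B j" "(x, y) \<in> R i" "i \<le> j" for x y i j
  proof (cases j)
    case 0 then show ?thesis using that B0 by simp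
  next
    case (Suc j')
    have "(x, y) \<in> R j" using that Rmono by blast
    then show ?thesis using that(1) Rtrans unfolding Suc BS by blast
  qed
  have XB: "x \<in> B k" if xk: "(x, y) \<in> X k" "k > 0" for x y k
  proof -
    obtain k' where k': "k = Suc k'" using xk(2) by (cases k) auto
    have "x \<in> fst ` X k" using xk(1) by force
    then show ?thesis unfolding k' BS using Rrefl by blast
  qed
  have Bn: "n \<in> B (Suc n)" for n
    unfolding BS using Rrefl by blast
  define l where "l n = (LEAST i. n \<in> B (Suc i))" for n
  have l1: "n \<in> B (Suc (l n))" for n
    unfolding l_def using Bn by (rule LeastI)
  have l2: "n \<notin> B (l n)" for n
  proof (cases "l n")
    case 0 then show ?thesis using B0 by simp
  next
    case (Suc i)
    then have "i < (LEAST i. n \<in> B (Suc i))" unfolding l_def by simp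
    then show ?thesis unfolding Suc using not_less_Least[of i "\<lambda>i. n \<in> B (Suc i)"] by simp
  qed
  have leql: "i \<le> l n" if "n \<notin> B i" for i n
  proof (rule ccontr)
    assume "\<not> i \<le> l n"
    then have "B (Suc (l n)) \<subseteq> B i" by (intro Bmono) auto
    then show False using l1 that by blast
  qed
  \<comment> \<open>Levels are unions of classes: from stage \<open>i\<close> on, the sets
    \<open>B j\<close> do not separate \<open>n\<close> from \<open>m\<close>, and before that both
    points are still outside.\<close>
  have lR: "l m = l n" if nm: "(n, m) \<in> R i" and i: "i \<le> l n" for n m i
  proof -
    have "m \<notin> B i" using l2[of n] Bsat[OF _ Rsym[OF nm], of i] Bmono[OF i] by blast
    have "n \<in> B (Suc j) \<longleftrightarrow> m \<in> B (Suc j)" for j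
    proof (cases "i \<le> Suc j")
      case True
      then show ?thesis using Bsat[OF _ nm True] Bsat[OF _ Rsym[OF nm] True] by blast
    next
      case False
      then have "B (Suc j) \<subseteq> B i" "B (Suc j) \<subseteq> B (l n)" using i by (auto intro!: Bmono)
      then show ?thesis using \<open>m \<notin> B i\<close> l2 by blast
    qed
    then show ?thesis unfolding l_def by simp
  qed
  define r where "r n = (LEAST m. (n, m) \<in> R (l n))" for n
  have r1: "(n, r n) \<in> R (l n)" for n
    unfolding r_def using Rrefl by (rule LeastI)
  have req: "r n = r m" if nm: "(n, m) \<in> R i" and i: "i \<le> l n" for n m i
  proof -
    have "l m = l n" by (rule lR[OF nm i])
    have "(n, m) \<in> R (l n)" using nm Rmono[OF i] by blast
    then have "(n, y) \<in> R (l n) \<longleftrightarrow> (m, y) \<in> R (l n)" for y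
      using Rtrans Rsym by blast
    then show ?thesis unfolding r_def \<open>l m = l n\<close> by simp
  qed
  show thesis
  proof
    show "r (r n) = r n" for n
      using req[OF r1 order_refl] by simp
    show "finite {n. r n = m}" for m
    proof (rule finite_subset)
      show "{n. r n = m} \<subseteq> R (l m) `` {m}"
      proof
        fix n assume "n \<in> {n. r n = m}"
        then have "r n = m" by simp
        then have "(n, m) \<in> R (l n)" using r1[of n] by simp
        moreover have "l m = l n" using lR[OF calculation] by simp
        ultimately show "n \<in> R (l m) `` {m}" using Rsym by auto
      qed
      show "finite (R (l m) `` {m})" by (intro uniformly_finite_finite_Image[OF Rfin]) simp
    qed
    show "finite {p \<in> \<pi>. r (fst p) \<noteq> r (snd p)}" if "\<pi> \<in> \<P>" for \<pi>
    proof -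
      obtain i where "{\<pi>} \<subseteq> PS i" using PS(4)[of "{\<pi>}"] \<open>\<pi> \<in> \<P>\<close> by auto
      then have sub: "\<pi> \<subseteq> R i" unfolding R_def by auto
      have "{p \<in> \<pi>. r (fst p) \<noteq> r (snd p)} \<subseteq> B i \<times> R i `` B i"
      proof
        fix p assume p: "p \<in> {p \<in> \<pi>. r (fst p) \<noteq> r (snd p)}"
        then have "(fst p, snd p) \<in> R i" using sub by auto
        moreover have "fst p \<in> B i"
        proof (rule ccontr)
          assume "fst p \<notin> B i"
          then have "i \<le> l (fst p)" by (rule leql)
          then show False using req[OF calculation] p by auto
        qed
        ultimately show "p \<in> B i \<times> R i `` B i" by (cases p) auto
      qed
      then show ?thesis
        using Bfin uniformly_finite_finite_Image[OF Rfin Bfin] by (meson finite_SigmaI finite_subset)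
    qed
    show "\<forall>\<^sub>F n in sequentially. \<bar>s n - s (r n)\<bar> < \<epsilon>" if s: "s \<in> H" and \<epsilon>: "\<epsilon> > 0" for s \<epsilon>
    proof -
      obtain k0 where k0: "{s} \<subseteq> HS k0" using HS(4)[of "{s}"] s by auto
      obtain k1 where k1: "1 / real (k1 + 1) < \<epsilon>" using \<epsilon> nat_approx_posE by (metis Suc_eq_plus1)
      define k where "k = Suc (max k0 k1)"
      have "\<bar>s n - s (r n)\<bar> < \<epsilon>" if "n \<notin> B k" for n
      proof -
        have kl: "k \<le> l n" by (rule leql[OF that])
        have "(n, r n) \<notin> X (l n)" using XB[of n "r n" "l n"] l2 kl unfolding k_def by auto
        moreover have "s \<in> HS (l n)" using k0 HS(1)[of k0 "l n"] kl by (auto simp: k_def Suc_le_eq)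
        ultimately have "\<bar>s n - s (r n)\<bar> < 1 / real (l n + 1)"
          using r1[of n] unfolding X_def by auto
        also have "\<dots> \<le> 1 / real (k1 + 1)" using kl unfolding k_def by (intro divide_left_mono) auto
        also have "\<dots> < \<epsilon>" by (rule k1)
        finally show ?thesis .
      qed
      then have "\<forall>n. n \<notin> B k \<longrightarrow> \<bar>s n - s (r n)\<bar> < \<epsilon>" by blast
      moreover have "\<forall>\<^sub>F n in sequentially. n \<notin> B k"
        using Bfin[of k] by (simp add: cofinite_eq_sequentially[symmetric] eventually_cofinite)
      ultimately show ?thesis by (auto elim: eventually_mono)
    qed
  qed
qed

section \<open>Extending an approximation by one more function\<close>

lemma approx_in_pointwise:
  assumes T: "T \<noteq> {}" and G: "countable G" "approx_in T G"
  obtains y where "\<And>n. y n \<in> T" "\<And>g \<epsilon>. g \<in> G \<Longrightarrow> \<epsilon> > 0 \<Longrightarrow> \<forall>\<^sub>F n in sequentially. dev g n (y n) < \<epsilon>"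
proof -
  obtain GS :: "nat \<Rightarrow> _ set" where GS: "\<And>i j. i \<le> j \<Longrightarrow> GS i \<subseteq> GS j" "\<And>k. finite (GS k)" "\<And>k. GS k \<subseteq> G"
    "\<And>F. F \<subseteq> G \<Longrightarrow> finite F \<Longrightarrow> \<exists>k. F \<subseteq> GS k"
    by (rule countable_exhaustion[OF G(1)]) (rule that)
  define good where "good n k \<longleftrightarrow> (\<exists>x\<in>T. \<forall>g\<in>GS k. dev g n x < 1 / real (k + 1))" for n k
  have ev: "\<forall>\<^sub>F n in sequentially. good n k" for k
    unfolding good_def using G(2) GS by (intro approx_inD[of T G]) auto
  \<comment> \<open>Diagonal choice: \<open>y n\<close> realises the largest stage k \<le> n that is
    realisable at \<open>n\<close>. Inserting 0 only makes the maximum exist; if stage 0 fails at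
    \<open>n\<close>, then \<open>y n\<close> may be an arbitrary point, which concerns finitely
    many \<open>n\<close>.\<close>
  define K where "K n = insert 0 {k. k \<le> n \<and> good n k}" for n
  define \<kappa> where "\<kappa> n = Max (K n)" for n
  have fK: "finite (K n)" "K n \<noteq> {}" for n unfolding K_def by auto
  define y where "y n = (SOME x. x \<in> T \<and> (good n (\<kappa> n) \<longrightarrow> (\<forall>g\<in>GS (\<kappa> n). dev g n x < 1 / real (\<kappa> n + 1))))" for n
  have y: "y n \<in> T \<and> (good n (\<kappa> n) \<longrightarrow> (\<forall>g\<in>GS (\<kappa> n). dev g n (y n) < 1 / real (\<kappa> n + 1)))" for n
    unfolding y_def
  proof (rule someI_ex, cases "good n (\<kappa> n)")
    case True
    then show "\<exists>x. x \<in> T \<and> (good n (\<kappa> n) \<longrightarrow> (\<forall>g\<in>GS (\<kappa> n). dev g n x < 1 / real (\<kappa> n + 1)))"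
      unfolding good_def[of n "\<kappa> n"] by blast
  next
    case False
    then show "\<exists>x. x \<in> T \<and> (good n (\<kappa> n) \<longrightarrow> (\<forall>g\<in>GS (\<kappa> n). dev g n x < 1 / real (\<kappa> n + 1)))"
      using T by blast
  qed
  show thesis
  proof
    show "y n \<in> T" for n using y by blast
    fix g and \<epsilon> :: real assume g: "g \<in> G" and \<epsilon>: "\<epsilon> > 0"
    obtain k0 where k0: "{g} \<subseteq> GS k0" using GS(4)[of "{g}"] g by auto
    obtain k1 where k1: "1 / real (k1 + 1) < \<epsilon>" using \<epsilon> nat_approx_posE by (metis Suc_eq_plus1)
    define k where "k = Suc (max k0 k1)"
    show "\<forall>\<^sub>F n in sequentially. dev g n (y n) < \<epsilon>"
      using ev[of k] eventually_ge_at_top[of k]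
    proof eventually_elim
      case (elim n)
      then have "k \<in> K n" unfolding K_def by auto
      then have kk: "k \<le> \<kappa> n" unfolding \<kappa>_def using fK by auto
      have "\<kappa> n \<in> K n" unfolding \<kappa>_def using fK by (intro Max_in)
      then have "good n (\<kappa> n)" using kk unfolding K_def k_def by auto
      moreover have "g \<in> GS (\<kappa> n)" using k0 GS(1)[of k0 "\<kappa> n"] kk by (auto simp: k_def Suc_le_eq)
      ultimately have "dev g n (y n) < 1 / real (\<kappa> n + 1)" using y by blast
      also have "\<dots> \<le> 1 / real (k1 + 1)" using kk unfolding k_def by (intro divide_left_mono) auto
      also have "\<dots> < \<epsilon>" by (rule k1)
      finally show ?case .
    qed
  qed
qed

text \<open>Sorting points by the integer parts of \<open>h x / \<delta>\<close> gives countably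
  many boxes because \<open>H\<close> is finite. This works for arbitrary real functions on an
  arbitrary set.\<close>

lemma countable_net:
  fixes H :: "('a \<Rightarrow> real) set"
  assumes "finite H" "\<delta> > 0"
  obtains E where "countable E" "E \<subseteq> T" "\<And>x. x \<in> T \<Longrightarrow> \<exists>z\<in>E. \<forall>h\<in>H. \<bar>h z - h x\<bar> < \<delta>"
proof -
  define \<Phi> where "\<Phi> x = (\<lambda>h\<in>H. \<lfloor>h x / \<delta>\<rfloor>)" for x
  have "\<Phi> ` T \<subseteq> (\<Pi>\<^sub>E h\<in>H. UNIV)" unfolding \<Phi>_def by auto
  moreover have "countable (\<Pi>\<^sub>E h\<in>H. (UNIV :: int set))" by (rule countable_PiE[OF assms(1)]) auto
  ultimately have c: "countable (\<Phi> ` T)" by (rule countable_subset)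
  show thesis
  proof (rule that[of "inv_into T \<Phi> ` \<Phi> ` T"])
    show "countable (inv_into T \<Phi> ` \<Phi> ` T)" using c by simp
    show "inv_into T \<Phi> ` \<Phi> ` T \<subseteq> T" by (auto intro: inv_into_into)
    fix x assume x: "x \<in> T"
    define z where "z = inv_into T \<Phi> (\<Phi> x)"
    have z: "\<Phi> z = \<Phi> x" unfolding z_def using x by (intro f_inv_into_f) auto
    have "\<bar>h z - h x\<bar> < \<delta>" if "h \<in> H" for h
    proof -
      have "\<lfloor>h z / \<delta>\<rfloor> = \<lfloor>h x / \<delta>\<rfloor>" using fun_cong[OF z, of h] that unfolding \<Phi>_def by simp
      then have "\<bar>h z / \<delta> - h x / \<delta>\<bar> < 1" by linarith
      then have "\<bar>h z - h x\<bar> / \<delta> < 1" using assms(2) by (simp add: diff_divide_distrib[symmetric] abs_divide)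
      then show ?thesis using assms(2) by (simp add: pos_divide_less_eq)
    qed
    then show "\<exists>z\<in>inv_into T \<Phi> ` \<Phi> ` T. \<forall>h\<in>H. \<bar>h z - h x\<bar> < \<delta>"
      unfolding z_def using x by blast
  qed
qed

lemma dense_sequence:
  fixes HS :: "nat \<Rightarrow> ('a \<Rightarrow> real) set"
  assumes T: "T \<noteq> {}" and HS: "\<And>k. finite (HS k)"
  obtains x where "\<And>k. x k \<in> T"
    "\<And>k z. z \<in> T \<Longrightarrow> \<exists>\<^sub>F n in sequentially. \<forall>h\<in>HS k. \<bar>h (x n) - h z\<bar> < 1 / real (k + 1)"
proof -
  have "\<exists>E. countable E \<and> E \<subseteq> T \<and> (\<forall>z\<in>T. \<exists>w\<in>E. \<forall>h\<in>HS k. \<bar>h w - h z\<bar> < 1 / real (k + 1))" for k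
    by (rule countable_net[OF HS[of k], of "1 / real (k + 1)" T]) auto
  then obtain E where E: "\<And>k. countable (E k)" "\<And>k. E k \<subseteq> T"
    "\<And>k z. z \<in> T \<Longrightarrow> \<exists>w\<in>E k. \<forall>h\<in>HS k. \<bar>h w - h z\<bar> < 1 / real (k + 1)"
    by metis
  define U where "U = (\<Union>k. E k)"
  obtain z0 where "z0 \<in> T" using T by blast
  have "countable U" unfolding U_def by (intro countable_UN E(1)) simp
  moreover have "U \<subseteq> T" unfolding U_def using E(2) by (rule UN_least)
  ultimately have U: "countable U" "U \<subseteq> T" by auto
  have "E 0 \<noteq> {}" using E(3)[OF \<open>z0 \<in> T\<close>, of 0] by auto
  then have "U \<noteq> {}" unfolding U_def by auto
  \<comment> \<open>The second component of the decoded pair is ignored, so every point of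
    \<open>U\<close> recurs at infinitely many indices.\<close>
  define x where "x n = from_nat_into U (fst (prod_decode n))" for n
  show thesis
  proof
    show "x k \<in> T" for k
      unfolding x_def using U(2) from_nat_into[OF \<open>U \<noteq> {}\<close>] by blast
    fix k z assume "z \<in> T"
    obtain w where w': "w \<in> E k" and w2: "\<forall>h\<in>HS k. \<bar>h w - h z\<bar> < 1 / real (k + 1)"
      using E(3)[OF \<open>z \<in> T\<close>, of k] by (elim bexE)
    have w: "w \<in> U" unfolding U_def using w' by auto
    obtain i where i: "from_nat_into U i = w" using from_nat_into_surj[OF U(1) w] by blast
    show "\<exists>\<^sub>F n in sequentially. \<forall>h\<in>HS k. \<bar>h (x n) - h z\<bar> < 1 / real (k + 1)"
      unfolding frequently_sequentially
    proof
      fix N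
      have "N \<le> prod_encode (i, N)" by (rule le_prod_encode_2)
      moreover have "x (prod_encode (i, N)) = w" unfolding x_def using i by simp
      ultimately show "\<exists>n\<ge>N. \<forall>h\<in>HS k. \<bar>h (x n) - h z\<bar> < 1 / real (k + 1)"
        using w2 by metis
    qed
  qed
qed

text \<open>Along a sparse sequence in \<open>M\<close> the points \<open>y n\<close> run through a
  sequence that is dense in \<open>T\<close> with respect to \<open>f\<close> and all of
  \<open>G\<close> at once; elsewhere they follow any approximation. So the values of
  \<open>f\<close> along \<open>y\<close> accumulate at each \<open>f x\<close> jointly with the
  coded coordinates, before any sequence for \<open>f\<close> exists.\<close>

lemma approx_points:
  fixes G :: "'a coding" and f :: "'a \<Rightarrow> real"
  assumes T: "T \<noteq> {}" and G: "countable G" "approx_in T G" and M: "\<And>x. x \<in> T \<Longrightarrow> clusters G M x"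
  obtains y where "\<And>n. y n \<in> T"
    "\<And>g \<epsilon>. g \<in> G \<Longrightarrow> \<epsilon> > 0 \<Longrightarrow> \<forall>\<^sub>F n in sequentially. dev g n (y n) < \<epsilon>"
    "\<And>x S \<epsilon>. x \<in> T \<Longrightarrow> S \<subseteq> G \<Longrightarrow> finite S \<Longrightarrow> \<epsilon> > 0 \<Longrightarrow>
      \<exists>\<^sub>F n in sequentially. n \<in> M \<and> \<bar>f (y n) - f x\<bar> < \<epsilon> \<and> (\<forall>g\<in>S. \<bar>fst g (y n) - fst g x\<bar> < \<epsilon>)"
proof -
  obtain GS :: "nat \<Rightarrow> _ set" where GS: "\<And>i j. i \<le> j \<Longrightarrow> GS i \<subseteq> GS j" "\<And>k. finite (GS k)" "\<And>k. GS k \<subseteq> G"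
    "\<And>F. F \<subseteq> G \<Longrightarrow> finite F \<Longrightarrow> \<exists>k. F \<subseteq> GS k"
    by (rule countable_exhaustion[OF G(1)]) (rule that)
  obtain y0 where y0: "\<And>n. y0 n \<in> T" "\<And>g \<epsilon>. g \<in> G \<Longrightarrow> \<epsilon> > 0 \<Longrightarrow> \<forall>\<^sub>F n in sequentially. dev g n (y0 n) < \<epsilon>"
    by (rule approx_in_pointwise[OF T G]) blast
  define HS where "HS k = insert f (fst ` GS k)" for k
  obtain x where x: "\<And>k. x k \<in> T"
    "\<And>k z. z \<in> T \<Longrightarrow> \<exists>\<^sub>F n in sequentially. \<forall>h\<in>HS k. \<bar>h (x n) - h z\<bar> < 1 / real (k + 1)"
    by (rule dense_sequence[OF T, of HS]) (auto simp: HS_def GS)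
  have step: "\<exists>n>N. n \<in> M \<and> (\<forall>g\<in>GS k. dev g n (x k) < 1 / real (k + 1))" for N k
  proof -
    have "\<exists>\<^sub>F n in sequentially. n \<in> M \<and> (\<forall>g\<in>GS k. dev g n (x k) < 1 / real (k + 1))"
      by (rule clustersD[OF M[OF x(1)] GS(3) GS(2)]) simp
    then show ?thesis
      unfolding frequently_sequentially by (meson Suc_le_eq)
  qed
  have "\<exists>m. \<forall>k. (m k \<in> M \<and> (\<forall>g\<in>GS k. dev g (m k) (x k) < 1 / real (k + 1))) \<and> m k < m (Suc k)"
    by (rule dependent_nat_choice[where Q = "\<lambda>_. (<)"]) (use step in blast)+
  then obtain m where m: "\<And>k. m k \<in> M" "\<And>k g. g \<in> GS k \<Longrightarrow> dev g (m k) (x k) < 1 / real (k + 1)"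
    "\<And>k. m k < m (Suc k)" by blast
  have mono: "strict_mono m" by (rule strict_monoI_Suc) (rule m(3))
  then have inj: "m i = m j \<longleftrightarrow> i = j" for i j by (simp add: strict_mono_eq)
  define y where "y n = (if n \<in> range m then x (inv m n) else y0 n)" for n
  have ym: "y (m k) = x k" for k
    unfolding y_def using inv_f_f[of m k] inj by (simp add: inj_def)
  show thesis
  proof
    show "y n \<in> T" for n unfolding y_def using x(1) y0(1) by simp
    fix g and \<epsilon> :: real assume g: "g \<in> G" and \<epsilon>: "\<epsilon> > 0"
    obtain k0 where k0: "{g} \<subseteq> GS k0" using GS(4)[of "{g}"] g by auto
    obtain k1 where k1: "1 / real (k1 + 1) < \<epsilon>" using \<epsilon> nat_approx_posE by (metis Suc_eq_plus1)
    show "\<forall>\<^sub>F n in sequentially. dev g n (y n) < \<epsilon>"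
      using y0(2)[OF g \<epsilon>] eventually_ge_at_top[of "m (max k0 k1)"]
    proof eventually_elim
      case (elim n)
      show ?case
      proof (cases "n \<in> range m")
        case False
        then show ?thesis using elim unfolding y_def by simp
      next
        case True
        then obtain k where k: "n = m k" by auto
        then have kk: "max k0 k1 \<le> k" using elim(2) strict_mono_less_eq[OF mono] by simp
        then have "g \<in> GS k" using k0 GS(1)[of k0 k] by auto
        then have "dev g n (y n) < 1 / real (k + 1)" unfolding k ym by (rule m(2))
        also have "\<dots> \<le> 1 / real (k1 + 1)" using kk by (intro divide_left_mono) auto
        also have "\<dots> < \<epsilon>" by (rule k1)
        finally show ?thesis .
      qed
    qed
  next
    fix z S and \<epsilon> :: real assume z: "z \<in> T" and S: "S \<subseteq> G" "finite S" and \<epsilon>: "\<epsilon> > 0"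
    obtain k0 where k0: "S \<subseteq> GS k0" using GS(4)[OF S] by auto
    obtain k1 where k1: "1 / real (k1 + 1) < \<epsilon>" using \<epsilon> nat_approx_posE by (metis Suc_eq_plus1)
    define k where "k = max k0 k1"
    have SS: "fst ` S \<subseteq> HS k" "f \<in> HS k" using k0 GS(1)[of k0 k] unfolding k_def HS_def by auto
    have kk: "1 / real (k + 1) < \<epsilon>"
    proof -
      have "1 / real (k + 1) \<le> 1 / real (k1 + 1)" unfolding k_def by (intro divide_left_mono) auto
      then show ?thesis using k1 by linarith
    qed
    show "\<exists>\<^sub>F n in sequentially. n \<in> M \<and> \<bar>f (y n) - f z\<bar> < \<epsilon> \<and> (\<forall>g\<in>S. \<bar>fst g (y n) - fst g z\<bar> < \<epsilon>)"
      unfolding frequently_sequentially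
    proof
      fix N
      obtain j where j: "j \<ge> N" "\<forall>h\<in>HS k. \<bar>h (x j) - h z\<bar> < 1 / real (k + 1)"
        using x(2)[OF z, of k] unfolding frequently_sequentially by blast
      have "j \<le> m j" using mono by (rule strict_mono_imp_increasing)
      then have "N \<le> m j" using j(1) by simp
      moreover have "\<bar>h (y (m j)) - h z\<bar> < \<epsilon>" if "h \<in> HS k" for h
        using j(2) that kk unfolding ym by fastforce
      ultimately show "\<exists>n\<ge>N. n \<in> M \<and> \<bar>f (y n) - f z\<bar> < \<epsilon> \<and> (\<forall>g\<in>S. \<bar>fst g (y n) - fst g z\<bar> < \<epsilon>)"
        using m(1) SS by blast
    qed
  qed
qed

text \<open>With \<open>r\<close> from \<open>collapse_classes\<close> put
  \<open>s n = f (y (r n))\<close>. All but finitely many pairs of each pairing have equal values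
  under \<open>s\<close>; the point \<open>y (r n)\<close> witnesses \<open>approx_in\<close> with
  error 0 at \<open>f\<close>; and the density of \<open>y\<close> along the fixed points of
  \<open>r\<close> gives \<open>approx_onto\<close>.\<close>

lemma extend_approximation:
  fixes G :: "'a coding" and f :: "'a \<Rightarrow> real"
  assumes T: "T \<noteq> {}" and G: "countable G" "approx_in T G" "approx_onto T G"
    and \<P>: "pairing_family \<P>" "countable \<P>"
    and slow: "\<And>g \<pi>. g \<in> G \<Longrightarrow> \<pi> \<in> \<P> \<Longrightarrow> slow_on (snd g) \<pi>"
  obtains s where "approx_in T (insert (f, s) G)" "approx_onto T (insert (f, s) G)"
    "\<And>\<pi>. \<pi> \<in> \<P> \<Longrightarrow> slow_on s \<pi>"
proof -
  obtain r :: "nat \<Rightarrow> nat" where r: "\<And>n. r (r n) = r n" "\<And>m. finite {n. r n = m}"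
    "\<And>\<pi>. \<pi> \<in> \<P> \<Longrightarrow> finite {p \<in> \<pi>. r (fst p) \<noteq> r (snd p)}"
    "\<And>s \<epsilon>. s \<in> snd ` G \<Longrightarrow> \<epsilon> > 0 \<Longrightarrow> \<forall>\<^sub>F n in sequentially. \<bar>s n - s (r n)\<bar> < \<epsilon>"
    by (rule collapse_classes[OF \<P>, of "snd ` G"]) (use G slow in auto)
  have rG: "\<forall>\<^sub>F n in sequentially. \<bar>snd g n - snd g (r n)\<bar> < \<epsilon>" if "g \<in> G" "\<epsilon> > 0" for g \<epsilon>
    using r(4)[of "snd g" \<epsilon>] that by auto
  have rinf: "filterlim r sequentially sequentially"
    unfolding filterlim_at_top
  proof
    fix N
    have "{n. \<not> N \<le> r n} = (\<Union>m<N. {n. r n = m})" by auto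
    then have "finite {n. \<not> N \<le> r n}" using r(2) by auto
    then show "\<forall>\<^sub>F n in sequentially. N \<le> r n"
      by (simp add: cofinite_eq_sequentially[symmetric] eventually_cofinite)
  qed
  define M where "M = range r"
  \<comment> \<open>Since \<open>r\<close> is finite-to-one and changes the coded sequences by null
    sequences, its range keeps every point of \<open>T\<close> as a limit point.\<close>
  have M: "clusters G M x" if x: "x \<in> T" for x
    unfolding clusters_def
  proof (intro allI impI)
    fix S and \<epsilon> :: real assume S: "S \<subseteq> G" "finite S" and \<epsilon>: "0 < \<epsilon>"
    have "\<exists>\<^sub>F n in sequentially. n \<in> UNIV \<and> (\<forall>g\<in>S. dev g n x < \<epsilon>/2)"
      using G(3) x S \<epsilon> unfolding approx_onto_def by (intro clustersD[of G]) auto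
    moreover have "\<forall>\<^sub>F n in sequentially. \<forall>g\<in>S. \<bar>snd g n - snd g (r n)\<bar> < \<epsilon>/2"
      using S \<epsilon> by (intro eventually_ball_finite ballI rG) auto
    ultimately have "\<exists>\<^sub>F n in sequentially. (n \<in> UNIV \<and> (\<forall>g\<in>S. dev g n x < \<epsilon>/2)) \<and> (\<forall>g\<in>S. \<bar>snd g n - snd g (r n)\<bar> < \<epsilon>/2)"
      by (rule frequently_eventually_frequently)
    then have "\<exists>\<^sub>F n in sequentially. r n \<in> M \<and> (\<forall>g\<in>S. dev g (r n) x < \<epsilon>)"
    proof (rule frequently_elim1)
      fix n assume n: "(n \<in> UNIV \<and> (\<forall>g\<in>S. dev g n x < \<epsilon>/2)) \<and> (\<forall>g\<in>S. \<bar>snd g n - snd g (r n)\<bar> < \<epsilon>/2)"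
      show "r n \<in> M \<and> (\<forall>g\<in>S. dev g (r n) x < \<epsilon>)"
      proof (intro conjI ballI)
        fix g assume "g \<in> S"
        then have "dev g n x < \<epsilon>/2" "\<bar>snd g n - snd g (r n)\<bar> < \<epsilon>/2" using n by auto
        then show "dev g (r n) x < \<epsilon>" by linarith
      qed (simp add: M_def)
    qed
    then show "\<exists>\<^sub>F n in sequentially. n \<in> M \<and> (\<forall>g\<in>S. dev g n x < \<epsilon>)"
      using rinf unfolding filterlim_iff frequently_def by blast
  qed
  obtain y where y: "\<And>n. y n \<in> T"
    "\<And>g \<epsilon>. g \<in> G \<Longrightarrow> \<epsilon> > 0 \<Longrightarrow> \<forall>\<^sub>F n in sequentially. dev g n (y n) < \<epsilon>"
    "\<And>x S \<epsilon>. x \<in> T \<Longrightarrow> S \<subseteq> G \<Longrightarrow> finite S \<Longrightarrow> \<epsilon> > 0 \<Longrightarrow>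
      \<exists>\<^sub>F n in sequentially. n \<in> M \<and> \<bar>f (y n) - f x\<bar> < \<epsilon> \<and> (\<forall>g\<in>S. \<bar>fst g (y n) - fst g x\<bar> < \<epsilon>)"
    by (rule approx_points[OF T G(1,2) M, where f = f]) blast+
  define s where "s n = f (y (r n))" for n
  have yr: "\<forall>\<^sub>F n in sequentially. dev g n (y (r n)) < \<epsilon>" if g: "g \<in> G" and \<epsilon>: "\<epsilon> > 0" for g \<epsilon>
  proof -
    have "\<forall>\<^sub>F n in sequentially. dev g (r n) (y (r n)) < \<epsilon>/2"
      by (rule eventually_compose_filterlim[OF y(2)[OF g half_gt_zero[OF \<epsilon>]] rinf])
    with rG[OF g half_gt_zero[OF \<epsilon>]] show ?thesis
      by eventually_elim linarith
  qed
  show thesis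
  proof (rule that[of s])
    show "approx_in T (insert (f, s) G)"
      unfolding approx_in_def
    proof (intro allI impI)
      fix S and \<epsilon> :: real assume S: "S \<subseteq> insert (f, s) G" "finite S" and \<epsilon>: "0 < \<epsilon>"
      have "\<forall>\<^sub>F n in sequentially. \<forall>g\<in>S - {(f, s)}. dev g n (y (r n)) < \<epsilon>"
        using S \<epsilon> yr by (intro eventually_ball_finite) auto
      then show "\<forall>\<^sub>F n in sequentially. \<exists>x\<in>T. \<forall>g\<in>S. dev g n x < \<epsilon>"
      proof eventually_elim
        case (elim n)
        have "dev g n (y (r n)) < \<epsilon>" if "g \<in> S" for g
        proof (cases "g = (f, s)")
          case True then show ?thesis using \<epsilon> by (simp add: s_def)
        next
          case False then show ?thesis using elim that by auto
        qed
        then show ?case using y(1) by blast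
      qed
    qed
    show "approx_onto T (insert (f, s) G)"
      unfolding approx_onto_def clusters_def
    proof (intro ballI allI impI)
      fix x S and \<epsilon> :: real assume x: "x \<in> T" and S: "S \<subseteq> insert (f, s) G" "finite S" and \<epsilon>: "0 < \<epsilon>"
      have "\<exists>\<^sub>F n in sequentially. n \<in> M \<and> \<bar>f (y n) - f x\<bar> < \<epsilon>/2 \<and> (\<forall>g\<in>S-{(f, s)}. \<bar>fst g (y n) - fst g x\<bar> < \<epsilon>/2)"
        using S \<epsilon> by (intro y(3)[OF x]) auto
      moreover have "\<forall>\<^sub>F n in sequentially. \<forall>g\<in>S - {(f, s)}. dev g n (y n) < \<epsilon>/2"
        using S \<epsilon> by (intro eventually_ball_finite ballI y(2)) auto
      ultimately have "\<exists>\<^sub>F n in sequentially. (n \<in> M \<and> \<bar>f (y n) - f x\<bar> < \<epsilon>/2 \<and> (\<forall>g\<in>S-{(f, s)}. \<bar>fst g (y n) - fst g x\<bar> < \<epsilon>/2))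
          \<and> (\<forall>g\<in>S - {(f, s)}. dev g n (y n) < \<epsilon>/2)"
        by (rule frequently_eventually_frequently)
      then show "\<exists>\<^sub>F n in sequentially. n \<in> UNIV \<and> (\<forall>g\<in>S. dev g n x < \<epsilon>)"
      proof (rule frequently_elim1)
        fix n assume n: "(n \<in> M \<and> \<bar>f (y n) - f x\<bar> < \<epsilon>/2 \<and> (\<forall>g\<in>S-{(f, s)}. \<bar>fst g (y n) - fst g x\<bar> < \<epsilon>/2))
          \<and> (\<forall>g\<in>S - {(f, s)}. dev g n (y n) < \<epsilon>/2)"
        then have "r n = n" unfolding M_def using r(1) by auto
        show "n \<in> UNIV \<and> (\<forall>g\<in>S. dev g n x < \<epsilon>)"
        proof (intro conjI ballI UNIV_I)
          fix g assume g: "g \<in> S"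
          show "dev g n x < \<epsilon>"
          proof (cases "g = (f, s)")
            case True
            then show ?thesis using n \<epsilon> \<open>r n = n\<close> by (simp add: s_def)
          next
            case False
            then have "\<bar>fst g (y n) - fst g x\<bar> < \<epsilon>/2" "dev g n (y n) < \<epsilon>/2" using n g by auto
            then show ?thesis by linarith
          qed
        qed
      qed
    qed
    show "slow_on s \<pi>" if "\<pi> \<in> \<P>" for \<pi>
      unfolding slow_on_def
    proof (intro allI impI)
      fix \<epsilon> :: real assume "0 < \<epsilon>"
      then have "{p \<in> \<pi>. \<epsilon> \<le> \<bar>s (fst p) - s (snd p)\<bar>} \<subseteq> {p \<in> \<pi>. r (fst p) \<noteq> r (snd p)}"
        unfolding s_def by auto
      then show "finite {p \<in> \<pi>. \<epsilon> \<le> \<bar>s (fst p) - s (snd p)\<bar>}"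
        using r(3)[OF that] by (rule finite_subset)
    qed
  qed
qed

section \<open>Coarse structures generated by pairings\<close>

lemma Well_order_finite_max:
  assumes "Well_order r" "finite J" "J \<noteq> {}" "J \<subseteq> Field r"
  obtains m where "m \<in> J" "J \<subseteq> insert m (underS r m)"
proof -
  have tot: "x = y \<or> (x, y) \<in> r \<or> (y, x) \<in> r" if "x \<in> Field r" "y \<in> Field r" for x y
    using assms(1) that unfolding well_order_on_def linear_order_on_def total_on_def by blast
  have tr: "trans r"
    using assms(1) unfolding well_order_on_def linear_order_on_def partial_order_on_def preorder_on_def by blast
  have "\<exists>m\<in>J. \<forall>y\<in>J. y = m \<or> (y, m) \<in> r"
    using assms(2-4)
  proof (induction J rule: finite_ne_induct)
    case (insert a F)
    then obtain m where m: "m \<in> F" "\<forall>y\<in>F. y = m \<or> (y, m) \<in> r" by auto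
    have "a = m \<or> (a, m) \<in> r \<or> (m, a) \<in> r" using tot insert.prems m(1) by auto
    then show ?case
    proof (elim disjE)
      assume am: "(m, a) \<in> r"
      then have "\<forall>y\<in>insert a F. y = a \<or> (y, a) \<in> r" using m(2) transD[OF tr _ am] am by auto
      then show ?thesis by blast
    qed (use m in blast)+
  qed auto
  then obtain m where "m \<in> J" "\<forall>y\<in>J. y = m \<or> (y, m) \<in> r" by blast
  then show thesis by (intro that[of m]) (auto simp: underS_def)
qed

lemma Well_order_wf: "Well_order r \<Longrightarrow> wf (r - Id)"
  unfolding well_order_on_def by blast

text \<open>An invariant of finite character passes limit stages for free: finitely many indices
  have a maximum, and the others lie in the initial segment below it. The bound on
  \<open>|X|\<close> tells the step how few choices were made before.\<close>

lemma transfinite_extension: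
  fixes r :: "'i rel" and Inv :: "'s set \<Rightarrow> bool"
  assumes wo: "Well_order r"
    and fc: "\<And>X. Inv X \<longleftrightarrow> (\<forall>S\<subseteq>X. finite S \<longrightarrow> Inv S)" and base: "Inv {}"
    and step: "\<And>x X. x \<in> Field r \<Longrightarrow> Inv X \<Longrightarrow> |X| \<le>o |underS r x| \<Longrightarrow> \<exists>v. Inv (insert v X) \<and> Q x X v"
  obtains g where "Inv (g ` Field r)" "\<And>x. x \<in> Field r \<Longrightarrow> Q x (g ` underS r x) (g x)"
proof -
  define P where "P g x v \<longleftrightarrow> (x \<in> Field r \<longrightarrow> Inv (insert v (g ` underS r x)) \<and> Q x (g ` underS r x) v)" for g :: "'i \<Rightarrow> 's" and x v
  have uF: "underS r x \<subseteq> Field r" for x unfolding underS_def Field_def by auto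
  have glue: "Inv (g ` J)"
    if J: "J \<subseteq> Field r" and g: "\<And>y. y \<in> J \<Longrightarrow> P g y (g y)" for g J
  proof (subst fc, intro allI impI)
    fix S assume "S \<subseteq> g ` J" "finite S"
    then obtain J' where J': "J' \<subseteq> J" "finite J'" "S = g ` J'"
      using finite_subset_image by metis
    show "Inv S"
    proof (cases "J' = {}")
      case True then show ?thesis using base J' by simp
    next
      case False
      obtain m where m: "m \<in> J'" "J' \<subseteq> insert m (underS r m)"
        using Well_order_finite_max[OF wo J'(2) False] J J'(1) by blast
      have "Inv (insert (g m) (g ` underS r m))"
        using g[of m] m J' J unfolding P_def by blast
      moreover have "S \<subseteq> insert (g m) (g ` underS r m)" using m(2) J'(3) by blast
      ultimately show ?thesis using fc[of "insert (g m) (g ` underS r m)"] J'(2,3) by blast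
    qed
  qed
  have "\<exists>g. \<forall>x. P g x (g x)"
  proof (rule dependent_wf_choice[OF Well_order_wf[OF wo]])
    fix g g' :: "'i \<Rightarrow> 's" and x v
    assume "\<And>z. (z, x) \<in> r - Id \<Longrightarrow> g z = g' z"
    then have "g ` underS r x = g' ` underS r x"
      by (intro image_cong) (auto simp: underS_def)
    then show "P g x v = P g' x v" unfolding P_def by simp
  next
    fix x and g :: "'i \<Rightarrow> 's"
    assume "\<And>y. (y, x) \<in> r - Id \<Longrightarrow> P g y (g y)"
    then have "Inv (g ` underS r x)"
      by (intro glue uF) (auto simp: underS_def)
    then show "\<exists>v. P g x v"
      unfolding P_def using step[of x "g ` underS r x"] card_of_image by blast
  qed
  then obtain g where g: "\<And>x. P g x (g x)" by blast
  show thesis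
    using that[of g] glue[of "Field r" g] g unfolding P_def by blast
qed

lemma Well_order_omega1: "Well_order \<omega>\<^sub>1" and Card_order_omega1: "Card_order \<omega>\<^sub>1"
  using cardSuc_Well_order cardSuc_Card_order natLeq_Card_order by blast+

lemma countable_underS_omega1:
  assumes "x \<in> Field \<omega>\<^sub>1" shows "countable (underS \<omega>\<^sub>1 x)"
proof -
  have "|underS \<omega>\<^sub>1 x| <o \<omega>\<^sub>1" by (rule card_of_underS[OF Card_order_omega1 assms])
  then have "|underS \<omega>\<^sub>1 x| \<le>o natLeq"
    using cardSuc_ordLeq_ordLess[OF natLeq_Card_order card_of_Card_order] by blast
  then show ?thesis by (simp add: countable_card_le_natLeq)
qed

lemma Field_omega1: "|Field \<omega>\<^sub>1| =o \<omega>\<^sub>1" "Field \<omega>\<^sub>1 \<noteq> {}" "uncountable (Field \<omega>\<^sub>1)"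
proof -
  show eq: "|Field \<omega>\<^sub>1| =o \<omega>\<^sub>1" by (rule card_of_Field_ordIso[OF Card_order_omega1])
  have "\<not> \<omega>\<^sub>1 \<le>o natLeq"
    using cardSuc_greater[OF natLeq_Card_order] not_ordLess_ordLeq by blast
  then show unc: "uncountable (Field \<omega>\<^sub>1)"
    unfolding countable_card_le_natLeq using eq ordIso_ordLeq_trans ordIso_symmetric by blast
  then show "Field \<omega>\<^sub>1 \<noteq> {}" by auto
qed

text \<open>This is the regularity of \<open>\<omega>\<^sub>1\<close>: countably many initial
  segments are countable, so their union is not everything.\<close>

lemma countable_bounded_omega1:
  assumes "countable Y" "Y \<subseteq> Field \<omega>\<^sub>1"
  obtains x where "x \<in> Field \<omega>\<^sub>1" "Y \<subseteq> underS \<omega>\<^sub>1 x"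
proof -
  have "countable (\<Union>y\<in>Y. insert y (underS \<omega>\<^sub>1 y))"
    using assms countable_underS_omega1 by (intro countable_UN) auto
  then obtain x where x: "x \<in> Field \<omega>\<^sub>1" "x \<notin> (\<Union>y\<in>Y. insert y (underS \<omega>\<^sub>1 y))"
    using Field_omega1(3) by (meson countable_subset subsetI)
  have "total_on (Field \<omega>\<^sub>1) \<omega>\<^sub>1"
    using Well_order_omega1 unfolding well_order_on_def linear_order_on_def by blast
  then have tot: "\<And>y. y \<in> Y \<Longrightarrow> y = x \<or> (y, x) \<in> \<omega>\<^sub>1 \<or> (x, y) \<in> \<omega>\<^sub>1"
    using x(1) assms(2) unfolding total_on_def by blast
  have "Y \<subseteq> underS \<omega>\<^sub>1 x"
  proof
    fix y assume y: "y \<in> Y"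
    then have "x \<noteq> y" "(x, y) \<notin> \<omega>\<^sub>1" using x(2) unfolding underS_def by auto
    then show "y \<in> underS \<omega>\<^sub>1 x" using tot[OF y] unfolding underS_def by auto
  qed
  with x(1) show thesis by (rule that)
qed

lemma ordLeq_surj:
  assumes "|A| \<le>o |B|" "A \<noteq> {}"
  obtains g where "g ` B = A"
  using assms card_of_ordLeq2[of A B] by blast

lemma countable_ordLess_continuum: "countable X \<Longrightarrow> |X| <o continuum"
  using uncountable_UNIV_real countable_ordLeq not_ordLeq_iff_ordLess[OF card_of_Well_order card_of_Well_order] by blast

lemma card_nat_set_pairs: "|UNIV :: (nat set \<times> nat set) set| \<le>o continuum"
proof -
  have 1: "|UNIV :: nat set set| \<le>o continuum"
    using nat_sets_eqpoll_reals unfolding eqpoll_def card_of_ordIso by (rule ordIso_imp_ordLeq)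
  have inf: "infinite (UNIV :: nat set set)"
    by (simp add: Finite_Set.finite_set)
  have "|(UNIV :: nat set set) \<times> (UNIV :: nat set set)| =o |UNIV :: nat set set|"
    by (rule card_of_Times_same_infinite[OF inf])
  then show ?thesis
    using 1 ordIso_ordLeq_trans by simp blast
qed

lemma card_of_finite_subsets:
  assumes "infinite P"
  shows "|{S. S \<subseteq> P \<and> finite S}| \<le>o |P|"
proof -
  define F where "F n = {S. S \<subseteq> P \<and> finite S \<and> card S = n}" for n :: nat
  have "|F n| \<le>o |P|" for n
  proof (induction n)
    case 0
    have "F 0 = {{}}" unfolding F_def by auto
    then show ?case
      using assms by (metis card_of_singl_ordLeq finite.emptyI)
  next
    case (Suc n)
    have "F (Suc n) \<subseteq> (\<lambda>(x, S). insert x S) ` (P \<times> F n)"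
    proof
      fix S assume "S \<in> F (Suc n)"
      then obtain x S' where "S = insert x S'" "x \<notin> S'" "card S' = n" "S \<subseteq> P" "finite S"
        unfolding F_def by (auto simp: card_Suc_eq)
      then show "S \<in> (\<lambda>(x, S). insert x S) ` (P \<times> F n)"
        unfolding F_def by (intro image_eqI[of _ _ "(x, S')"]) auto
    qed
    then have "|F (Suc n)| \<le>o |P \<times> F n|"
      by (meson card_of_image card_of_mono1 ordLeq_transitive)
    also have "|P \<times> F n| \<le>o |P \<times> P|" by (rule card_of_Times_mono2[OF Suc])
    also have "|P \<times> P| \<le>o |P|"
      using card_of_Times_same_infinite[OF assms] ordIso_imp_ordLeq by blast
    finally show ?case .
  qed
  then have "|\<Union>n\<in>UNIV. F n| \<le>o |P|"
    using assms by (intro card_of_UNION_ordLeq_infinite) (auto simp: infinite_iff_card_of_nat)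
  moreover have "{S. S \<subseteq> P \<and> finite S} = (\<Union>n\<in>UNIV. F n)" unfolding F_def by auto
  ultimately show ?thesis by simp
qed

section \<open>Coarse structures with a base of equivalence relations\<close>

definition coarse_of :: "('b \<times> 'b) set set \<Rightarrow> ('b \<times> 'b) set set" where
  "coarse_of \<R> = {E. Id \<subseteq> E \<and> (\<exists>R\<in>\<R>. E \<subseteq> R)}"

lemma coarse_of:
  assumes eq: "\<And>R. R \<in> \<R> \<Longrightarrow> equiv UNIV R" and fin: "\<And>R. R \<in> \<R> \<Longrightarrow> uniformly_finite R"
    and dir: "\<And>Q R. Q \<in> \<R> \<Longrightarrow> R \<in> \<R> \<Longrightarrow> \<exists>P\<in>\<R>. Q \<union> R \<subseteq> P"
    and cov: "\<And>x y. \<exists>R\<in>\<R>. (x, y) \<in> R"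
  shows "coarse_space UNIV (coarse_of \<R>)" "finitary UNIV (coarse_of \<R>)"
    "cellular UNIV (coarse_of \<R>)" "coarse_base (coarse_of \<R>) \<R>"
proof -
  have refl: "Id \<subseteq> R" if "R \<in> \<R>" for R
    using eq[OF that] unfolding equiv_def refl_on_def by auto
  have Rin: "\<R> \<subseteq> coarse_of \<R>" unfolding coarse_of_def using refl by blast
  show "coarse_space UNIV (coarse_of \<R>)"
    unfolding coarse_space_def
  proof (intro conjI ballI allI impI)
    show "Id_on UNIV \<subseteq> E" "E \<subseteq> UNIV \<times> UNIV" if "E \<in> coarse_of \<R>" for E
      using that unfolding coarse_of_def by auto
    show "\<Union> (coarse_of \<R>) = UNIV \<times> UNIV" using cov Rin by auto blast
    show "\<exists>G\<in>coarse_of \<R>. E O F\<inverse> \<subseteq> G" if "E \<in> coarse_of \<R>" "F \<in> coarse_of \<R>" for E F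
    proof -
      obtain Q R where QR: "Q \<in> \<R>" "E \<subseteq> Q" "R \<in> \<R>" "F \<subseteq> R" using \<open>E \<in> _\<close> \<open>F \<in> _\<close> unfolding coarse_of_def by auto
      then obtain P where P: "P \<in> \<R>" "Q \<union> R \<subseteq> P" using dir by blast
      have tr: "trans P" "sym P" using eq[OF P(1)] unfolding equiv_def by auto
      have "E O F\<inverse> \<subseteq> P"
      proof
        fix p assume "p \<in> E O F\<inverse>"
        then obtain a b c where p: "p = (a, c)" and "(a, b) \<in> E" "(c, b) \<in> F" by auto
        then have ab: "(a, b) \<in> P" and cb: "(c, b) \<in> P" using P(2) QR by auto
        show "p \<in> P" unfolding p by (rule transD[OF tr(1) ab symD[OF tr(2) cb]])
      qed
      then show ?thesis using P(1) Rin by blast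
    qed
    show "E \<in> coarse_of \<R>" if EF: "Id_on UNIV \<subseteq> E" "E \<subseteq> F" "F \<in> coarse_of \<R>" for E F
      using EF(1,3) subset_trans[OF EF(2)] unfolding coarse_of_def by auto
  qed
  show "finitary UNIV (coarse_of \<R>)"
    unfolding finitary_def
  proof
    fix E assume "E \<in> coarse_of \<R>"
    then obtain R where "R \<in> \<R>" "E \<subseteq> R" unfolding coarse_of_def by auto
    then have "uniformly_finite E" using uniformly_finite_mono[OF fin] by blast
    then show "\<exists>n. \<forall>x\<in>UNIV. finite (E `` {x}) \<and> card (E `` {x}) \<le> n"
      unfolding uniformly_finite_def by simp
  qed
  show base: "coarse_base (coarse_of \<R>) \<R>"
    unfolding coarse_base_def using Rin by (auto simp: coarse_of_def)
  show "cellular UNIV (coarse_of \<R>)"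
    unfolding cellular_def using base eq by blast
qed

text \<open>The finite blocks \<open>B \<times> B\<close> provide the entourages that relate any two
  given points, as the covering axiom of a coarse space demands.\<close>

definition join_classes :: "('b \<times> 'b) set set \<Rightarrow> ('b \<times> 'b) set set" where
  "join_classes \<P> = {(\<Union>S \<union> B \<times> B)\<^sup>* |S B. S \<subseteq> \<P> \<and> finite S \<and> finite B}"

lemma join_classes_uniformly_finite:
  assumes \<P>: "pairing_family \<P>" and S: "S \<subseteq> \<P>" "finite S" and B: "finite B"
  shows "uniformly_finite ((\<Union>S \<union> B \<times> B)\<^sup>*)"
proof -
  define R where "R = (\<Union>S)\<^sup>*"
  \<comment> \<open>With \<open>T = B\<close> the new block lies inside the saturation of
    \<open>T\<close>, so the condition outside is vacuous.\<close>
  have "uniformly_finite ((R \<union> B \<times> B)\<^sup>*)"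
  proof (rule uniformly_finite_join[of _ _ B])
    show "uniformly_finite R" unfolding R_def by (rule pairing_familyD[OF \<P> S])
    show "sym R" unfolding R_def by (rule pairing_family_sym[OF \<P> S(1)])
    show "refl R" "trans R" unfolding R_def by (auto simp: refl_rtrancl trans_rtrancl)
    have "B \<subseteq> R `` B" unfolding R_def by auto
    then show "b \<in> R `` B" if "(a, b) \<in> B \<times> B" for a b using that by auto
    show "R `` {a} \<inter> Domain (B \<times> B) = {a} \<and> (B \<times> B) `` {a} = {b}"
      if "(a, b) \<in> B \<times> B" "a \<notin> R `` B" for a b
      using that \<open>B \<subseteq> R `` B\<close> by auto
  qed (auto simp: sym_def B)
  then show ?thesis
    by (rule uniformly_finite_mono) (intro rtrancl_mono, auto simp: R_def)
qed

lemma coarse_of_join_classes: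
  assumes "pairing_family \<P>"
  shows "coarse_space UNIV (coarse_of (join_classes \<P>))" "finitary UNIV (coarse_of (join_classes \<P>))"
    "cellular UNIV (coarse_of (join_classes \<P>))" "\<pi> \<in> \<P> \<Longrightarrow> \<pi> \<union> Id \<in> coarse_of (join_classes \<P>)"
    and join_classes_equiv: "R \<in> join_classes \<P> \<Longrightarrow> equiv UNIV R"
    and join_classes_directed: "Q \<in> join_classes \<P> \<Longrightarrow> R \<in> join_classes \<P> \<Longrightarrow> \<exists>P\<in>join_classes \<P>. Q \<union> R \<subseteq> P"
    and join_classes_cover: "\<exists>R\<in>join_classes \<P>. (x, y) \<in> R"
proof -
  show eq: "equiv UNIV R" if R: "R \<in> join_classes \<P>" for R
  proof -
    obtain S B where SB: "S \<subseteq> \<P>" "R = (\<Union>S \<union> B \<times> B)\<^sup>*" using R unfolding join_classes_def by auto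
    have "sym (\<Union>S)"
      using assms SB(1) unfolding pairing_family_def by (intro symI) (meson UnionE UnionI subsetD symD)
    then have "sym R" unfolding SB(2) by (intro sym_rtrancl sym_Un) (auto simp: sym_def)
    then show ?thesis unfolding equiv_def SB(2) by (auto simp: refl_rtrancl trans_rtrancl)
  qed
  have fin: "uniformly_finite R" if "R \<in> join_classes \<P>" for R
    using that join_classes_uniformly_finite[OF assms] unfolding join_classes_def by auto
  show dir: "\<exists>P\<in>join_classes \<P>. Q \<union> R \<subseteq> P" if Q: "Q \<in> join_classes \<P>" and R: "R \<in> join_classes \<P>" for Q R
  proof -
    obtain S B where SB: "S \<subseteq> \<P>" "finite S" "finite B" "Q = (\<Union>S \<union> B \<times> B)\<^sup>*" using Q unfolding join_classes_def by auto
    obtain S' B' where SB': "S' \<subseteq> \<P>" "finite S'" "finite B'" "R = (\<Union>S' \<union> B' \<times> B')\<^sup>*" using R unfolding join_classes_def by auto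
    define P where "P = (\<Union>(S \<union> S') \<union> (B \<union> B') \<times> (B \<union> B'))\<^sup>*"
    have "Q \<subseteq> P" "R \<subseteq> P" unfolding P_def SB(4) SB'(4) by (intro rtrancl_mono; blast)+
    moreover have "P \<in> join_classes \<P>"
      unfolding join_classes_def P_def using SB SB'
      by (intro CollectI exI[of _ "S \<union> S'"] exI[of _ "B \<union> B'"]) auto
    ultimately show ?thesis by blast
  qed
  show cov: "\<exists>R\<in>join_classes \<P>. (x, y) \<in> R" for x y
  proof
    show "(\<Union>{} \<union> {x, y} \<times> {x, y})\<^sup>* \<in> join_classes \<P>"
      unfolding join_classes_def by (intro CollectI exI[of _ "{}"] exI[of _ "{x, y}"]) auto
  qed auto
  show "coarse_space UNIV (coarse_of (join_classes \<P>))" "finitary UNIV (coarse_of (join_classes \<P>))"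
    "cellular UNIV (coarse_of (join_classes \<P>))"
    using coarse_of[OF eq fin dir cov] by auto
  show "\<pi> \<union> Id \<in> coarse_of (join_classes \<P>)" if "\<pi> \<in> \<P>"
  proof -
    have "(\<Union>{\<pi>} \<union> {} \<times> {})\<^sup>* \<in> join_classes \<P>"
      unfolding join_classes_def using that by (intro CollectI exI[of _ "{\<pi>}"] exI[of _ "{}"]) auto
    moreover have "\<pi> \<union> Id \<subseteq> (\<Union>{\<pi>} \<union> {} \<times> {})\<^sup>*" by auto
    ultimately show ?thesis unfolding coarse_of_def by blast
  qed
qed

lemma slow_on_coarse_of_join_classes:
  assumes \<P>: "pairing_family \<P>" and slow: "\<And>\<pi>. \<pi> \<in> \<P> \<Longrightarrow> slow_on s \<pi>"
    and E: "E \<in> coarse_of (join_classes \<P>)"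
  shows "slow_on s E"
proof -
  obtain S B where SB: "S \<subseteq> \<P>" "finite S" "finite B" "E \<subseteq> (\<Union>S \<union> B \<times> B)\<^sup>*"
    using E unfolding coarse_of_def join_classes_def by auto
  have "slow_on s ((\<Union>S \<union> B \<times> B)\<^sup>*)"
  proof (rule slow_on_rtrancl)
    show "uniformly_finite ((\<Union>S \<union> B \<times> B)\<^sup>*)" by (rule join_classes_uniformly_finite[OF \<P> SB(1-3)])
    have "sym (\<Union>S)"
      using \<P> SB(1) unfolding pairing_family_def by (intro symI) (meson UnionE UnionI subsetD symD)
    then show "sym (\<Union>S \<union> B \<times> B)" by (intro sym_Un) (auto simp: sym_def)
    have "slow_on s (\<Union>S)"
      using SB(1) slow by (intro slow_on_Union[OF SB(2)]) blast
    then show "slow_on s (\<Union>S \<union> B \<times> B)"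
      using SB(3) by (intro slow_on_union[OF _ slow_on_finite]) auto
  qed
  then show ?thesis using SB(4) by (rule slow_on_subset)
qed

lemma card_join_classes:
  assumes "|\<P>| <o continuum"
  shows "|join_classes (\<P> :: (nat \<times> nat) set set)| <o continuum"
proof -
  define Q where "Q = {S. S \<subseteq> \<P> \<and> finite S} \<times> {B :: nat set. finite B}"
  have "join_classes \<P> = (\<lambda>(S, B). (\<Union>S \<union> B \<times> B)\<^sup>*) ` Q"
    unfolding join_classes_def Q_def by auto
  then have 1: "|join_classes \<P>| \<le>o |Q|" by (simp only: card_of_image)
  have fin: "countable {B :: nat set. finite B}" by (rule countable_Collect_finite)
  have "|Q| <o continuum"
  proof (cases "countable \<P>")
    case True
    then have "countable {S. S \<subseteq> \<P> \<and> finite S}"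
      using countable_Collect_finite_subset by (metis (no_types, lifting) Collect_cong)
    then have "countable Q" unfolding Q_def using fin by auto
    then show ?thesis by (rule countable_ordLess_continuum)
  next
    case False
    then have inf: "infinite \<P>" by (auto dest: countable_finite)
    have "|Q| \<le>o |\<P> \<times> {B :: nat set. finite B}|"
      unfolding Q_def by (rule card_of_Times_mono1[OF card_of_finite_subsets[OF inf]])
    also have "|\<P> \<times> {B :: nat set. finite B}| =o |\<P>|"
    proof -
      have le: "|{B :: nat set. finite B}| \<le>o |\<P>|"
        using fin inf unfolding countable_card_of_nat infinite_iff_card_of_nat by (rule ordLeq_transitive)
      have ne: "{B :: nat set. finite B} \<noteq> {}" by auto
      show ?thesis by (rule card_of_Times_infinite[OF inf ne le, THEN conjunct1])
    qed
    finally show ?thesis using assms ordLeq_ordLess_trans by blast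
  qed
  then show ?thesis using 1 ordLeq_ordLess_trans by blast
qed

lemma finitary_bounded_finite:
  "finitary X \<E> \<Longrightarrow> coarse_bounded X \<E> B \<Longrightarrow> finite B"
  unfolding finitary_def coarse_bounded_def by (blast intro: finite_subset)

text \<open>Pull the joins back along an enumeration of \<open>A\<close>. They form a base of a
  cellular finitary coarse structure on the naturals, and there are fewer than continuum many of
  them. By the assumption on \<open>Delta_cellular\<close> this structure has an infinite discrete
  set, and the image of that set in \<open>A\<close> is thin.\<close>

lemma thinnable_Delta_cellular:
  fixes \<P> :: "(nat \<times> nat) set set"
  assumes \<P>: "pairing_family \<P>" and card: "|\<P>| <o continuum" and Delta: "Delta_cellular =o continuum"
  shows "thinnable \<P>"
  unfolding thinnable_def
proof (intro allI impI)
  fix A :: "nat set" assume A: "infinite A"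
  define e where "e = enumerate A"
  have e: "bij_betw e UNIV A" unfolding e_def using A by (rule bij_enumerate)
  have inj: "inj e" using e by (simp add: bij_betw_def)
  define \<R> where "\<R> = (\<lambda>R. inv_image R e) ` join_classes \<P>"
  have jc: "uniformly_finite R" if "R \<in> join_classes \<P>" for R
    using that join_classes_uniformly_finite[OF \<P>] unfolding join_classes_def by auto
  have 1: "equiv UNIV R" if R: "R \<in> \<R>" for R
  proof -
    obtain Q where Q: "Q \<in> join_classes \<P>" "R = inv_image Q e" using R unfolding \<R>_def by auto
    have "refl_on UNIV Q" "sym Q" "trans Q" using join_classes_equiv[OF \<P> Q(1)] unfolding equiv_def by auto
    then have "refl_on UNIV R" "sym R" "trans R"
      unfolding Q(2) by (simp_all add: refl_on_def sym_inv_image trans_inv_image)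
    then show ?thesis unfolding equiv_def by simp
  qed
  have 2: "uniformly_finite R" if R: "R \<in> \<R>" for R
  proof -
    obtain Q where Q: "Q \<in> join_classes \<P>" "R = inv_image Q e" using R unfolding \<R>_def by auto
    obtain k where k: "\<And>x. finite (Q `` {x}) \<and> card (Q `` {x}) \<le> k"
      using jc[OF Q(1)] unfolding uniformly_finite_def by auto
    have "finite (R `` {x}) \<and> card (R `` {x}) \<le> k" for x
    proof -
      have sub: "e ` (R `` {x}) \<subseteq> Q `` {e x}" unfolding Q(2) by auto
      have injR: "inj_on e (R `` {x})" using inj by (rule inj_on_subset) auto
      have "finite (R `` {x})" using k[of "e x"] injR sub by (meson inj_on_finite)
      moreover have "card (R `` {x}) \<le> card (Q `` {e x})" using k[of "e x"] injR sub by (intro card_inj_on_le[of e]) auto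
      ultimately show ?thesis using k[of "e x"] by linarith
    qed
    then show ?thesis unfolding uniformly_finite_def by blast
  qed
  have 3: "\<exists>P\<in>\<R>. Q \<union> R \<subseteq> P" if QR: "Q \<in> \<R>" "R \<in> \<R>" for Q R
  proof -
    obtain Q' R' where *: "Q' \<in> join_classes \<P>" "Q = inv_image Q' e" "R' \<in> join_classes \<P>" "R = inv_image R' e"
      using QR unfolding \<R>_def by auto
    obtain P' where "P' \<in> join_classes \<P>" "Q' \<union> R' \<subseteq> P'" using join_classes_directed[OF \<P> *(1,3)] by blast
    then show ?thesis unfolding \<R>_def using * by (intro bexI[of _ "inv_image P' e"]) auto
  qed
  have 4: "\<exists>R\<in>\<R>. (x, y) \<in> R" for x y
    using join_classes_cover[OF \<P>, of "e x" "e y"] unfolding \<R>_def by auto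
  note co = coarse_of[OF 1 2 3 4]
  have "\<exists>D. infinite D \<and> coarse_discrete UNIV (coarse_of \<R>) D"
  proof (rule ccontr)
    assume no: "\<not> ?thesis"
    define \<C> where "\<C> = {\<B>. \<exists>\<E>. coarse_space (UNIV :: nat set) \<E> \<and> cellular UNIV \<E> \<and> finitary UNIV \<E> \<and>
      \<not> (\<exists>D. infinite D \<and> coarse_discrete UNIV \<E> D) \<and> coarse_base \<E> \<B>}"
    have "\<R> \<in> \<C>" unfolding \<C>_def using co no by blast
    then have "least_card \<C> \<le>o |\<R>|" using least_card[of \<C>] by blast
    then have "Delta_cellular \<le>o |\<R>|" unfolding Delta_cellular_def \<C>_def .
    moreover have "|\<R>| \<le>o |join_classes \<P>|" unfolding \<R>_def by (rule card_of_image)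
    ultimately have "continuum \<le>o |join_classes \<P>|"
      using Delta by (meson ordIso_ordLeq_trans ordIso_symmetric ordLeq_transitive)
    then show False using card_join_classes[OF card] not_ordLess_ordLeq by blast
  qed
  then obtain D where D: "infinite D" "coarse_discrete UNIV (coarse_of \<R>) D" by blast
  show "\<exists>D\<subseteq>A. infinite D \<and> (\<forall>S\<subseteq>\<P>. finite S \<longrightarrow> finite {a\<in>D. (\<Union>S)\<^sup>* `` {a} \<inter> D \<noteq> {a}})"
  proof (intro exI[of _ "e ` D"] conjI allI impI)
    show "e ` D \<subseteq> A" using e unfolding bij_betw_def by auto
    show "infinite (e ` D)" using D(1) inj finite_imageD inj_on_subset by blast
    fix S assume S: "S \<subseteq> \<P>" "finite S"
    define R where "R = (\<Union>S)\<^sup>*"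
    have "R \<in> join_classes \<P>"
      unfolding join_classes_def R_def using S by (intro CollectI exI[of _ S] exI[of _ "{}"]) auto
    then have "inv_image R e \<in> \<R>" unfolding \<R>_def by auto
    then have "inv_image R e \<in> coarse_of \<R>" using co(4) unfolding coarse_base_def by blast
    then obtain B where B: "coarse_bounded UNIV (coarse_of \<R>) B" "\<forall>x\<in>D - B. D \<inter> inv_image R e `` {x} = {x}"
      using D(2) unfolding coarse_discrete_def by blast
    have "finite B" using finitary_bounded_finite[OF co(2) B(1)] .
    moreover have "{a \<in> e ` D. R `` {a} \<inter> e ` D \<noteq> {a}} \<subseteq> e ` B"
    proof
      fix a assume a: "a \<in> {a \<in> e ` D. R `` {a} \<inter> e ` D \<noteq> {a}}"
      then obtain x where x: "a = e x" "x \<in> D" by auto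
      have "R `` {e x} \<inter> e ` D = e ` (D \<inter> inv_image R e `` {x})" by auto
      then have "D \<inter> inv_image R e `` {x} \<noteq> {x}" using a x by auto
      then show "a \<in> e ` B" using B(2) x by blast
    qed
    ultimately show "finite {a \<in> e ` D. (\<Union>S)\<^sup>* `` {a} \<inter> e ` D \<noteq> {a}}"
      unfolding R_def by (meson finite_imageI finite_subset)
  qed
qed

section \<open>Convergent subsequences and transfinite constructions\<close>

lemma pairing_family_empty: "pairing_family {}"
  unfolding pairing_family_def uniformly_finite_def by (auto intro!: exI[of _ 1])

lemma frequently_sequentially_infinite: "(\<exists>\<^sub>F n in sequentially. P n) \<longleftrightarrow> infinite {n::nat. P n}"
  by (simp add: cofinite_eq_sequentially[symmetric] frequently_cofinite)

lemma convergent_subset_countable: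
  assumes cl: "clusters G A x" and G: "countable G"
  obtains A' where "A' \<subseteq> A" "infinite A'" "converges G A' x"
proof -
  obtain GS :: "nat \<Rightarrow> _ set" where GS: "\<And>i j. i \<le> j \<Longrightarrow> GS i \<subseteq> GS j" "\<And>k. finite (GS k)" "\<And>k. GS k \<subseteq> G"
    "\<And>F. F \<subseteq> G \<Longrightarrow> finite F \<Longrightarrow> \<exists>k. F \<subseteq> GS k"
    by (rule countable_exhaustion[OF G]) (rule that)
  have step: "\<exists>n>N. n \<in> A \<and> (\<forall>g\<in>GS k. dev g n x < 1 / real (k + 1))" for N k
  proof -
    have "\<exists>\<^sub>F n in sequentially. n \<in> A \<and> (\<forall>g\<in>GS k. dev g n x < 1 / real (k + 1))"
      by (rule clustersD[OF cl GS(3) GS(2)]) simp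
    then show ?thesis
      unfolding frequently_sequentially by (meson Suc_le_eq)
  qed
  have "\<exists>m. \<forall>k. (m k \<in> A \<and> (\<forall>g\<in>GS k. dev g (m k) x < 1 / real (k + 1))) \<and> m k < m (Suc k)"
    by (rule dependent_nat_choice[where Q = "\<lambda>_. (<)"]) (use step in blast)+
  then obtain m where m: "\<And>k. m k \<in> A" "\<And>k g. g \<in> GS k \<Longrightarrow> dev g (m k) x < 1 / real (k + 1)"
    "\<And>k. m k < m (Suc k)" by blast
  have mono: "strict_mono m" by (rule strict_monoI_Suc) (rule m(3))
  show thesis
  proof (rule that[of "range m"])
    show "range m \<subseteq> A" using m(1) by auto
    show "infinite (range m)" using strict_mono_imp_inj_on[OF mono] by (rule range_inj_infinite)
    show "converges G (range m) x"
      unfolding converges_def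
    proof (intro ballI allI impI)
      fix g and \<epsilon> :: real assume g: "g \<in> G" and \<epsilon>: "\<epsilon> > 0"
      obtain k0 where k0: "{g} \<subseteq> GS k0" using GS(4)[of "{g}"] g by auto
      obtain k1 where k1: "1 / real (k1 + 1) < \<epsilon>" using \<epsilon> nat_approx_posE by (metis Suc_eq_plus1)
      show "\<forall>\<^sub>F n in sequentially. n \<in> range m \<longrightarrow> dev g n x < \<epsilon>"
        using eventually_ge_at_top[of "m (max k0 k1)"]
      proof eventually_elim
        case (elim n)
        show ?case
        proof
          assume "n \<in> range m"
          then obtain k where k: "n = m k" by auto
          then have kk: "max k0 k1 \<le> k" using elim strict_mono_less_eq[OF mono] by simp
          then have "g \<in> GS k" using k0 GS(1)[of k0 k] by auto
          then have "dev g n x < 1 / real (k + 1)" unfolding k by (rule m(2))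
          also have "\<dots> \<le> 1 / real (k1 + 1)" using kk by (intro divide_left_mono) auto
          also have "\<dots> < \<epsilon>" by (rule k1)
          finally show "dev g n x < \<epsilon>" .
        qed
      qed
    qed
  qed
qed

lemma pseudointersectionE:
  fixes \<F> :: "nat set set"
  assumes "|\<F>| <o pseudointersection_number"
    and "\<And>\<G>. \<G> \<subseteq> \<F> \<Longrightarrow> finite \<G> \<Longrightarrow> \<G> \<noteq> {} \<Longrightarrow> infinite (\<Inter>\<G>)"
  obtains I where "infinite I" "\<And>F. F \<in> \<F> \<Longrightarrow> finite (I - F)"
proof -
  define \<C> :: "nat set set set" where "\<C> = {\<F>. (\<forall>F\<in>\<F>. infinite F) \<and>
     (\<forall>\<G>. \<G> \<subseteq> \<F> \<longrightarrow> finite \<G> \<longrightarrow> \<G> \<noteq> {} \<longrightarrow> infinite (\<Inter>\<G>)) \<and>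
     (\<forall>I. infinite I \<longrightarrow> (\<exists>F\<in>\<F>. infinite (I - F)))}"
  have "\<F> \<notin> \<C>"
  proof
    assume "\<F> \<in> \<C>"
    then have "least_card \<C> \<le>o |\<F>|" using least_card[of \<C>] by blast
    then have "pseudointersection_number \<le>o |\<F>|" unfolding pseudointersection_number_def \<C>_def .
    then show False using assms(1) not_ordLess_ordLeq by blast
  qed
  moreover have "infinite F" if "F \<in> \<F>" for F
    using assms(2)[of "{F}"] that by simp
  ultimately have "\<not> (\<forall>I. infinite I \<longrightarrow> (\<exists>F\<in>\<F>. infinite (I - F)))"
    unfolding \<C>_def using assms(2) by blast
  then show thesis using that by blast
qed

text \<open>The sets of \<open>n\<close> in \<open>A\<close> at which one coordinate is within
  1/(k+1) of its value at \<open>x\<close> have infinite finite intersections, because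
  \<open>A\<close> clusters at \<open>x\<close>. For infinite \<open>G\<close> there are at most
  \<open>|G|\<close> of them, and a pseudointersection of them converges to
  \<open>x\<close>.\<close>

lemma convergent_subset_pseudointersection:
  assumes cl: "clusters G A x" and inf: "infinite G" and card: "|G| <o pseudointersection_number"
  obtains A' where "A' \<subseteq> A" "infinite A'" "converges G A' x"
proof -
  define \<phi> where "\<phi> = (\<lambda>(g, k). {n \<in> A. dev g n x < 1 / real (k + 1 :: nat)})"
  define \<F> where "\<F> = \<phi> ` (G \<times> UNIV)"
  have "|\<F>| \<le>o |G \<times> (UNIV :: nat set)|" unfolding \<F>_def by (rule card_of_image)
  also have "|G \<times> (UNIV :: nat set)| =o |G|"
    using inf by (intro card_of_Times_infinite[THEN conjunct1]) (auto simp: infinite_iff_card_of_nat)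
  finally have "|\<F>| <o pseudointersection_number" using card ordLeq_ordLess_trans by blast
  moreover have "infinite (\<Inter>\<G>)" if \<G>: "\<G> \<subseteq> \<F>" "finite \<G>" "\<G> \<noteq> {}" for \<G>
  proof -
    obtain S where S: "S \<subseteq> G \<times> UNIV" "finite S" "\<G> = \<phi> ` S"
      using finite_subset_image[OF \<G>(2)] \<G>(1) unfolding \<F>_def by blast
    define k where "k = Max (insert 0 (snd ` S))"
    have k: "snd p \<le> k" if "p \<in> S" for p unfolding k_def using S(2) that by simp
    have "\<exists>\<^sub>F n in sequentially. n \<in> A \<and> (\<forall>g\<in>fst ` S. dev g n x < 1 / real (k + 1))"
      using S by (intro clustersD[OF cl]) auto
    then have "infinite {n. n \<in> A \<and> (\<forall>g\<in>fst ` S. dev g n x < 1 / real (k + 1))}"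
      unfolding frequently_sequentially_infinite .
    moreover have "{n. n \<in> A \<and> (\<forall>g\<in>fst ` S. dev g n x < 1 / real (k + 1))} \<subseteq> \<Inter>\<G>"
    proof (rule subsetI, rule InterI)
      fix n F assume n: "n \<in> {n. n \<in> A \<and> (\<forall>g\<in>fst ` S. dev g n x < 1 / real (k + 1))}" and "F \<in> \<G>"
      then obtain p where p: "p \<in> S" "F = \<phi> p" using S(3) by auto
      have "1 / real (k + 1) \<le> 1 / real (snd p + 1)" using k[OF p(1)] by (intro divide_left_mono) auto
      moreover have "dev (fst p) n x < 1 / real (k + 1)" "n \<in> A" using n p(1) by auto
      ultimately show "n \<in> F" unfolding p(2) \<phi>_def by (simp add: case_prod_unfold)
    qed
    ultimately show ?thesis using finite_subset by blast
  qed
  ultimately obtain I where I: "infinite I" "\<And>F. F \<in> \<F> \<Longrightarrow> finite (I - F)"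
    using pseudointersectionE by metis
  \<comment> \<open>The pseudointersection need not lie in \<open>A\<close>. Any one of the sets,
    here for \<open>g0\<close> and k = 0, is contained in \<open>A\<close> and so shows that only
    finitely many points lie outside.\<close>
  have "G \<noteq> {}" using inf by auto
  then obtain g0 where "g0 \<in> G" by blast
  then have "finite (I - \<phi> (g0, 0))" using I(2) unfolding \<F>_def by blast
  moreover have "I - A \<subseteq> I - \<phi> (g0, 0)" unfolding \<phi>_def by auto
  ultimately have "finite (I - A)" by (rule finite_subset[rotated])
  moreover have "I - (I - A) = A \<inter> I" by blast
  ultimately have "infinite (A \<inter> I)" using I(1) Diff_infinite_finite[of "I - A" I] by simp
  show thesis
  proof (rule that[of "A \<inter> I"])
    show "converges G (A \<inter> I) x"
      unfolding converges_def
    proof (intro ballI allI impI)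
      fix g and \<epsilon> :: real assume g: "g \<in> G" and \<epsilon>: "\<epsilon> > 0"
      obtain k where k: "1 / real (k + 1) < \<epsilon>" using \<epsilon> nat_approx_posE by (metis Suc_eq_plus1)
      have "finite (I - \<phi> (g, k))" using I(2) g unfolding \<F>_def by blast
      then have "\<forall>\<^sub>F n in sequentially. n \<notin> I - \<phi> (g, k)"
        by (simp add: cofinite_eq_sequentially[symmetric] eventually_cofinite del: Diff_iff)
      then show "\<forall>\<^sub>F n in sequentially. n \<in> A \<inter> I \<longrightarrow> dev g n x < \<epsilon>"
        by eventually_elim (use k in \<open>auto simp: \<phi>_def\<close>)
    qed
  qed (use \<open>infinite (A \<inter> I)\<close> in auto)
qed

text \<open>A Frechet-Urysohn property: cluster points of a set of naturals are limits of its
  infinite subsets. It lets two sets clustering at \<open>x\<close> be matched by pairs along which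
  all coded sequences are slow.\<close>

definition sequential_clusters :: "'a set \<Rightarrow> 'a coding \<Rightarrow> bool" where
  "sequential_clusters T G \<longleftrightarrow>
    (\<forall>x\<in>T. \<forall>A. clusters G A x \<longrightarrow> (\<exists>A'\<subseteq>A. infinite A' \<and> converges G A' x))"

text \<open>One common cluster point is enough: that \<pi> meets \<open>A \<times> B\<close>
  infinitely often does not mention the point, so the same pairing serves all common cluster points
  of \<open>A\<close> and \<open>B\<close>. If there is none, the empty relation is added.\<close>

lemma pairing_step:
  assumes \<P>: "pairing_family \<P>" "thinnable \<P>" and G: "sequential_clusters T G"
  obtains \<pi> where "pairing_family (insert \<pi> \<P>)" "\<And>g. g \<in> G \<Longrightarrow> slow_on (snd g) \<pi>"
    "\<And>x. x \<in> T \<Longrightarrow> clusters G A x \<Longrightarrow> clusters G B x \<Longrightarrow> infinite (\<pi> \<inter> A \<times> B)"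
proof (cases "\<exists>x\<in>T. clusters G A x \<and> clusters G B x")
  case True
  then obtain x where x: "x \<in> T" "clusters G A x" "clusters G B x" by blast
  obtain A' where A': "A' \<subseteq> A" "infinite A'" "converges G A' x" using G x unfolding sequential_clusters_def by blast
  obtain B' where B': "B' \<subseteq> B" "infinite B'" "converges G B' x" using G x unfolding sequential_clusters_def by blast
  obtain \<pi> where \<pi>: "sym \<pi>" "\<pi> \<subseteq> A' \<times> B' \<union> B' \<times> A'" "infinite (\<pi> \<inter> A' \<times> B')" "pairing_family (insert \<pi> \<P>)"
    by (rule pairing_family_extend[OF \<P> A'(2) B'(2)])
  have "uniformly_finite ((\<Union>{\<pi>})\<^sup>*)" by (rule pairing_familyD[OF \<pi>(4)]) auto
  then have uf: "uniformly_finite \<pi>" by (rule uniformly_finite_mono) auto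
  show thesis
  proof (rule that[OF \<pi>(4)])
    show "slow_on (snd g) \<pi>" if "g \<in> G" for g
      by (rule converges_slow_on[OF \<pi>(2,1) uf A'(3) B'(3) that])
    have "\<pi> \<inter> A' \<times> B' \<subseteq> \<pi> \<inter> A \<times> B" using A'(1) B'(1) by auto
    then show "infinite (\<pi> \<inter> A \<times> B)" using \<pi>(3) finite_subset by blast
  qed
next
  case False
  have "pairing_family (insert {} \<P>)"
    by (rule pairing_family_insert_link[OF \<P>(1), of "{}"]) auto
  then show thesis using False by (intro that[of "{}"]) (auto simp: slow_on_def)
qed

section \<open>Recursions through pairs of sets and through functions\<close>

lemma pairings_Delta:
  assumes G: "sequential_clusters T G" and Delta: "Delta_cellular =o continuum"
  obtains \<P> where "pairing_family \<P>" "\<And>g \<pi>. g \<in> G \<Longrightarrow> \<pi> \<in> \<P> \<Longrightarrow> slow_on (snd g) \<pi>"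
    "\<And>x A B. x \<in> T \<Longrightarrow> clusters G A x \<Longrightarrow> clusters G B x \<Longrightarrow> \<exists>\<pi>\<in>\<P>. infinite (\<pi> \<inter> A \<times> B)"
proof -
  define Inv where "Inv \<P> \<longleftrightarrow> pairing_family \<P> \<and> (\<forall>g\<in>G. \<forall>\<pi>\<in>\<P>. slow_on (snd g) \<pi>)" for \<P>
  \<comment> \<open>A cardinal order on the pairs \<open>(A, B)\<close>: proper initial segments
    have fewer than continuum many elements, so the earlier pairings are few enough for
    \<open>thinnable_Delta_cellular\<close>.\<close>
  define r where "r = |UNIV :: (nat set \<times> nat set) set|"
  define Q where "Q p (X :: (nat \<times> nat) set set) \<pi> \<longleftrightarrow>
    (\<forall>x\<in>T. clusters G (fst p) x \<longrightarrow> clusters G (snd p) x \<longrightarrow> infinite (\<pi> \<inter> fst p \<times> snd p))" for p X and \<pi> :: "(nat \<times> nat) set"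
  have Fr: "Field r = UNIV" unfolding r_def by (rule Field_card_of)
  obtain g where g: "Inv (g ` Field r)" "\<And>p. p \<in> Field r \<Longrightarrow> Q p (g ` underS r p) (g p)"
  proof (rule transfinite_extension[of r Inv Q])
    show "Well_order r" unfolding r_def by (rule card_of_Well_order)
    show "Inv {}" unfolding Inv_def using pairing_family_empty by simp
    show "Inv X \<longleftrightarrow> (\<forall>S\<subseteq>X. finite S \<longrightarrow> Inv S)" for X
    proof
      assume "Inv X" then show "\<forall>S\<subseteq>X. finite S \<longrightarrow> Inv S"
        unfolding Inv_def using pairing_family_subset by blast
    next
      assume *: "\<forall>S\<subseteq>X. finite S \<longrightarrow> Inv S"
      have "pairing_family (id ` X)"
        by (rule pairing_family_image) (use * in \<open>auto simp: Inv_def\<close>)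
      moreover have "slow_on (snd g) \<pi>" if "g \<in> G" "\<pi> \<in> X" for g \<pi>
        using *[rule_format, of "{\<pi>}"] that unfolding Inv_def by auto
      ultimately show "Inv X" unfolding Inv_def by auto
    qed
    show "\<exists>v. Inv (insert v X) \<and> Q p X v" if p: "p \<in> Field r" and X: "Inv X" "|X| \<le>o |underS r p|" for p X
    proof -
      have "|underS r p| <o r" unfolding r_def by (rule card_of_underS[OF card_of_Card_order]) (simp add: Field_card_of)
      then have "|underS r p| <o continuum" unfolding r_def using card_nat_set_pairs ordLess_ordLeq_trans by blast
      then have "|X| <o continuum" using X(2) ordLeq_ordLess_trans by blast
      then have th: "thinnable X" using X(1) Delta unfolding Inv_def by (intro thinnable_Delta_cellular) auto
      have pf: "pairing_family X" using X(1) unfolding Inv_def by simp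
      obtain \<pi> where "pairing_family (insert \<pi> X)" "\<And>g. g \<in> G \<Longrightarrow> slow_on (snd g) \<pi>"
        "\<And>x. x \<in> T \<Longrightarrow> clusters G (fst p) x \<Longrightarrow> clusters G (snd p) x \<Longrightarrow> infinite (\<pi> \<inter> fst p \<times> snd p)"
        by (rule pairing_step[OF pf th G, of "fst p" "snd p"]) blast
      then show ?thesis using X(1) unfolding Inv_def Q_def by (intro exI[of _ \<pi>]) auto
    qed
  qed (rule that)
  show thesis
  proof (rule that[of "range g"])
    show "pairing_family (range g)" using g(1) unfolding Fr Inv_def by simp
    show "slow_on (snd h) \<pi>" if "h \<in> G" "\<pi> \<in> range g" for h \<pi>
      using g(1) that unfolding Fr Inv_def by blast
    show "\<exists>\<pi>\<in>range g. infinite (\<pi> \<inter> A \<times> B)" if "x \<in> T" "clusters G A x" "clusters G B x" for x A B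
      using g(2)[of "(A, B)"] that unfolding Fr Q_def by auto
  qed
qed

text \<open>Each stage first picks a pairing for \<open>(A \<alpha>, B \<alpha>)\<close> with
  respect to the countable coding so far, then a sequence for \<open>f \<alpha>\<close> that is slow
  along it and all earlier ones. A cluster point for the final coding is one for each earlier
  coding, so an early pairing still does its work at the end.\<close>

lemma omega1_approximation:
  fixes f :: "nat set \<Rightarrow> 'a \<Rightarrow> real" and A B :: "nat set \<Rightarrow> nat set"
  assumes T: "T \<noteq> {}"
  obtains G :: "'a coding" and \<P> where "approx_in T G" "approx_onto T G" "pairing_family \<P>"
    "\<And>g \<pi>. g \<in> G \<Longrightarrow> \<pi> \<in> \<P> \<Longrightarrow> slow_on (snd g) \<pi>" "fst ` G = f ` Field \<omega>\<^sub>1" "|G| \<le>o \<omega>\<^sub>1"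
    "\<And>x \<alpha>. x \<in> T \<Longrightarrow> \<alpha> \<in> Field \<omega>\<^sub>1 \<Longrightarrow> clusters G (A \<alpha>) x \<Longrightarrow> clusters G (B \<alpha>) x \<Longrightarrow>
      \<exists>\<pi>\<in>\<P>. infinite (\<pi> \<inter> A \<alpha> \<times> B \<alpha>)"
proof -
  define Inv where "Inv X \<longleftrightarrow> approx_in T (fst ` X) \<and> approx_onto T (fst ` X) \<and> pairing_family (snd ` X) \<and>
    (\<forall>g\<in>fst ` X. \<forall>\<pi>\<in>snd ` X. slow_on (snd g) \<pi>)" for X :: "((('a \<Rightarrow> real) \<times> (nat \<Rightarrow> real)) \<times> (nat \<times> nat) set) set"
  define Q where "Q \<alpha> X v \<longleftrightarrow> fst (fst v) = f \<alpha> \<and> (\<forall>x\<in>T. clusters (fst ` X) (A \<alpha>) x \<longrightarrow> clusters (fst ` X) (B \<alpha>) x \<longrightarrow>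
    infinite (snd v \<inter> A \<alpha> \<times> B \<alpha>))" for \<alpha> and X :: "((('a \<Rightarrow> real) \<times> (nat \<Rightarrow> real)) \<times> (nat \<times> nat) set) set" and v :: "(('a \<Rightarrow> real) \<times> (nat \<Rightarrow> real)) \<times> (nat \<times> nat) set"
  obtain h where h: "Inv (h ` Field \<omega>\<^sub>1)" "\<And>\<alpha>. \<alpha> \<in> Field \<omega>\<^sub>1 \<Longrightarrow> Q \<alpha> (h ` underS \<omega>\<^sub>1 \<alpha>) (h \<alpha>)"
  proof (rule transfinite_extension[of \<omega>\<^sub>1 Inv Q])
    show "Well_order \<omega>\<^sub>1" by (rule Well_order_omega1)
    show "Inv {}"
    proof -
      have "pairing_family ({} :: (nat \<times> nat) set set)" by (rule pairing_family_empty)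
      moreover have "approx_in T {}" using T unfolding approx_in_def by auto
      moreover have "approx_onto T {}"
        unfolding approx_onto_def clusters_def by (auto simp: frequently_sequentially)
      ultimately show ?thesis unfolding Inv_def by simp
    qed
    show "Inv X \<longleftrightarrow> (\<forall>S\<subseteq>X. finite S \<longrightarrow> Inv S)" for X
    proof
      assume X: "Inv X" show "\<forall>S\<subseteq>X. finite S \<longrightarrow> Inv S"
      proof (intro allI impI)
        fix S assume "S \<subseteq> X"
        then have sub: "fst ` S \<subseteq> fst ` X" "snd ` S \<subseteq> snd ` X" by auto
        have "approx_in T (fst ` S)" using X approx_in_subset[OF _ sub(1)] unfolding Inv_def by simp
        moreover have "approx_onto T (fst ` S)"
          using X clusters_subset[OF _ sub(1)] unfolding Inv_def approx_onto_def by simp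
        moreover have "pairing_family (snd ` S)" using X pairing_family_subset[OF _ sub(2)] unfolding Inv_def by simp
        moreover have "\<forall>g\<in>fst ` S. \<forall>\<pi>\<in>snd ` S. slow_on (snd g) \<pi>"
          using X \<open>S \<subseteq> X\<close> unfolding Inv_def by auto
        ultimately show "Inv S" unfolding Inv_def by simp
      qed
    next
      assume *: "\<forall>S\<subseteq>X. finite S \<longrightarrow> Inv S"
      have pre: "\<exists>S\<subseteq>X. finite S \<and> F = fst ` S" if "F \<subseteq> fst ` X" "finite F" for F
        using finite_subset_image[OF that(2,1)] by blast
      have "approx_in T (fst ` X)"
        unfolding approx_in_def
      proof (intro allI impI)
        fix F and \<epsilon> :: real assume F: "F \<subseteq> fst ` X" "finite F" and \<epsilon>: "0 < \<epsilon>"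
        obtain S where S: "S \<subseteq> X" "finite S" "F = fst ` S" using pre[OF F] by blast
        then have "approx_in T F" using * unfolding Inv_def by blast
        then show "\<forall>\<^sub>F n in sequentially. \<exists>x\<in>T. \<forall>g\<in>F. dev g n x < \<epsilon>"
          using F(2) \<epsilon> by (intro approx_inD) auto
      qed
      moreover have "approx_onto T (fst ` X)"
        unfolding approx_onto_def clusters_def
      proof (intro ballI allI impI)
        fix x F and \<epsilon> :: real assume x: "x \<in> T" and F: "F \<subseteq> fst ` X" "finite F" and \<epsilon>: "0 < \<epsilon>"
        obtain S where S: "S \<subseteq> X" "finite S" "F = fst ` S" using pre[OF F] by blast
        then have "clusters F UNIV x" using * x unfolding Inv_def approx_onto_def by blast
        then show "\<exists>\<^sub>F n in sequentially. n \<in> UNIV \<and> (\<forall>g\<in>F. dev g n x < \<epsilon>)"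
          using F(2) \<epsilon> by (intro clustersD) auto
      qed
      moreover have "pairing_family (snd ` X)"
        by (rule pairing_family_image) (use * in \<open>auto simp: Inv_def\<close>)
      moreover have "slow_on (snd g) \<pi>" if g\<pi>: "g \<in> fst ` X" "\<pi> \<in> snd ` X" for g \<pi>
      proof -
        obtain a b where ab: "a \<in> X" "g = fst a" "b \<in> X" "\<pi> = snd b" using g\<pi> by blast
        then have "Inv {a, b}" using * by auto
        then show ?thesis unfolding Inv_def using ab by auto
      qed
      ultimately show "Inv X" unfolding Inv_def by blast
    qed
    show "\<exists>v. Inv (insert v X) \<and> Q \<alpha> X v" if \<alpha>: "\<alpha> \<in> Field \<omega>\<^sub>1" and X: "Inv X" "|X| \<le>o |underS \<omega>\<^sub>1 \<alpha>|" for \<alpha> X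
    proof -
      have cX: "countable X" using countable_ordLeq[OF X(2) countable_underS_omega1[OF \<alpha>]] .
      define G where "G = fst ` X"
      define \<P> where "\<P> = snd ` X"
      have IG: "approx_in T G \<and> approx_onto T G \<and> pairing_family \<P> \<and> (\<forall>g\<in>G. \<forall>\<pi>\<in>\<P>. slow_on (snd g) \<pi>)"
        using X(1) unfolding Inv_def G_def \<P>_def .
      have G: "countable G" "approx_in T G" "approx_onto T G" and \<P>: "pairing_family \<P>" "countable \<P>"
        using IG cX by (simp_all add: G_def \<P>_def)
      have slow: "slow_on (snd g) \<pi>" if "g \<in> G" "\<pi> \<in> \<P>" for g \<pi>
        using IG that by blast
      have "sequential_clusters T G"
        unfolding sequential_clusters_def using convergent_subset_countable[OF _ G(1)] by metis
      then obtain \<pi> where \<pi>: "pairing_family (insert \<pi> \<P>)" "\<And>g. g \<in> G \<Longrightarrow> slow_on (snd g) \<pi>"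
        "\<And>x. x \<in> T \<Longrightarrow> clusters G (A \<alpha>) x \<Longrightarrow> clusters G (B \<alpha>) x \<Longrightarrow> infinite (\<pi> \<inter> A \<alpha> \<times> B \<alpha>)"
        by (rule pairing_step[OF \<P>(1) thinnable_countable[OF \<P>], of T G "A \<alpha>" "B \<alpha>"]) blast
      obtain s where s: "approx_in T (insert (f \<alpha>, s) G)" "approx_onto T (insert (f \<alpha>, s) G)"
        "\<And>\<rho>. \<rho> \<in> insert \<pi> \<P> \<Longrightarrow> slow_on s \<rho>"
        by (rule extend_approximation[OF T G \<pi>(1), where f = "f \<alpha>"]) (use \<P>(2) slow \<pi>(2) in auto)
      have "Inv (insert ((f \<alpha>, s), \<pi>) X)"
        unfolding Inv_def using s \<pi>(1,2) slow unfolding G_def \<P>_def by auto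
      moreover have "Q \<alpha> X ((f \<alpha>, s), \<pi>)" unfolding Q_def using \<pi>(3) unfolding G_def by auto
      ultimately show ?thesis by blast
    qed
  qed (rule that)
  define X where "X = h ` Field \<omega>\<^sub>1"
  have X: "Inv X" unfolding X_def by (rule h(1))
  show thesis
  proof (rule that[of "fst ` X" "snd ` X"])
    show "approx_in T (fst ` X)" "approx_onto T (fst ` X)" "pairing_family (snd ` X)"
      using X unfolding Inv_def by auto
    show "slow_on (snd g) \<pi>" if "g \<in> fst ` X" "\<pi> \<in> snd ` X" for g \<pi>
      using X that unfolding Inv_def by blast
    show "fst ` fst ` X = f ` Field \<omega>\<^sub>1"
      unfolding X_def image_image using h(2) unfolding Q_def by (intro image_cong) auto
    have "|fst ` X| \<le>o |Field \<omega>\<^sub>1|" unfolding X_def image_image by (rule card_of_image)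
    then show "|fst ` X| \<le>o \<omega>\<^sub>1" using Field_omega1(1) by (rule ordLeq_ordIso_trans)
    fix x \<alpha> assume *: "x \<in> T" "\<alpha> \<in> Field \<omega>\<^sub>1" "clusters (fst ` X) (A \<alpha>) x" "clusters (fst ` X) (B \<alpha>) x"
    have sub: "fst ` h ` underS \<omega>\<^sub>1 \<alpha> \<subseteq> fst ` X"
      unfolding X_def by (intro image_mono) (auto simp: underS_def Field_def)
    have "infinite (snd (h \<alpha>) \<inter> A \<alpha> \<times> B \<alpha>)"
      using h(2)[OF *(2)] *(1) clusters_subset[OF *(3) sub] clusters_subset[OF *(4) sub] unfolding Q_def by simp
    then show "\<exists>\<pi>\<in>snd ` X. infinite (\<pi> \<inter> A \<alpha> \<times> B \<alpha>)" using *(2) unfolding X_def by blast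
  qed
qed

section \<open>The Higson corona of a finitary coarse structure on the naturals\<close>

lemma coarse_spaceD:
  assumes "coarse_space X \<E>"
  shows "E \<in> \<E> \<Longrightarrow> Id_on X \<subseteq> E" "E \<in> \<E> \<Longrightarrow> E \<subseteq> X \<times> X"
    "E \<in> \<E> \<Longrightarrow> F \<in> \<E> \<Longrightarrow> \<exists>G\<in>\<E>. E O F\<inverse> \<subseteq> G"
    "Id_on X \<subseteq> E \<Longrightarrow> E \<subseteq> F \<Longrightarrow> F \<in> \<E> \<Longrightarrow> E \<in> \<E>"
    "x \<in> X \<Longrightarrow> y \<in> X \<Longrightarrow> \<exists>E\<in>\<E>. (x, y) \<in> E"
proof -
  note * = assms[unfolded coarse_space_def]
  show "E \<in> \<E> \<Longrightarrow> Id_on X \<subseteq> E" "E \<in> \<E> \<Longrightarrow> E \<subseteq> X \<times> X" using *[THEN conjunct1] by simp_all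
  show "E \<in> \<E> \<Longrightarrow> F \<in> \<E> \<Longrightarrow> \<exists>G\<in>\<E>. E O F\<inverse> \<subseteq> G"
    by (rule *[THEN conjunct2, THEN conjunct2, THEN conjunct1, rule_format])
  show "Id_on X \<subseteq> E \<Longrightarrow> E \<subseteq> F \<Longrightarrow> F \<in> \<E> \<Longrightarrow> E \<in> \<E>"
    by (rule *[THEN conjunct2, THEN conjunct2, THEN conjunct2, rule_format])
  show "\<exists>E\<in>\<E>. (x, y) \<in> E" if "x \<in> X" "y \<in> X"
  proof -
    have "(x, y) \<in> \<Union>\<E>" using *[THEN conjunct2, THEN conjunct1] that by simp
    then show ?thesis by simp
  qed
qed

text \<open>The axioms only offer composites \<open>E O F\<inverse>\<close>; as entourages contain
  the diagonal, \<open>E\<inverse>\<close> sits inside \<open>E O E\<inverse>\<close>.\<close>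

lemma coarse_space_converse:
  assumes "coarse_space X \<E>" "E \<in> \<E>"
  shows "E\<inverse> \<in> \<E>"
proof -
  note sub = coarse_spaceD(1,2)[OF assms] and comp = coarse_spaceD(3)[OF assms(1)]
    and down = coarse_spaceD(4)[OF assms(1)]
  obtain G where G: "G \<in> \<E>" "E O E\<inverse> \<subseteq> G" using comp[OF assms(2,2)] by blast
  have "E\<inverse> \<subseteq> E O E\<inverse>"
  proof (rule subrelI)
    fix b a assume ba: "(b, a) \<in> E\<inverse>"
    then have "(b, b) \<in> E" using sub by blast
    then show "(b, a) \<in> E O E\<inverse>" using ba by (rule relcompI)
  qed
  then show ?thesis using G sub(1) by (intro down[of "E\<inverse>" G]) (auto simp: Id_on_def)
qed

lemma coarse_space_Un:
  assumes "coarse_space X \<E>" "E \<in> \<E>" "F \<in> \<E>"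
  shows "E \<union> F \<in> \<E>"
proof -
  note sub = coarse_spaceD(1,2)[OF assms(1,2)] coarse_spaceD(1,2)[OF assms(1,3)]
    and comp = coarse_spaceD(3)[OF assms(1)] and down = coarse_spaceD(4)[OF assms(1)]
  obtain G where G: "G \<in> \<E>" "E O (F\<inverse>)\<inverse> \<subseteq> G"
    using comp[OF assms(2) coarse_space_converse[OF assms(1,3)]] by blast
  have "E \<subseteq> E O F" "F \<subseteq> E O F"
  proof -
    show "E \<subseteq> E O F"
    proof (rule subrelI)
      fix a b assume ab: "(a, b) \<in> E"
      then have "(b, b) \<in> F" using sub by blast
      with ab show "(a, b) \<in> E O F" by (rule relcompI)
    qed
    show "F \<subseteq> E O F"
    proof (rule subrelI)
      fix a b assume ab: "(a, b) \<in> F"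
      then have "(a, a) \<in> E" using sub by blast
      then show "(a, b) \<in> E O F" using ab by (rule relcompI)
    qed
  qed
  then show ?thesis using G sub(1) by (intro down[of "E \<union> F" G]) auto
qed

lemma coarse_bounded_iff_finite:
  fixes \<E> :: "('b \<times> 'b) set set"
  assumes "coarse_space UNIV \<E>" "finitary UNIV \<E>"
  shows "coarse_bounded UNIV \<E> B \<longleftrightarrow> finite B"
proof
  show "finite B" if "coarse_bounded UNIV \<E> B"
    using finitary_bounded_finite[OF assms(2) that] .
next
  have cov: "\<exists>E\<in>\<E>. (x, y) \<in> E" for x y
    using coarse_spaceD(5)[OF assms(1)] by simp
  fix x0 :: 'b
  assume "finite B"
  then have "\<exists>E\<in>\<E>. B \<subseteq> E `` {x0}"
  proof (induction B rule: finite_induct)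
    case empty then show ?case using cov[of x0 x0] by blast
  next
    case (insert y B)
    then obtain E where E: "E \<in> \<E>" "B \<subseteq> E `` {x0}" by blast
    obtain F where F: "F \<in> \<E>" "(x0, y) \<in> F" using cov by blast
    show ?case using coarse_space_Un[OF assms(1) E(1) F(1)] E F by (intro bexI[of _ "E \<union> F"]) auto
  qed
  then show "coarse_bounded UNIV \<E> B" unfolding coarse_bounded_def by blast
qed

lemma finitary_Image_finite: "finitary UNIV \<E> \<Longrightarrow> E \<in> \<E> \<Longrightarrow> finite A \<Longrightarrow> finite (E `` A)"
proof -
  assume *: "finitary UNIV \<E>" "E \<in> \<E>" "finite A"
  then have "uniformly_finite E" unfolding finitary_def uniformly_finite_def by simp
  then show ?thesis using *(3) by (rule uniformly_finite_finite_Image)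
qed

lemma so_eq:
  fixes \<E> :: "(nat \<times> nat) set set"
  assumes E: "coarse_space UNIV \<E>" "finitary UNIV \<E>"
  shows "so UNIV \<E> = {\<phi>. bounded (range \<phi>) \<and> (\<forall>E\<in>\<E>. slow_on \<phi> E)}"
proof -
  have Id: "(x, x) \<in> E" if "E \<in> \<E>" for x E using coarse_spaceD(1)[OF E(1) that] by blast
  have "slowly_oscillating UNIV \<E> \<phi> \<longleftrightarrow> (\<forall>E\<in>\<E>. slow_on \<phi> E)" for \<phi>
  proof
    assume so: "slowly_oscillating UNIV \<E> \<phi>"
    show "\<forall>E\<in>\<E>. slow_on \<phi> E"
      unfolding slow_on_def
    proof (intro ballI allI impI)
      fix E and \<epsilon> :: real assume "E \<in> \<E>" "0 < \<epsilon>"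
      then obtain B where B: "coarse_bounded UNIV \<E> B"
        "\<And>x. x \<notin> B \<Longrightarrow> bounded (\<phi> ` (E `` {x})) \<and> diameter (\<phi> ` (E `` {x})) < \<epsilon>"
        using so unfolding slowly_oscillating_def by (metis DiffI UNIV_I)
      have "finite B" using B(1) coarse_bounded_iff_finite[OF E] by blast
      have "{p \<in> E. \<epsilon> \<le> \<bar>\<phi> (fst p) - \<phi> (snd p)\<bar>} \<subseteq> B \<times> E `` B"
      proof
        fix p assume p: "p \<in> {p \<in> E. \<epsilon> \<le> \<bar>\<phi> (fst p) - \<phi> (snd p)\<bar>}"
        have "fst p \<in> B"
        proof (rule ccontr)
          assume "fst p \<notin> B"
          then have b: "bounded (\<phi> ` (E `` {fst p}))" "diameter (\<phi> ` (E `` {fst p})) < \<epsilon>" using B(2) by auto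
          have "(fst p, snd p) \<in> E" using p by simp
          then have "dist (\<phi> (fst p)) (\<phi> (snd p)) \<le> diameter (\<phi> ` (E `` {fst p}))"
            using Id[OF \<open>E \<in> \<E>\<close>] by (intro diameter_bounded_bound[OF b(1)]) auto
          then show False using b(2) p by (simp add: dist_real_def)
        qed
        then show "p \<in> B \<times> E `` B" using p by (cases p) auto
      qed
      moreover have "finite (E `` B)" by (rule finitary_Image_finite[OF E(2) \<open>E \<in> \<E>\<close> \<open>finite B\<close>])
      ultimately show "finite {p \<in> E. \<epsilon> \<le> \<bar>\<phi> (fst p) - \<phi> (snd p)\<bar>}"
        using \<open>finite B\<close> by (meson finite_SigmaI finite_subset)
    qed
  next
    assume slow: "\<forall>E\<in>\<E>. slow_on \<phi> E"
    show "slowly_oscillating UNIV \<E> \<phi>"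
      unfolding slowly_oscillating_def
    proof (intro ballI allI impI)
      fix E and \<epsilon> :: real assume "E \<in> \<E>" "0 < \<epsilon>"
      \<comment> \<open>Off \<open>B\<close> the values on a section of \<open>E\<close> are all
        within \<epsilon>/4 of the value at its centre, so the diameter is at most \<epsilon>/2,
        which leaves room for the strict bound.\<close>
      define B where "B = fst ` {p \<in> E. \<epsilon> / 4 \<le> \<bar>\<phi> (fst p) - \<phi> (snd p)\<bar>}"
      have "0 < \<epsilon> / 4" using \<open>0 < \<epsilon>\<close> by simp
      then have "finite {p \<in> E. \<epsilon> / 4 \<le> \<bar>\<phi> (fst p) - \<phi> (snd p)\<bar>}"
        using slow \<open>E \<in> \<E>\<close> unfolding slow_on_def by blast
      then have "finite B" unfolding B_def by (rule finite_imageI)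
      moreover have "bounded (\<phi> ` (E `` {x})) \<and> diameter (\<phi> ` (E `` {x})) < \<epsilon>" if "x \<notin> B" for x
      proof
        have "finite (E `` {x})" by (rule finitary_Image_finite[OF E(2) \<open>E \<in> \<E>\<close>]) simp
        then show "bounded (\<phi> ` (E `` {x}))" by (intro finite_imp_bounded) simp
        have close: "\<bar>\<phi> x - \<phi> y\<bar> < \<epsilon> / 4" if "y \<in> E `` {x}" for y
        proof (rule ccontr)
          assume "\<not> ?thesis"
          then have "(x, y) \<in> {p \<in> E. \<epsilon> / 4 \<le> \<bar>\<phi> (fst p) - \<phi> (snd p)\<bar>}" using that by auto
          then show False using \<open>x \<notin> B\<close> unfolding B_def by force
        qed
        have "diameter (\<phi> ` (E `` {x})) \<le> \<epsilon> / 2"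
        proof (rule diameter_le)
          show "\<phi> ` (E `` {x}) \<noteq> {} \<or> 0 \<le> \<epsilon> / 2" using \<open>0 < \<epsilon>\<close> by simp
          fix a b assume "a \<in> \<phi> ` (E `` {x})" "b \<in> \<phi> ` (E `` {x})"
          then obtain y z where yz: "y \<in> E `` {x}" "z \<in> E `` {x}" "a = \<phi> y" "b = \<phi> z" by blast
          show "norm (a - b) \<le> \<epsilon> / 2" using close[OF yz(1)] close[OF yz(2)] unfolding yz(3,4) real_norm_def by linarith
        qed
        then show "diameter (\<phi> ` (E `` {x})) < \<epsilon>" using \<open>0 < \<epsilon>\<close> by linarith
      qed
      ultimately show "\<exists>B. coarse_bounded UNIV \<E> B \<and>
          (\<forall>x\<in>UNIV - B. bounded (\<phi> ` (E `` {x})) \<and> diameter (\<phi> ` (E `` {x})) < \<epsilon>)"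
        using coarse_bounded_iff_finite[OF E] by blast
    qed
  qed
  then show ?thesis unfolding so_def by auto
qed

section \<open>The corona as a set of limit points in a product of lines\<close>

lemma openin_powertop_real:
  assumes "openin (powertop_real I) U" "p \<in> U"
  obtains \<Phi> \<epsilon> where "\<Phi> \<subseteq> I" "finite \<Phi>" "\<epsilon> > 0"
    "\<And>q. q \<in> (\<Pi>\<^sub>E i\<in>I. UNIV) \<Longrightarrow> (\<And>i. i \<in> \<Phi> \<Longrightarrow> \<bar>q i - p i\<bar> < \<epsilon>) \<Longrightarrow> q \<in> U"
proof -
  obtain W where W: "finite {i \<in> I. W i \<noteq> (UNIV :: real set)}" "\<forall>i\<in>I. open (W i)" "p \<in> Pi\<^sub>E I W" "Pi\<^sub>E I W \<subseteq> U"
    using assms unfolding openin_product_topology_alt by (auto simp: topspace_euclidean)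
  define \<Phi> where "\<Phi> = {i \<in> I. W i \<noteq> UNIV}"
  have fin: "finite \<Phi>" unfolding \<Phi>_def by (rule W(1))
  have "\<forall>i\<in>\<Phi>. \<exists>e>0. \<forall>t. \<bar>t - p i\<bar> < e \<longrightarrow> t \<in> W i"
  proof
    fix i assume "i \<in> \<Phi>"
    then have "open (W i)" "p i \<in> W i" using W unfolding \<Phi>_def by auto
    then show "\<exists>e>0. \<forall>t. \<bar>t - p i\<bar> < e \<longrightarrow> t \<in> W i" unfolding open_dist dist_real_def by blast
  qed
  then obtain e where e: "\<And>i. i \<in> \<Phi> \<Longrightarrow> e i > 0" "\<And>i t. i \<in> \<Phi> \<Longrightarrow> \<bar>t - p i\<bar> < e i \<Longrightarrow> t \<in> W i" by metis
  define \<epsilon> where "\<epsilon> = Min (insert 1 (e ` \<Phi>))"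
  have \<epsilon>: "\<epsilon> > 0" "\<And>i. i \<in> \<Phi> \<Longrightarrow> \<epsilon> \<le> e i" unfolding \<epsilon>_def using fin e(1) by auto
  show thesis
  proof (rule that[of \<Phi> \<epsilon>])
    show "\<Phi> \<subseteq> I" unfolding \<Phi>_def by auto
    fix q assume q: "q \<in> (\<Pi>\<^sub>E i\<in>I. UNIV)" "\<And>i. i \<in> \<Phi> \<Longrightarrow> \<bar>q i - p i\<bar> < \<epsilon>"
    have "q i \<in> W i" if "i \<in> I" for i
    proof (cases "i \<in> \<Phi>")
      case True
      then have "\<bar>q i - p i\<bar> < e i" using q(2)[OF True] \<epsilon>(2)[OF True] by linarith
      then show ?thesis by (rule e(2)[OF True])
    next
      case False then show ?thesis using that unfolding \<Phi>_def by simp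
    qed
    then have "q \<in> Pi\<^sub>E I W" using q(1) by (auto simp: PiE_iff)
    then show "q \<in> U" using W(4) by blast
  qed (use fin \<epsilon>(1) in auto)
qed

lemma openin_powertop_real_box:
  assumes "finite \<Phi>" "\<Phi> \<subseteq> I"
  shows "openin (powertop_real I) {q \<in> (\<Pi>\<^sub>E i\<in>I. UNIV). \<forall>i\<in>\<Phi>. \<bar>q i - p i\<bar> < \<epsilon>}"
proof -
  have "openin (powertop_real I) {q \<in> topspace (powertop_real I). q i \<in> {t. \<bar>t - p i\<bar> < \<epsilon>}}" if "i \<in> \<Phi>" for i
  proof (rule openin_continuous_map_preimage)
    show "continuous_map (powertop_real I) euclideanreal (\<lambda>q. q i)"
      using that assms(2) by (intro continuous_map_product_projection) auto
    have "{t. \<bar>t - p i\<bar> < \<epsilon>} = ball (p i) \<epsilon>" by (auto simp: dist_real_def)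
    then show "openin euclideanreal {t. \<bar>t - p i\<bar> < \<epsilon>}" by simp
  qed
  then have "openin (powertop_real I) (\<Inter>(insert (topspace (powertop_real I)) ((\<lambda>i. {q \<in> topspace (powertop_real I). q i \<in> {t. \<bar>t - p i\<bar> < \<epsilon>}}) ` \<Phi>)))"
    using assms(1) openin_topspace[of "powertop_real I"] by (intro openin_Inter) auto
  moreover have "\<Inter>(insert (topspace (powertop_real I)) ((\<lambda>i. {q \<in> topspace (powertop_real I). q i \<in> {t. \<bar>t - p i\<bar> < \<epsilon>}}) ` \<Phi>)) =
      {q \<in> (\<Pi>\<^sub>E i\<in>I. UNIV). \<forall>i\<in>\<Phi>. \<bar>q i - p i\<bar> < \<epsilon>}" by auto
  ultimately show ?thesis by simp
qed

text \<open>Bounded sets are finite and finite sets are closed in the product, so removing the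
  closures of bounded sets removes exactly the naturals. What remains of the closure are the limit
  points of the embedded naturals.\<close>

lemma higson_corona_points:
  fixes \<E> :: "(nat \<times> nat) set set"
  assumes E: "coarse_space UNIV \<E>" "finitary UNIV \<E>"
  defines "P \<equiv> {p \<in> (\<Pi>\<^sub>E i\<in>so UNIV \<E>. UNIV). \<forall>\<Phi>\<subseteq>so UNIV \<E>. finite \<Phi> \<longrightarrow>
      (\<forall>\<epsilon>>0. \<exists>\<^sub>F n in sequentially. \<forall>\<phi>\<in>\<Phi>. \<bar>\<phi> n - p \<phi>\<bar> < \<epsilon>)}"
  shows "higson_corona UNIV \<E> = subtopology (powertop_real (so UNIV \<E>)) P"
proof -
  define I where "I = so UNIV \<E>"
  define X where "X = powertop_real I"
  define em where "em = higson_embed UNIV \<E>"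
  have emI: "em n \<phi> = \<phi> n" if "\<phi> \<in> I" for n \<phi> using that unfolding em_def higson_embed_def I_def by simp
  have emX: "em n \<in> topspace X" for n unfolding em_def higson_embed_def X_def I_def by simp
  have tX: "topspace X = (\<Pi>\<^sub>E i\<in>I. UNIV)" unfolding X_def by simp
  have "Hausdorff_space X" unfolding X_def by (simp add: Hausdorff_space_product_topology)
  then have fcl: "closedin X F" if "finite F" "F \<subseteq> topspace X" for F
    using that by (simp add: closedin_Hausdorff_finite)
  define C where "C = X closure_of range em"
  have rC: "range em \<subseteq> C" unfolding C_def using emX by (intro closure_of_subset) auto
  have hc: "higson_compactification UNIV \<E> = subtopology X C"
    unfolding higson_compactification_def so_power_def X_def C_def em_def I_def by simp
  have CX: "C \<subseteq> topspace X" unfolding C_def by (rule closure_of_subset_topspace)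
  have clB: "higson_compactification UNIV \<E> closure_of (em ` B) = em ` B" if "finite B" for B
  proof -
    have "closedin X (em ` B)" using that emX by (intro fcl) auto
    moreover have "C \<inter> em ` B = em ` B" using rC by auto
    ultimately have "X closure_of (C \<inter> em ` B) = em ` B" by (simp add: closure_of_eq)
    then show ?thesis unfolding hc closure_of_subtopology using rC by auto
  qed
  have "\<Union> {higson_compactification UNIV \<E> closure_of (em ` B) |B. coarse_bounded UNIV \<E> B} = range em"
  proof -
    have "{higson_compactification UNIV \<E> closure_of (em ` B) |B. coarse_bounded UNIV \<E> B} = (\<lambda>B. em ` B) ` {B. finite B}"
      using clB coarse_bounded_iff_finite[OF E] by auto
    moreover have "\<Union> ((\<lambda>B. em ` B) ` {B. finite B}) = range em"
    proof
      show "range em \<subseteq> \<Union> ((\<lambda>B. em ` B) ` {B. finite B})"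
      proof
        fix y assume "y \<in> range em"
        then obtain n where "y \<in> em ` {n}" by auto
        then show "y \<in> \<Union> ((\<lambda>B. em ` B) ` {B. finite B})" by blast
      qed
    qed auto
    ultimately show ?thesis by simp
  qed
  then have "higson_corona UNIV \<E> = subtopology (subtopology X C) (C - range em)"
    unfolding higson_corona_def em_def[symmetric] unfolding hc using CX by (simp add: Int_absorb1)
  also have "\<dots> = subtopology X (C - range em)"
    by (simp add: subtopology_subtopology Int_absorb1)
  also have "C - range em = P"
  proof (intro set_eqI iffI)
    fix p assume p: "p \<in> C - range em"
    show "p \<in> P"
      unfolding P_def I_def[symmetric]
    proof (intro CollectI conjI allI impI)
      show "p \<in> (\<Pi>\<^sub>E i\<in>I. UNIV)" using p CX tX by auto
      fix \<Phi> and \<epsilon> :: real assume \<Phi>: "\<Phi> \<subseteq> I" "finite \<Phi>" "0 < \<epsilon>"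
      show "\<exists>\<^sub>F n in sequentially. \<forall>\<phi>\<in>\<Phi>. \<bar>\<phi> n - p \<phi>\<bar> < \<epsilon>"
        unfolding frequently_sequentially
      proof
        fix N
        define U where "U = {q \<in> (\<Pi>\<^sub>E i\<in>I. UNIV). \<forall>i\<in>\<Phi>. \<bar>q i - p i\<bar> < \<epsilon>} - em ` {..<N}"
        have "closedin X (em ` {..<N})" by (rule fcl) (use emX in auto)
        then have "openin X U"
          unfolding U_def X_def by (intro openin_diff openin_powertop_real_box[OF \<Phi>(2,1)])
        moreover have "p \<in> U" unfolding U_def using p CX tX \<Phi>(3) by auto
        moreover have "p \<in> X closure_of range em" using p unfolding C_def by blast
        ultimately obtain y where "y \<in> range em" "y \<in> U" unfolding in_closure_of by blast
        then obtain n where n: "em n \<in> U" by auto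
        then have "n \<ge> N" unfolding U_def by (meson DiffD2 imageI lessThan_iff not_le)
        moreover have "\<bar>\<phi> n - p \<phi>\<bar> < \<epsilon>" if "\<phi> \<in> \<Phi>" for \<phi>
        proof -
          have "\<bar>em n \<phi> - p \<phi>\<bar> < \<epsilon>" using n that unfolding U_def by blast
          then show ?thesis using emI[of \<phi> n] that \<Phi>(1) by auto
        qed
        ultimately show "\<exists>n\<ge>N. \<forall>\<phi>\<in>\<Phi>. \<bar>\<phi> n - p \<phi>\<bar> < \<epsilon>" by blast
      qed
    qed
  next
    fix p assume "p \<in> P"
    then have pX: "p \<in> topspace X"
      and pP: "\<And>\<Phi> \<epsilon>. \<Phi> \<subseteq> I \<Longrightarrow> finite \<Phi> \<Longrightarrow> \<epsilon> > 0 \<Longrightarrow> \<exists>\<^sub>F n in sequentially. \<forall>\<phi>\<in>\<Phi>. \<bar>\<phi> n - p \<phi>\<bar> < \<epsilon>"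
      unfolding P_def I_def[symmetric] tX by auto
    have "p \<in> C"
      unfolding C_def in_closure_of
    proof (intro conjI allI impI)
      show "p \<in> topspace X" by (rule pX)
      fix U assume U: "p \<in> U \<and> openin X U"
      then obtain \<Phi> \<epsilon> where \<Phi>: "\<Phi> \<subseteq> I" "finite \<Phi>" "\<epsilon> > 0"
        "\<And>q. q \<in> (\<Pi>\<^sub>E i\<in>I. UNIV) \<Longrightarrow> (\<And>i. i \<in> \<Phi> \<Longrightarrow> \<bar>q i - p i\<bar> < \<epsilon>) \<Longrightarrow> q \<in> U"
        unfolding X_def using openin_powertop_real[of I U p] by metis
      obtain n where n: "\<forall>\<phi>\<in>\<Phi>. \<bar>\<phi> n - p \<phi>\<bar> < \<epsilon>"
        using pP[OF \<Phi>(1-3)] frequently_ex by blast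
      have "em n \<in> U"
      proof (rule \<Phi>(4))
        show "em n \<in> (\<Pi>\<^sub>E i\<in>I. UNIV)" using emX tX by auto
        show "\<bar>em n i - p i\<bar> < \<epsilon>" if "i \<in> \<Phi>" for i using n emI \<Phi>(1) that by auto
      qed
      then show "\<exists>y. y \<in> range em \<and> y \<in> U" by blast
    qed
    moreover have "p \<noteq> em n" for n
    proof
      assume pn: "p = em n"
      \<comment> \<open>The indicator of \<open>n\<close> oscillates slowly because entourages have
        finite sections in both directions. It separates \<open>em n\<close> from all other embedded
        points, so \<open>em n\<close> is no limit point.\<close>
      define d :: "nat \<Rightarrow> real" where "d m = (if m = n then 1 else 0)" for m
      have "slow_on d E" if EE: "E \<in> \<E>" for E
        unfolding slow_on_def
      proof (intro allI impI)
        fix \<epsilon> :: real assume "0 < \<epsilon>"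
        have "{p \<in> E. \<epsilon> \<le> \<bar>d (fst p) - d (snd p)\<bar>} \<subseteq> {n} \<times> E `` {n} \<union> E\<inverse> `` {n} \<times> {n}"
          using \<open>0 < \<epsilon>\<close> by (auto simp: d_def split: if_splits)
        moreover have "finite (E `` {n})" "finite (E\<inverse> `` {n})"
          using finitary_Image_finite[OF E(2)] EE coarse_space_converse[OF E(1)] by auto
        ultimately show "finite {p \<in> E. \<epsilon> \<le> \<bar>d (fst p) - d (snd p)\<bar>}"
          by (meson finite.emptyI finite_SigmaI finite_UnI finite_insert finite_subset)
      qed
      moreover have "bounded (range d)"
        by (rule bounded_subset[of "{0, 1}"]) (auto simp: d_def)
      ultimately have dI: "d \<in> I" unfolding I_def so_eq[OF E] by simp
      obtain m where m: "m \<ge> Suc n" "\<forall>\<phi>\<in>{d}. \<bar>\<phi> m - p \<phi>\<bar> < 1/2"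
        using pP[of "{d}" "1/2"] dI unfolding frequently_sequentially by auto
      then show False unfolding pn using emI[OF dI] by (simp add: d_def split: if_splits)
    qed
    ultimately show "p \<in> C - range em" by blast
  qed
  finally show ?thesis unfolding X_def I_def .
qed

section \<open>Limits along a coding and the homeomorphism with the corona\<close>

lemma not_clustersE:
  assumes "\<not> clusters G A x"
  obtains S \<delta> where "S \<subseteq> G" "finite S" "\<delta> > 0"
    "\<forall>\<^sub>F n in sequentially. (\<forall>g\<in>S. dev g n x < \<delta>) \<longrightarrow> n \<notin> A"
proof -
  obtain S \<delta> where S: "S \<subseteq> G" "finite S" "\<delta> > 0"
    and n: "\<not> (\<exists>\<^sub>F n in sequentially. n \<in> A \<and> (\<forall>g\<in>S. dev g n x < \<delta>))"
    using assms unfolding clusters_def by blast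
  from n have "\<forall>\<^sub>F n in sequentially. (\<forall>g\<in>S. dev g n x < \<delta>) \<longrightarrow> n \<notin> A"
    unfolding not_frequently by (rule eventually_mono) blast
  with S show thesis by (rule that)
qed

text \<open>The limit of \<phi> at \<open>x\<close>, taken over the traces on the naturals of the
  neighbourhoods of \<open>x\<close> that the coding defines.\<close>

definition limit_along :: "'a coding \<Rightarrow> 'a \<Rightarrow> (nat \<Rightarrow> real) \<Rightarrow> real \<Rightarrow> bool" where
  "limit_along G x \<phi> l \<longleftrightarrow> (\<forall>\<epsilon>>0. \<exists>S\<subseteq>G. finite S \<and> (\<exists>\<delta>>0. \<forall>\<^sub>F n in sequentially.
     (\<forall>g\<in>S. dev g n x < \<delta>) \<longrightarrow> \<bar>\<phi> n - l\<bar> < \<epsilon>))"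

text \<open>The limit is the supremum of the levels \<open>a\<close> such that the set where \<phi>
  is at least \<open>a\<close> clusters at \<open>x\<close>. If values far below it recurred near
  \<open>x\<close>, a sublevel set and a superlevel set with a gap between them would both cluster
  at \<open>x\<close>, which \<open>sep\<close> excludes.\<close>

lemma limit_along_ex:
  assumes cl: "clusters G UNIV x" and bdd: "bounded (range \<phi>)"
    and sep: "\<And>a b. a < b \<Longrightarrow> clusters G {n. \<phi> n \<le> a} x \<Longrightarrow> clusters G {n. b \<le> \<phi> n} x \<Longrightarrow> False"
  shows "\<exists>l. limit_along G x \<phi> l"
proof -
  obtain c where c: "\<And>n. \<bar>\<phi> n\<bar> \<le> c" using bdd unfolding bounded_iff by auto
  define L where "L = {a. clusters G {n. a \<le> \<phi> n} x}"
  have ne: "- c \<in> L"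
  proof -
    have "{n. - c \<le> \<phi> n} = UNIV" using c by (auto simp: abs_le_iff minus_le_iff)
    then show ?thesis unfolding L_def using cl by simp
  qed
  have ub: "a \<le> c" if "a \<in> L" for a
  proof (rule ccontr)
    assume "\<not> a \<le> c"
    then have "{n. a \<le> \<phi> n} = {}" using c by (auto simp: not_le) (meson abs_le_D1 not_le order_trans)
    then have "clusters G {} x" using that unfolding L_def by simp
    then show False unfolding clusters_def by (auto dest!: spec[of _ "{}"] spec[of _ 1])
  qed
  have bddL: "bdd_above L" by (rule bdd_aboveI) (rule ub)
  define l where "l = Sup L"
  have "limit_along G x \<phi> l"
    unfolding limit_along_def
  proof (intro allI impI)
    fix \<epsilon> :: real assume \<epsilon>: "0 < \<epsilon>"
    have n1: "\<not> clusters G {n. l + \<epsilon> \<le> \<phi> n} x"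
    proof
      assume "clusters G {n. l + \<epsilon> \<le> \<phi> n} x"
      then have "l + \<epsilon> \<le> l" unfolding l_def using bddL by (intro cSup_upper) (auto simp: L_def)
      then show False using \<epsilon> by simp
    qed
    have n2: "\<not> clusters G {n. \<phi> n \<le> l - \<epsilon>} x"
    proof
      assume *: "clusters G {n. \<phi> n \<le> l - \<epsilon>} x"
      obtain a where "a \<in> L" "l - \<epsilon> < a"
        using less_cSupD[of L "l - \<epsilon>"] ne \<epsilon> unfolding l_def by auto
      then show False using sep[OF _ *] unfolding L_def by blast
    qed
    obtain S1 \<delta>1 where 1: "S1 \<subseteq> G" "finite S1" "\<delta>1 > 0"
      "\<forall>\<^sub>F n in sequentially. (\<forall>g\<in>S1. dev g n x < \<delta>1) \<longrightarrow> n \<notin> {n. l + \<epsilon> \<le> \<phi> n}"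
      by (rule not_clustersE[OF n1])
    obtain S2 \<delta>2 where 2: "S2 \<subseteq> G" "finite S2" "\<delta>2 > 0"
      "\<forall>\<^sub>F n in sequentially. (\<forall>g\<in>S2. dev g n x < \<delta>2) \<longrightarrow> n \<notin> {n. \<phi> n \<le> l - \<epsilon>}"
      by (rule not_clustersE[OF n2])
    have "\<forall>\<^sub>F n in sequentially. (\<forall>g\<in>S1 \<union> S2. dev g n x < min \<delta>1 \<delta>2) \<longrightarrow> \<bar>\<phi> n - l\<bar> < \<epsilon>"
      using 1(4) 2(4)
    proof eventually_elim
      case (elim n)
      show ?case
      proof
        assume "\<forall>g\<in>S1 \<union> S2. dev g n x < min \<delta>1 \<delta>2"
        then have "\<phi> n < l + \<epsilon>" "l - \<epsilon> < \<phi> n" using elim by auto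
        then show "\<bar>\<phi> n - l\<bar> < \<epsilon>" by linarith
      qed
    qed
    then show "\<exists>S\<subseteq>G. finite S \<and> (\<exists>\<delta>>0. \<forall>\<^sub>F n in sequentially. (\<forall>g\<in>S. dev g n x < \<delta>) \<longrightarrow> \<bar>\<phi> n - l\<bar> < \<epsilon>)"
      using 1(1-3) 2(1-3) by (intro exI[of _ "S1 \<union> S2"] conjI exI[of _ "min \<delta>1 \<delta>2"]) auto
  qed
  then show ?thesis ..
qed

lemma limit_along_finite:
  assumes "finite \<Phi>" "\<And>\<phi>. \<phi> \<in> \<Phi> \<Longrightarrow> limit_along G x \<phi> (l \<phi>)" and \<epsilon>: "\<epsilon> > 0"
  obtains S \<delta> where "S \<subseteq> G" "finite S" "\<delta> > 0"
    "\<forall>\<^sub>F n in sequentially. (\<forall>g\<in>S. dev g n x < \<delta>) \<longrightarrow> (\<forall>\<phi>\<in>\<Phi>. \<bar>\<phi> n - l \<phi>\<bar> < \<epsilon>)"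
proof -
  have "\<exists>S\<subseteq>G. finite S \<and> (\<exists>\<delta>>0. \<forall>\<^sub>F n in sequentially. (\<forall>g\<in>S. dev g n x < \<delta>) \<longrightarrow> (\<forall>\<phi>\<in>\<Phi>. \<bar>\<phi> n - l \<phi>\<bar> < \<epsilon>))"
    using assms(1,2)
  proof (induction \<Phi> rule: finite_induct)
    case empty
    show ?case by (intro exI[of _ "{}"]) (auto intro: exI[of _ 1])
  next
    case (insert \<psi> \<Phi>)
    obtain S1 \<delta>1 where 1: "S1 \<subseteq> G" "finite S1" "\<delta>1 > 0"
      "\<forall>\<^sub>F n in sequentially. (\<forall>g\<in>S1. dev g n x < \<delta>1) \<longrightarrow> (\<forall>\<phi>\<in>\<Phi>. \<bar>\<phi> n - l \<phi>\<bar> < \<epsilon>)"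
      using insert by blast
    obtain S2 \<delta>2 where 2: "S2 \<subseteq> G" "finite S2" "\<delta>2 > 0"
      "\<forall>\<^sub>F n in sequentially. (\<forall>g\<in>S2. dev g n x < \<delta>2) \<longrightarrow> \<bar>\<psi> n - l \<psi>\<bar> < \<epsilon>"
      using insert.prems[of \<psi>] \<epsilon> unfolding limit_along_def by blast
    have "\<forall>\<^sub>F n in sequentially. (\<forall>g\<in>S1 \<union> S2. dev g n x < min \<delta>1 \<delta>2) \<longrightarrow> (\<forall>\<phi>\<in>insert \<psi> \<Phi>. \<bar>\<phi> n - l \<phi>\<bar> < \<epsilon>)"
      using 1(4) 2(4) by eventually_elim auto
    then show ?case
      using 1(1-3) 2(1-3) by (intro exI[of _ "S1 \<union> S2"] conjI exI[of _ "min \<delta>1 \<delta>2"]) auto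
  qed
  then show thesis using that by blast
qed

lemma approx_in_bounded:
  assumes G: "approx_in (topspace K) G" and K: "compact_space K"
    and g: "g \<in> G" and cont: "continuous_map K euclideanreal (fst g)"
  shows "bounded (range (snd g))"
proof -
  have "compactin euclideanreal (fst g ` topspace K)"
    using K cont unfolding compact_space_def by (rule image_compactin)
  then have "bounded (fst g ` topspace K)" by (simp add: compact_imp_bounded)
  then obtain c where c: "\<And>x. x \<in> topspace K \<Longrightarrow> \<bar>fst g x\<bar> \<le> c" unfolding bounded_iff by auto
  have "\<forall>\<^sub>F n in sequentially. \<exists>x\<in>topspace K. \<forall>h\<in>{g}. dev h n x < 1"
    using g by (intro approx_inD[OF G]) auto
  then obtain N where N: "\<And>n. n \<ge> N \<Longrightarrow> \<exists>x\<in>topspace K. dev g n x < 1"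
    unfolding eventually_sequentially by auto
  have "range (snd g) \<subseteq> snd g ` {..<N} \<union> {- (c + 1)..c + 1}"
  proof
    fix y assume "y \<in> range (snd g)"
    then obtain n where n: "y = snd g n" by auto
    show "y \<in> snd g ` {..<N} \<union> {- (c + 1)..c + 1}"
    proof (cases "n < N")
      case False
      then obtain x where "x \<in> topspace K" "dev g n x < 1" using N[of n] by auto
      then have "\<bar>y\<bar> \<le> c + 1" using c[of x] n by linarith
      then show ?thesis by auto
    qed (use n in auto)
  qed
  then show ?thesis by (rule bounded_subset[rotated]) (auto intro: finite_imp_bounded)
qed

text \<open>A point \<open>x\<close> is sent to the limits at \<open>x\<close> of all bounded slowly
  oscillating functions. The coded sequences are among these and have limits \<open>fst g x\<close>,
  which gives injectivity. For a corona point \<open>p\<close>, compactness finds \<open>x\<close>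
  with the same coded coordinates; these already force every other coordinate of \<open>p\<close> to
  be the limit at \<open>x\<close>.\<close>

lemma higson_corona_homeomorphic:
  fixes K :: "'a topology" and \<E> :: "(nat \<times> nat) set set"
  assumes K: "compact_space K"
    and cont: "\<And>g. g \<in> G \<Longrightarrow> continuous_map K euclideanreal (fst g)"
    and sep: "\<And>x y. x \<in> topspace K \<Longrightarrow> y \<in> topspace K \<Longrightarrow> (\<And>g. g \<in> G \<Longrightarrow> fst g x = fst g y) \<Longrightarrow> x = y"
    and G: "approx_in (topspace K) G" "approx_onto (topspace K) G"
    and E: "coarse_space UNIV \<E>" "finitary UNIV \<E>"
    and slow: "\<And>g E. g \<in> G \<Longrightarrow> E \<in> \<E> \<Longrightarrow> slow_on (snd g) E"
    and link: "\<And>A B x. x \<in> topspace K \<Longrightarrow> clusters G A x \<Longrightarrow> clusters G B x \<Longrightarrow> \<exists>E\<in>\<E>. infinite (E \<inter> A \<times> B)"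
  shows "K homeomorphic_space higson_corona UNIV \<E>"
proof -
  define I where "I = so UNIV \<E>"
  have I: "I = {\<phi>. bounded (range \<phi>) \<and> (\<forall>E\<in>\<E>. slow_on \<phi> E)}" unfolding I_def by (rule so_eq[OF E])
  define P where "P = {p \<in> (\<Pi>\<^sub>E i\<in>I. UNIV). \<forall>\<Phi>\<subseteq>I. finite \<Phi> \<longrightarrow>
      (\<forall>\<epsilon>>0. \<exists>\<^sub>F n in sequentially. \<forall>\<phi>\<in>\<Phi>. \<bar>\<phi> n - p \<phi>\<bar> < \<epsilon>)}"
  define Y where "Y = subtopology (powertop_real I) P"
  have Y: "higson_corona UNIV \<E> = Y"
    unfolding Y_def P_def I_def by (rule higson_corona_points[OF E])
  have tY: "topspace Y = P" unfolding Y_def P_def by auto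
  have cl: "clusters G UNIV x" if "x \<in> topspace K" for x using G(2) that unfolding approx_onto_def by blast
  have GI: "snd g \<in> I" if "g \<in> G" for g
    unfolding I using slow that approx_in_bounded[OF G(1) K that cont[OF that]] by blast
  \<comment> \<open>Two clustering level sets with a gap would be linked by infinitely many pairs of
    one entourage, and \<phi> jumps by at least \<open>b - a\<close> along each of them.\<close>
  have "\<exists>l. limit_along G x \<phi> l" if x: "x \<in> topspace K" and \<phi>: "\<phi> \<in> I" for x \<phi>
  proof (rule limit_along_ex[OF cl[OF x]])
    show "bounded (range \<phi>)" using \<phi> unfolding I by blast
    fix a b :: real assume ab: "a < b" "clusters G {n. \<phi> n \<le> a} x" "clusters G {n. b \<le> \<phi> n} x"
    obtain E where E': "E \<in> \<E>" "infinite (E \<inter> {n. \<phi> n \<le> a} \<times> {n. b \<le> \<phi> n})" using link[OF x ab(2,3)] by blast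
    have "E \<inter> {n. \<phi> n \<le> a} \<times> {n. b \<le> \<phi> n} \<subseteq> {p \<in> E. b - a \<le> \<bar>\<phi> (fst p) - \<phi> (snd p)\<bar>}" by auto
    moreover have "finite {p \<in> E. b - a \<le> \<bar>\<phi> (fst p) - \<phi> (snd p)\<bar>}"
      using \<phi> E'(1) ab(1) unfolding I slow_on_def by simp
    ultimately show False using E'(2) finite_subset by blast
  qed
  then obtain H where H: "\<And>x \<phi>. x \<in> topspace K \<Longrightarrow> \<phi> \<in> I \<Longrightarrow> limit_along G x \<phi> (H x \<phi>)" by metis
  have HG: "H x (snd g) = fst g x" if x: "x \<in> topspace K" and g: "g \<in> G" for x g
  proof (rule ccontr)
    define \<epsilon> where "\<epsilon> = \<bar>H x (snd g) - fst g x\<bar> / 2"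
    assume "H x (snd g) \<noteq> fst g x"
    then have \<epsilon>: "\<epsilon> > 0" unfolding \<epsilon>_def by simp
    then obtain S \<delta> where S: "S \<subseteq> G" "finite S" "\<delta> > 0"
      "\<forall>\<^sub>F n in sequentially. (\<forall>g\<in>S. dev g n x < \<delta>) \<longrightarrow> \<bar>snd g n - H x (snd g)\<bar> < \<epsilon>"
      using H[OF x GI[OF g]] unfolding limit_along_def by blast
    have "\<exists>\<^sub>F n in sequentially. n \<in> UNIV \<and> (\<forall>h\<in>insert g S. dev h n x < min \<epsilon> \<delta>)"
      using S(1-3) g \<epsilon> by (intro clustersD[OF cl[OF x]]) auto
    from frequently_eventually_frequently[OF this S(4)]
    obtain n where "dev g n x < \<epsilon>" "\<bar>snd g n - H x (snd g)\<bar> < \<epsilon>"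
      by (auto dest!: frequently_ex)
    then show False unfolding \<epsilon>_def by (simp add: abs_if split: if_splits)
  qed
  define h where "h x = (\<lambda>\<phi>\<in>I. H x \<phi>)" for x
  have "h x \<in> P" if x: "x \<in> topspace K" for x
    unfolding P_def
  proof (intro CollectI conjI allI impI)
    show "h x \<in> (\<Pi>\<^sub>E i\<in>I. UNIV)" unfolding h_def by simp
    fix \<Phi> and \<epsilon> :: real assume \<Phi>: "\<Phi> \<subseteq> I" "finite \<Phi>" and \<epsilon>: "0 < \<epsilon>"
    obtain S \<delta> where S: "S \<subseteq> G" "finite S" "\<delta> > 0"
      "\<forall>\<^sub>F n in sequentially. (\<forall>g\<in>S. dev g n x < \<delta>) \<longrightarrow> (\<forall>\<phi>\<in>\<Phi>. \<bar>\<phi> n - H x \<phi>\<bar> < \<epsilon>)"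
      by (rule limit_along_finite[OF \<Phi>(2) _ \<epsilon>, of G x "H x"]) (use H[OF x] \<Phi>(1) in auto)
    have "\<exists>\<^sub>F n in sequentially. n \<in> UNIV \<and> (\<forall>g\<in>S. dev g n x < \<delta>)"
      using S by (intro clustersD[OF cl[OF x]]) auto
    from frequently_eventually_frequently[OF this S(4)]
    have "\<exists>\<^sub>F n in sequentially. \<forall>\<phi>\<in>\<Phi>. \<bar>\<phi> n - H x \<phi>\<bar> < \<epsilon>"
      by (rule frequently_elim1) blast
    moreover have "h x \<phi> = H x \<phi>" if "\<phi> \<in> \<Phi>" for \<phi> using that \<Phi>(1) unfolding h_def by auto
    ultimately show "\<exists>\<^sub>F n in sequentially. \<forall>\<phi>\<in>\<Phi>. \<bar>\<phi> n - h x \<phi>\<bar> < \<epsilon>" by simp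
  qed
  then have hP: "h ` topspace K \<subseteq> P" by auto
  have "p \<in> h ` topspace K" if p: "p \<in> P" for p
  proof -
    have pP: "\<exists>\<^sub>F n in sequentially. \<forall>\<phi>\<in>\<Phi>. \<bar>\<phi> n - p \<phi>\<bar> < \<epsilon>" if "\<Phi> \<subseteq> I" "finite \<Phi>" "\<epsilon> > 0" for \<Phi> \<epsilon>
      using p that unfolding P_def by blast
    \<comment> \<open>Closed conditions on a point whose coded coordinates should be those of
      \<open>p\<close>. Finitely many hold together: infinitely many \<open>n\<close> are close to
      \<open>p\<close> on given coordinates, and all large \<open>n\<close> are close to values at
      points of \<open>K\<close>.\<close>
    define Z where "Z = (\<lambda>(g, \<epsilon>). {y \<in> topspace K. fst g y \<in> cball (p (snd g)) \<epsilon>})"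
    have "topspace K \<inter> \<Inter>(Z ` (G \<times> {0<..})) \<noteq> {}"
    proof -
      have closed: "closedin K C" if "C \<in> Z ` (G \<times> {0<..})" for C
      proof -
        obtain g \<epsilon> where g: "g \<in> G" and C: "C = {y \<in> topspace K. fst g y \<in> cball (p (snd g)) \<epsilon>}"
          using \<open>C \<in> _\<close> unfolding Z_def by auto
        show ?thesis unfolding C by (rule closedin_continuous_map_preimage[OF cont[OF g]]) simp
      qed
      have fip: "topspace K \<inter> \<Inter>\<F> \<noteq> {}" if F: "finite \<F>" "\<F> \<subseteq> Z ` (G \<times> {0<..})" for \<F>
      proof -
        obtain D where D: "D \<subseteq> G \<times> {0<..}" "finite D" "\<F> = Z ` D" using finite_subset_image[OF F] by blast
        define \<epsilon> where "\<epsilon> = Min (insert 1 (snd ` D))"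
        have \<epsilon>: "\<epsilon> > 0" "\<And>d. d \<in> D \<Longrightarrow> \<epsilon> \<le> snd d" unfolding \<epsilon>_def using D(1,2) by auto
        define S where "S = fst ` D"
        have S: "S \<subseteq> G" "finite S" unfolding S_def using D by auto
        have A: "\<exists>\<^sub>F n in sequentially. \<forall>\<phi>\<in>snd ` S. \<bar>\<phi> n - p \<phi>\<bar> < \<epsilon>/2"
          using S GI \<epsilon>(1) by (intro pP) auto
        have B: "\<forall>\<^sub>F n in sequentially. \<exists>x\<in>topspace K. \<forall>g\<in>S. dev g n x < \<epsilon>/2"
          using S \<epsilon>(1) by (intro approx_inD[OF G(1)]) auto
        obtain n where n: "\<forall>\<phi>\<in>snd ` S. \<bar>\<phi> n - p \<phi>\<bar> < \<epsilon>/2" "\<exists>x\<in>topspace K. \<forall>g\<in>S. dev g n x < \<epsilon>/2"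
          using frequently_ex[OF frequently_eventually_frequently[OF A B]] by blast
        then obtain x where x: "x \<in> topspace K" "\<forall>g\<in>S. dev g n x < \<epsilon>/2" by blast
        have "x \<in> Z d" if "d \<in> D" for d
        proof -
          have "fst d \<in> S" using that unfolding S_def by auto
          then have "\<bar>snd (fst d) n - p (snd (fst d))\<bar> < \<epsilon>/2" "dev (fst d) n x < \<epsilon>/2" using n(1) x(2) by auto
          then have "\<bar>p (snd (fst d)) - fst (fst d) x\<bar> \<le> snd d" using \<epsilon>(2)[OF that] by linarith
          then show ?thesis unfolding Z_def using x(1) by (simp add: case_prod_unfold dist_real_def)
        qed
        then show ?thesis using x(1) D(3) by blast
      qed
      have fip': "\<Inter>\<F> \<noteq> {}" if F: "finite \<F>" "\<F> \<subseteq> insert (topspace K) (Z ` (G \<times> {0<..}))" for \<F>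
      proof -
        have "topspace K \<inter> \<Inter>(\<F> - {topspace K}) \<noteq> {}" using F by (intro fip) auto
        moreover have "topspace K \<inter> \<Inter>(\<F> - {topspace K}) \<subseteq> \<Inter>\<F>" by auto
        ultimately show ?thesis by blast
      qed
      have "\<Inter>(insert (topspace K) (Z ` (G \<times> {0<..}))) \<noteq> {}"
      proof (rule K[unfolded compact_space_fip, rule_format], intro conjI ballI allI impI)
        show "closedin K C" if "C \<in> insert (topspace K) (Z ` (G \<times> {0<..}))" for C
          using that closed by auto
        show "\<Inter>\<F> \<noteq> {}" if "finite \<F> \<and> \<F> \<subseteq> insert (topspace K) (Z ` (G \<times> {0<..}))" for \<F>
          using that by (intro fip') auto
      qed
      then show ?thesis by simp
    qed
    then obtain x where x: "x \<in> topspace K" "\<And>g \<epsilon>. g \<in> G \<Longrightarrow> \<epsilon> > 0 \<Longrightarrow> x \<in> Z (g, \<epsilon>)" by auto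
    have px: "p (snd g) = fst g x" if "g \<in> G" for g
    proof (rule ccontr)
      assume ne: "p (snd g) \<noteq> fst g x"
      then have "x \<in> Z (g, \<bar>p (snd g) - fst g x\<bar> / 2)" using x(2)[OF that] by simp
      then show False using ne unfolding Z_def by (simp add: dist_real_def)
    qed
    have "p \<phi> = H x \<phi>" if \<phi>: "\<phi> \<in> I" for \<phi>
    proof (rule ccontr)
      define \<epsilon> where "\<epsilon> = \<bar>H x \<phi> - p \<phi>\<bar> / 2"
      assume "p \<phi> \<noteq> H x \<phi>"
      then have \<epsilon>: "\<epsilon> > 0" unfolding \<epsilon>_def by simp
      then obtain S \<delta> where S: "S \<subseteq> G" "finite S" "\<delta> > 0"
        "\<forall>\<^sub>F n in sequentially. (\<forall>g\<in>S. dev g n x < \<delta>) \<longrightarrow> \<bar>\<phi> n - H x \<phi>\<bar> < \<epsilon>"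
        using H[OF x(1) \<phi>] unfolding limit_along_def by blast
      have "\<exists>\<^sub>F n in sequentially. \<forall>\<psi>\<in>insert \<phi> (snd ` S). \<bar>\<psi> n - p \<psi>\<bar> < min \<epsilon> \<delta>"
        using S(1-3) \<phi> \<epsilon> GI by (intro pP) auto
      from frequently_ex[OF frequently_eventually_frequently[OF this S(4)]]
      obtain n where n: "\<forall>\<psi>\<in>insert \<phi> (snd ` S). \<bar>\<psi> n - p \<psi>\<bar> < min \<epsilon> \<delta>"
        "(\<forall>g\<in>S. dev g n x < \<delta>) \<longrightarrow> \<bar>\<phi> n - H x \<phi>\<bar> < \<epsilon>" by blast
      have "dev g n x < \<delta>" if "g \<in> S" for g
      proof -
        have "\<bar>snd g n - p (snd g)\<bar> < \<delta>" using n(1) that by simp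
        then show ?thesis using px[of g] S(1) that by auto
      qed
      then have "\<bar>\<phi> n - H x \<phi>\<bar> < \<epsilon>" "\<bar>\<phi> n - p \<phi>\<bar> < \<epsilon>" using n by auto
      then show False unfolding \<epsilon>_def by (simp add: abs_if split: if_splits)
    qed
    then have "p = h x" using p unfolding P_def h_def by (auto simp: PiE_iff extensional_def fun_eq_iff)
    then show ?thesis using x(1) by blast
  qed
  then have surj: "h ` topspace K = P" using hP by blast
  have inj: "inj_on h (topspace K)"
  proof (rule inj_onI)
    fix x y assume xy: "x \<in> topspace K" "y \<in> topspace K" "h x = h y"
    show "x = y"
    proof (rule sep[OF xy(1,2)])
      fix g assume g: "g \<in> G"
      have "h x (snd g) = h y (snd g)" using xy(3) by simp
      then show "fst g x = fst g y" unfolding h_def using GI[OF g] HG[OF xy(1) g] HG[OF xy(2) g] by simp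
    qed
  qed
  have "continuous_map K euclideanreal (\<lambda>x. H x \<phi>)" if \<phi>: "\<phi> \<in> I" for \<phi>
    unfolding continuous_map_def
  proof (intro conjI allI impI)
    fix U :: "real set" assume "openin euclideanreal U"
    then have U: "open U" by simp
    show "openin K {x \<in> topspace K. H x \<phi> \<in> U}"
    proof (subst openin_subopen, intro ballI)
      fix x assume "x \<in> {x \<in> topspace K. H x \<phi> \<in> U}"
      then have x: "x \<in> topspace K" "H x \<phi> \<in> U" by auto
      obtain \<epsilon> where \<epsilon>: "\<epsilon> > 0" "\<And>t. \<bar>t - H x \<phi>\<bar> < \<epsilon> \<Longrightarrow> t \<in> U"
        using U x(2) unfolding open_dist dist_real_def by blast
      obtain S \<delta> where S: "S \<subseteq> G" "finite S" "\<delta> > 0"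
        "\<forall>\<^sub>F n in sequentially. (\<forall>g\<in>S. dev g n x < \<delta>) \<longrightarrow> \<bar>\<phi> n - H x \<phi>\<bar> < \<epsilon>/2"
        using H[OF x(1) \<phi>] half_gt_zero[OF \<epsilon>(1)] unfolding limit_along_def by blast
      \<comment> \<open>The radius \<delta>/2 lets an \<open>n\<close> that is near a point
        \<open>y\<close> of \<open>W\<close> be near \<open>x\<close> as well. Such an
        \<open>n\<close> then compares the limits at both points.\<close>
      define W where "W = \<Inter>(insert (topspace K) ((\<lambda>g. {y \<in> topspace K. fst g y \<in> ball (fst g x) (\<delta>/2)}) ` S))"
      have "openin K {y \<in> topspace K. fst g y \<in> ball (fst g x) (\<delta>/2)}" if "g \<in> S" for g
        using S(1) that by (intro openin_continuous_map_preimage[OF cont]) auto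
      then have "openin K W"
        unfolding W_def using S(2) by (intro openin_Inter) (auto simp del: mem_ball)
      moreover have "x \<in> W" unfolding W_def using x(1) S(3) by auto
      moreover have "H y \<phi> \<in> U" "y \<in> topspace K" if "y \<in> W" for y
      proof -
        show y: "y \<in> topspace K" using that unfolding W_def by auto
        have yx: "\<bar>fst g y - fst g x\<bar> < \<delta>/2" if "g \<in> S" for g
          using \<open>y \<in> W\<close> that unfolding W_def by (auto simp: dist_real_def abs_minus_commute)
        obtain S' \<delta>' where S': "S' \<subseteq> G" "finite S'" "\<delta>' > 0"
          "\<forall>\<^sub>F n in sequentially. (\<forall>g\<in>S'. dev g n y < \<delta>') \<longrightarrow> \<bar>\<phi> n - H y \<phi>\<bar> < \<epsilon>/2"
          using H[OF y \<phi>] half_gt_zero[OF \<epsilon>(1)] unfolding limit_along_def by blast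
        have "\<exists>\<^sub>F n in sequentially. n \<in> UNIV \<and> (\<forall>g\<in>S \<union> S'. dev g n y < min (\<delta>/2) \<delta>')"
          using S S' by (intro clustersD[OF cl[OF y]]) auto
        from frequently_ex[OF frequently_eventually_frequently[OF this eventually_conj[OF S(4) S'(4)]]]
        obtain n where n: "\<forall>g\<in>S \<union> S'. dev g n y < min (\<delta>/2) \<delta>'"
          "(\<forall>g\<in>S. dev g n x < \<delta>) \<longrightarrow> \<bar>\<phi> n - H x \<phi>\<bar> < \<epsilon>/2"
          "(\<forall>g\<in>S'. dev g n y < \<delta>') \<longrightarrow> \<bar>\<phi> n - H y \<phi>\<bar> < \<epsilon>/2" by blast
        have "dev g n x < \<delta>" if "g \<in> S" for g
        proof -
          have "dev g n y < \<delta>/2" using n(1) that by auto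
          then show ?thesis using yx[OF that] by linarith
        qed
        then have "\<bar>\<phi> n - H x \<phi>\<bar> < \<epsilon>/2" using n(2) by blast
        moreover have "\<bar>\<phi> n - H y \<phi>\<bar> < \<epsilon>/2" using n(1,3) by auto
        ultimately have "\<bar>H y \<phi> - H x \<phi>\<bar> < \<epsilon>" by linarith
        then show "H y \<phi> \<in> U" by (rule \<epsilon>(2))
      qed
      ultimately show "\<exists>T. openin K T \<and> x \<in> T \<and> T \<subseteq> {x \<in> topspace K. H x \<phi> \<in> U}" by blast
    qed
  qed auto
  then have "continuous_map K (powertop_real I) h"
    unfolding h_def by (auto simp: continuous_map_componentwise)
  then have conth: "continuous_map K Y h"
    unfolding Y_def using hP by (simp add: continuous_map_in_subtopology image_subset_iff_funcset)
  have "Hausdorff_space Y"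
    unfolding Y_def by (intro Hausdorff_space_subtopology) (simp add: Hausdorff_space_product_topology)
  then have "homeomorphic_map K Y h"
    using K conth surj inj tY by (intro continuous_imp_homeomorphic_map) auto
  then show ?thesis unfolding Y by (rule homeomorphic_map_imp_homeomorphic_space)
qed

section \<open>Coarse structures from approximating sequences\<close>

lemma uniformly_finite_relcomp:
  assumes "uniformly_finite E" "uniformly_finite F"
  shows "uniformly_finite (E O F)"
proof -
  obtain k where k: "\<And>x. finite (E `` {x}) \<and> card (E `` {x}) \<le> k" using assms(1) unfolding uniformly_finite_def by auto
  obtain l where l: "\<And>x. finite (F `` {x}) \<and> card (F `` {x}) \<le> l" using assms(2) unfolding uniformly_finite_def by auto
  have "finite ((E O F) `` {x}) \<and> card ((E O F) `` {x}) \<le> k * l" for x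
  proof -
    have eq: "(E O F) `` {x} = (\<Union>y\<in>E `` {x}. F `` {y})" by auto
    have "card (\<Union>y\<in>E `` {x}. F `` {y}) \<le> (\<Sum>y\<in>E `` {x}. card (F `` {y}))"
      using k by (intro card_UN_le) auto
    also have "\<dots> \<le> card (E `` {x}) * l" using l by (intro sum_bounded_above[of _ _ l, simplified]) auto
    also have "\<dots> \<le> k * l" using k by simp
    finally show ?thesis unfolding eq using k l by auto
  qed
  then show ?thesis unfolding uniformly_finite_def by blast
qed

lemma slow_on_relcomp_converse:
  assumes E: "uniformly_finite (E\<inverse>)" "slow_on s E" and F: "uniformly_finite (F\<inverse>)" "slow_on s F"
  shows "slow_on s (E O F\<inverse>)"
  unfolding slow_on_def
proof (intro allI impI)
  fix \<epsilon> :: real assume "0 < \<epsilon>"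
  define X where "X = {p \<in> E. \<epsilon>/2 \<le> \<bar>s (fst p) - s (snd p)\<bar>}"
  define Y where "Y = {p \<in> F. \<epsilon>/2 \<le> \<bar>s (fst p) - s (snd p)\<bar>}"
  have "0 < \<epsilon>/2" using \<open>0 < \<epsilon>\<close> by simp
  then have fin: "finite X" "finite Y" using E(2) F(2) unfolding slow_on_def X_def Y_def by blast+
  have "{p \<in> E O F\<inverse>. \<epsilon> \<le> \<bar>s (fst p) - s (snd p)\<bar>} \<subseteq> fst ` X \<times> F\<inverse> `` (snd ` X) \<union> E\<inverse> `` (snd ` Y) \<times> fst ` Y"
  proof
    fix p assume p: "p \<in> {p \<in> E O F\<inverse>. \<epsilon> \<le> \<bar>s (fst p) - s (snd p)\<bar>}"
    then obtain a b c where abc: "p = (a, c)" "(a, b) \<in> E" "(c, b) \<in> F" by auto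
    have "\<epsilon>/2 \<le> \<bar>s a - s b\<bar> \<or> \<epsilon>/2 \<le> \<bar>s c - s b\<bar>" 
    proof -
      have "\<epsilon> \<le> \<bar>s a - s c\<bar>" using p unfolding abc(1) by simp
      then show ?thesis by linarith
    qed
    then show "p \<in> fst ` X \<times> F\<inverse> `` (snd ` X) \<union> E\<inverse> `` (snd ` Y) \<times> fst ` Y"
    proof
      assume "\<epsilon>/2 \<le> \<bar>s a - s b\<bar>"
      then have "(a, b) \<in> X" using abc unfolding X_def by simp
      then have "a \<in> fst ` X" "b \<in> snd ` X" by force+
      then show ?thesis using abc by blast
    next
      assume "\<epsilon>/2 \<le> \<bar>s c - s b\<bar>"
      then have "(c, b) \<in> Y" using abc unfolding Y_def by simp
      then have "c \<in> fst ` Y" "b \<in> snd ` Y" by force+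
      then show ?thesis using abc by blast
    qed
  qed
  moreover have "finite (F\<inverse> `` (snd ` X))"
    by (rule uniformly_finite_finite_Image[OF F(1) finite_imageI[OF fin(1)]])
  moreover have "finite (E\<inverse> `` (snd ` Y))"
    by (rule uniformly_finite_finite_Image[OF E(1) finite_imageI[OF fin(2)]])
  ultimately show "finite {p \<in> E O F\<inverse>. \<epsilon> \<le> \<bar>s (fst p) - s (snd p)\<bar>}"
    using fin by (meson finite_SigmaI finite_UnI finite_imageI finite_subset)
qed

text \<open>This is the largest finitary coarse structure along which all sequences of
  \<open>H\<close> are slow. The bound on converses is built in because
  \<open>uniformly_finite\<close> is one-sided while coarse structures are closed under
  converses.\<close>

lemma slow_coarse_space:
  fixes H :: "(nat \<Rightarrow> real) set"
  defines "\<E> \<equiv> {E. Id \<subseteq> E \<and> uniformly_finite E \<and> uniformly_finite (E\<inverse>) \<and> (\<forall>s\<in>H. slow_on s E)}"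
  shows "coarse_space UNIV \<E>" "finitary UNIV \<E>"
proof -
  show "finitary UNIV \<E>" unfolding finitary_def \<E>_def uniformly_finite_def by simp
  have cov: "{(x, y)} \<union> Id \<in> \<E>" for x y
  proof -
    have uf: "uniformly_finite ({(x, y)} \<union> Id)" for x y :: nat
      unfolding uniformly_finite_def
    proof (intro exI[of _ 2] allI)
      fix z
      have "({(x, y)} \<union> Id) `` {z} \<subseteq> {z, y}" by auto
      moreover have "card {z, y} \<le> 2" by (simp add: card_insert_if)
      ultimately show "finite (({(x, y)} \<union> Id) `` {z}) \<and> card (({(x, y)} \<union> Id) `` {z}) \<le> 2"
        by (meson card_mono finite.emptyI finite_insert finite_subset order_trans)
    qed
    have "({(x, y)} \<union> Id)\<inverse> = {(y, x)} \<union> Id" by auto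
    moreover have "slow_on s ({(x, y)} \<union> Id)" for s
      unfolding slow_on_def by (auto intro!: finite_subset[of _ "{(x, y)}"])
    ultimately show ?thesis unfolding \<E>_def using uf by auto
  qed
  show "coarse_space UNIV \<E>"
    unfolding coarse_space_def
  proof (intro conjI ballI allI impI)
    show "Id_on UNIV \<subseteq> E" "E \<subseteq> UNIV \<times> UNIV" if "E \<in> \<E>" for E using that unfolding \<E>_def by auto
    have "p \<in> \<Union>\<E>" for p
      using cov[of "fst p" "snd p"] by (rule UnionI) simp
    then show "\<Union>\<E> = UNIV \<times> UNIV" by auto
    show "\<exists>G\<in>\<E>. E O F\<inverse> \<subseteq> G" if EF: "E \<in> \<E>" "F \<in> \<E>" for E F
    proof -
      have "E O F\<inverse> \<in> \<E>"
        unfolding \<E>_def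
      proof (intro CollectI conjI ballI)
        show "Id \<subseteq> E O F\<inverse>" using EF unfolding \<E>_def by auto
        show "uniformly_finite (E O F\<inverse>)" using EF unfolding \<E>_def by (simp add: uniformly_finite_relcomp)
        show "uniformly_finite ((E O F\<inverse>)\<inverse>)" using EF unfolding \<E>_def by (simp add: converse_relcomp uniformly_finite_relcomp)
        show "slow_on s (E O F\<inverse>)" if "s \<in> H" for s
          using EF that unfolding \<E>_def by (intro slow_on_relcomp_converse) auto
      qed
      then show ?thesis by blast
    qed
    show "E \<in> \<E>" if EF: "Id_on UNIV \<subseteq> E" "E \<subseteq> F" "F \<in> \<E>" for E F
    proof -
      have "E\<inverse> \<subseteq> F\<inverse>" using EF(2) by auto
      then show ?thesis using EF unfolding \<E>_def by (auto intro: uniformly_finite_mono slow_on_subset)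
    qed
  qed
qed

text \<open>All relations compatible with the coding are entourages at once, so each pairing can be
  built alone, from the empty family. Pairings for different sets then enter only through
  composites, which stay uniformly finite, and not through the classes they generate
  together.\<close>

lemma finitary_corona:
  fixes K :: "'a topology"
  assumes K: "compact_space K"
    and cont: "\<And>g. g \<in> G \<Longrightarrow> continuous_map K euclideanreal (fst g)"
    and sep: "\<And>x y. x \<in> topspace K \<Longrightarrow> y \<in> topspace K \<Longrightarrow> (\<And>g. g \<in> G \<Longrightarrow> fst g x = fst g y) \<Longrightarrow> x = y"
    and G: "approx_in (topspace K) G" "approx_onto (topspace K) G"
    and seq: "sequential_clusters (topspace K) G"
  shows "\<exists>\<E> :: (nat \<times> nat) set set. coarse_space UNIV \<E> \<and> finitary UNIV \<E> \<and> K homeomorphic_space higson_corona UNIV \<E>"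
proof -
  define \<E> :: "(nat \<times> nat) set set" where
    "\<E> = {E. Id \<subseteq> E \<and> uniformly_finite E \<and> uniformly_finite (E\<inverse>) \<and> (\<forall>s\<in>snd ` G. slow_on s E)}"
  note E = slow_coarse_space[of "snd ` G", folded \<E>_def]
  have "K homeomorphic_space higson_corona UNIV \<E>"
  proof (rule higson_corona_homeomorphic[OF K cont sep G E])
    show "slow_on (snd g) E" if "g \<in> G" "E \<in> \<E>" for g E using that unfolding \<E>_def by blast
    fix A B x assume x: "x \<in> topspace K" "clusters G A x" "clusters G B x"
    obtain \<pi> :: "(nat \<times> nat) set" where \<pi>: "pairing_family (insert \<pi> {})" "\<And>g. g \<in> G \<Longrightarrow> slow_on (snd g) \<pi>"
      "\<And>x. x \<in> topspace K \<Longrightarrow> clusters G A x \<Longrightarrow> clusters G B x \<Longrightarrow> infinite (\<pi> \<inter> A \<times> B)"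
      using pairing_step[OF pairing_family_empty thinnable_countable[OF pairing_family_empty] seq, of A B] by auto
    have sym: "sym \<pi>" using \<pi>(1) unfolding pairing_family_def by simp
    have uf: "uniformly_finite (\<pi>\<^sup>*)" using pairing_familyD[OF \<pi>(1), of "{\<pi>}"] by simp
    have "\<pi>\<^sup>* \<in> \<E>"
      unfolding \<E>_def using uf sym_conv_converse_eq[of "\<pi>\<^sup>*"] sym_rtrancl[OF sym] slow_on_rtrancl[OF uf sym] \<pi>(2) by auto
    moreover have "infinite (\<pi>\<^sup>* \<inter> A \<times> B)"
    proof -
      have "\<pi> \<inter> A \<times> B \<subseteq> \<pi>\<^sup>* \<inter> A \<times> B" by auto
      then show ?thesis using \<pi>(3)[OF x] finite_subset by blast
    qed
    ultimately show "\<exists>E\<in>\<E>. infinite (E \<inter> A \<times> B)" by blast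
  qed
  with E show ?thesis by blast
qed

lemma cellular_corona:
  fixes K :: "'a topology"
  assumes K: "compact_space K"
    and cont: "\<And>g. g \<in> G \<Longrightarrow> continuous_map K euclideanreal (fst g)"
    and sep: "\<And>x y. x \<in> topspace K \<Longrightarrow> y \<in> topspace K \<Longrightarrow> (\<And>g. g \<in> G \<Longrightarrow> fst g x = fst g y) \<Longrightarrow> x = y"
    and G: "approx_in (topspace K) G" "approx_onto (topspace K) G"
    and \<P>: "pairing_family \<P>" and slow: "\<And>g \<pi>. g \<in> G \<Longrightarrow> \<pi> \<in> \<P> \<Longrightarrow> slow_on (snd g) \<pi>"
    and link: "\<And>x A B. x \<in> topspace K \<Longrightarrow> clusters G A x \<Longrightarrow> clusters G B x \<Longrightarrow> \<exists>\<pi>\<in>\<P>. infinite (\<pi> \<inter> A \<times> B)"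
  shows "\<exists>\<E> :: (nat \<times> nat) set set. coarse_space UNIV \<E> \<and> finitary UNIV \<E> \<and> cellular UNIV \<E> \<and>
    K homeomorphic_space higson_corona UNIV \<E>"
proof -
  define \<E> where "\<E> = coarse_of (join_classes \<P>)"
  note E = coarse_of_join_classes(1-3)[OF \<P>, folded \<E>_def]
  have "K homeomorphic_space higson_corona UNIV \<E>"
  proof (rule higson_corona_homeomorphic[OF K cont sep G E(1,2)])
    show "slow_on (snd g) E" if "g \<in> G" "E \<in> \<E>" for g E
      using slow_on_coarse_of_join_classes[OF \<P> slow] that unfolding \<E>_def by blast
    fix A B x assume x: "x \<in> topspace K" "clusters G A x" "clusters G B x"
    obtain \<pi> where \<pi>: "\<pi> \<in> \<P>" "infinite (\<pi> \<inter> A \<times> B)" using link[OF x] by blast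
    have "\<pi> \<inter> A \<times> B \<subseteq> (\<pi> \<union> Id) \<inter> A \<times> B" by auto
    then have "infinite ((\<pi> \<union> Id) \<inter> A \<times> B)" using \<pi>(2) finite_subset by blast
    then show "\<exists>E\<in>\<E>. infinite (E \<inter> A \<times> B)"
      using coarse_of_join_classes(4)[OF \<P> \<pi>(1)] unfolding \<E>_def by blast
  qed
  with E show ?thesis by blast
qed

section \<open>Convergence decided by few coordinates\<close>

lemma compact_zero_set_in_open:
  fixes H :: "('a \<Rightarrow> real) set"
  assumes K: "compact_space K" and H: "\<And>h. h \<in> H \<Longrightarrow> continuous_map K euclideanreal h"
    and U: "openin K U" "\<And>y. y \<in> topspace K \<Longrightarrow> \<forall>h\<in>H. h y = 0 \<Longrightarrow> y \<in> U"
  obtains S \<delta> where "S \<subseteq> H" "finite S" "\<delta> > 0"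
    "\<And>y. y \<in> topspace K \<Longrightarrow> \<forall>h\<in>S. \<bar>h y\<bar> < \<delta> \<Longrightarrow> y \<in> U"
proof (rule ccontr)
  assume nt: "\<not> thesis"
  note result = that
  have neg: "\<exists>y\<in>topspace K. (\<forall>h\<in>S. \<bar>h y\<bar> < \<delta>) \<and> y \<notin> U" if S: "S \<subseteq> H" "finite S" "\<delta> > 0" for S \<delta>
  proof (rule ccontr)
    assume "\<not> ?thesis"
    then have "y \<in> U" if "y \<in> topspace K" "\<forall>h\<in>S. \<bar>h y\<bar> < \<delta>" for y using that by blast
    then have thesis by (rule result[OF S])
    then show False using nt by blast
  qed
  define Z where "Z = (\<lambda>(h :: 'a \<Rightarrow> real, \<epsilon>). {y \<in> topspace K. h y \<in> cball 0 \<epsilon>})"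
  \<comment> \<open>If no finite choice worked, these closed sets would have the finite intersection
    property, and a common point would be a common zero of \<open>H\<close> outside
    \<open>U\<close>.\<close>
  define \<Z> where "\<Z> = insert (topspace K - U) (Z ` (H \<times> {0<..}))"
  have closed: "closedin K C" if C: "C \<in> \<Z>" for C
  proof -
    consider "C = topspace K - U" | h \<epsilon> where "h \<in> H" "C = {y \<in> topspace K. h y \<in> cball 0 \<epsilon>}"
      using C unfolding \<Z>_def Z_def by auto
    then show ?thesis
    proof cases
      case 1 then show ?thesis using U(1) by blast
    next
      case 2
      show ?thesis unfolding 2(2) by (rule closedin_continuous_map_preimage[OF H[OF 2(1)]]) simp
    qed
  qed
  have "\<Inter>\<Z> \<noteq> {}"
  proof (rule K[unfolded compact_space_fip, rule_format], intro conjI ballI allI impI)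
    show "closedin K C" if "C \<in> \<Z>" for C using closed[OF that] .
    fix \<F> assume F: "finite \<F> \<and> \<F> \<subseteq> \<Z>"
    then have "finite (\<F> - {topspace K - U})" "\<F> - {topspace K - U} \<subseteq> Z ` (H \<times> {0<..})" unfolding \<Z>_def by auto
    then obtain D where D: "D \<subseteq> H \<times> {0<..}" "finite D" "\<F> - {topspace K - U} = Z ` D" using finite_subset_image by metis
    define \<epsilon> where "\<epsilon> = Min (insert 1 (snd ` D))"
    have \<epsilon>: "\<epsilon> > 0" "\<And>d. d \<in> D \<Longrightarrow> \<epsilon> \<le> snd d" unfolding \<epsilon>_def using D(1,2) by auto
    have "\<exists>y\<in>topspace K. (\<forall>h\<in>fst ` D. \<bar>h y\<bar> < \<epsilon>) \<and> y \<notin> U"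
      by (rule neg) (use D(1,2) \<epsilon>(1) in auto)
    then obtain y where y: "y \<in> topspace K" "\<forall>h\<in>fst ` D. \<bar>h y\<bar> < \<epsilon>" "y \<notin> U" by blast
    have "y \<in> Z d" if "d \<in> D" for d
    proof -
      have "\<bar>fst d y\<bar> < \<epsilon>" using y(2) that by auto
      then show ?thesis using \<epsilon>(2)[OF that] y(1) unfolding Z_def by (simp add: case_prod_unfold)
    qed
    then have "y \<in> C" if "C \<in> Z ` D" for C using that by auto
    then have "y \<in> C" if "C \<in> \<F>" for C
      using D(3) that y by (cases "C = topspace K - U") (simp, metis DiffI singletonD)
    then show "\<Inter>\<F> \<noteq> {}" by blast
  qed
  then obtain y where yZ: "y \<in> \<Inter>\<Z>" by blast
  then have y: "y \<in> topspace K" "y \<notin> U" unfolding \<Z>_def by auto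
  have yh: "\<bar>h y\<bar> \<le> \<epsilon>" if "h \<in> H" "\<epsilon> > 0" for h \<epsilon>
  proof -
    have "Z (h, \<epsilon>) \<in> \<Z>" unfolding \<Z>_def using that by simp
    then have "y \<in> Z (h, \<epsilon>)" using yZ by blast
    then show ?thesis unfolding Z_def by simp
  qed
  have "\<forall>h\<in>H. h y = 0"
  proof
    fix h assume "h \<in> H"
    then show "h y = 0"
      using yh[of h "\<bar>h y\<bar> / 2"] by (cases "h y = 0") auto
  qed
  then show False using U(2)[OF y(1)] y(2) by blast
qed

text \<open>For large \<open>n\<close> the coding supplies one point \<open>y\<close> that
  approximates finitely many coordinates from \<open>H\<close> and the coordinate \<open>g\<close>
  simultaneously. For \<open>n\<close> in \<open>A\<close> the former are near their values at
  \<open>x\<close>; by compactness this puts \<open>y\<close> where \<open>fst g\<close> is near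
  \<open>fst g x\<close>, so \<open>snd g n\<close> is near it too.\<close>

lemma converges_determined:
  assumes K: "compact_space K" and cont: "\<And>g. g \<in> G \<Longrightarrow> continuous_map K euclideanreal (fst g)"
    and G: "approx_in (topspace K) G" and H: "H \<subseteq> G" "converges H A x" and x: "x \<in> topspace K"
    and det: "\<And>y g. y \<in> topspace K \<Longrightarrow> (\<And>h. h \<in> H \<Longrightarrow> fst h y = fst h x) \<Longrightarrow> g \<in> G \<Longrightarrow> fst g y = fst g x"
  shows "converges G A x"
  unfolding converges_def
proof (intro ballI allI impI)
  fix g and \<epsilon> :: real assume g: "g \<in> G" and \<epsilon>: "0 < \<epsilon>"
  define U where "U = {y \<in> topspace K. fst g y \<in> ball (fst g x) (\<epsilon>/2)}"
  have "openin K U" unfolding U_def by (rule openin_continuous_map_preimage[OF cont[OF g]]) simp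
  define H' where "H' = (\<lambda>h y. fst h y - fst h x) ` H"
  have cH: "continuous_map K euclideanreal h" if "h \<in> H'" for h
    using that H(1) cont unfolding H'_def by (auto intro!: continuous_intros)
  obtain S' \<delta> where S': "S' \<subseteq> H'" "finite S'" "\<delta> > 0"
    "\<And>y. y \<in> topspace K \<Longrightarrow> \<forall>h\<in>S'. \<bar>h y\<bar> < \<delta> \<Longrightarrow> y \<in> U"
  proof (rule compact_zero_set_in_open[OF K cH \<open>openin K U\<close>])
    show "y \<in> U" if y: "y \<in> topspace K" "\<forall>h\<in>H'. h y = 0" for y
    proof -
      have "fst h y = fst h x" if "h \<in> H" for h using y(2) that unfolding H'_def by auto
      then have "fst g y = fst g x" using det[OF y(1) _ g] by blast
      then show ?thesis unfolding U_def using y(1) \<epsilon> by simp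
    qed
  qed (assumption, rule that)
  obtain S where S: "S \<subseteq> H" "finite S" "S' = (\<lambda>h y. fst h y - fst h x) ` S"
    using finite_subset_image[OF S'(2)] S'(1) unfolding H'_def by blast
  have "\<forall>\<^sub>F n in sequentially. \<forall>h\<in>S. n \<in> A \<longrightarrow> dev h n x < \<delta>/2"
  proof (intro eventually_ball_finite S(2) ballI)
    fix h assume "h \<in> S"
    then have "h \<in> H" using S(1) by blast
    then show "\<forall>\<^sub>F n in sequentially. n \<in> A \<longrightarrow> dev h n x < \<delta>/2"
      using H(2)[unfolded converges_def, rule_format, OF _ half_gt_zero[OF S'(3)]] by blast
  qed
  moreover have "\<forall>\<^sub>F n in sequentially. \<exists>y\<in>topspace K. \<forall>h\<in>insert g S. dev h n y < min (\<delta>/2) (\<epsilon>/2)"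
    using S(1,2) H(1) g S'(3) \<epsilon> by (intro approx_inD[OF G]) auto
  ultimately show "\<forall>\<^sub>F n in sequentially. n \<in> A \<longrightarrow> dev g n x < \<epsilon>"
  proof eventually_elim
    case (elim n)
    show ?case
    proof
      assume "n \<in> A"
      obtain y where y: "y \<in> topspace K" "\<And>h. h \<in> insert g S \<Longrightarrow> dev h n y < min (\<delta>/2) (\<epsilon>/2)"
        using elim(2) by blast
      have "\<bar>h y\<bar> < \<delta>" if hS: "h \<in> S'" for h
      proof -
        obtain h' where h': "h' \<in> S" "h = (\<lambda>y. fst h' y - fst h' x)" using hS S(3) by auto
        have "dev h' n y < \<delta>/2" "dev h' n x < \<delta>/2"
          using y(2)[of h'] elim(1) h'(1) \<open>n \<in> A\<close> by auto
        then show ?thesis unfolding h'(2) by linarith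
      qed
      then have "y \<in> U" using S'(4)[OF y(1)] by blast
      then have "\<bar>fst g x - fst g y\<bar> < \<epsilon>/2" unfolding U_def by (simp add: dist_real_def)
      moreover have "dev g n y < \<epsilon>/2" using y(2)[of g] by simp
      ultimately show "dev g n x < \<epsilon>" by linarith
    qed
  qed
qed

text \<open>Subsequences need only be found for a small set of coordinates that tells
  \<open>x\<close> from all other points; convergence of these forces convergence of all
  coordinates.\<close>

lemma sequential_clustersI:
  assumes K: "compact_space K" and cont: "\<And>g. g \<in> G \<Longrightarrow> continuous_map K euclideanreal (fst g)"
    and G: "approx_in (topspace K) G"
    and H: "\<And>x. x \<in> topspace K \<Longrightarrow> \<exists>H\<subseteq>G. (countable H \<or> |H| <o pseudointersection_number) \<and>
      (\<forall>y\<in>topspace K. (\<forall>h\<in>H. fst h y = fst h x) \<longrightarrow> y = x)"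
  shows "sequential_clusters (topspace K) G"
  unfolding sequential_clusters_def
proof (intro ballI allI impI)
  fix x A assume x: "x \<in> topspace K" and A: "clusters G A x"
  from H[OF x] obtain H where H0: "H \<subseteq> G \<and> (countable H \<or> |H| <o pseudointersection_number) \<and>
      (\<forall>y\<in>topspace K. (\<forall>h\<in>H. fst h y = fst h x) \<longrightarrow> y = x)"
    by (elim exE)
  then have H': "H \<subseteq> G" "countable H \<or> |H| <o pseudointersection_number" by simp_all
  have det: "y = x" if "y \<in> topspace K" "\<And>h. h \<in> H \<Longrightarrow> fst h y = fst h x" for y
    using H0 that by simp
  have AH: "clusters H A x" by (rule clusters_subset[OF A H'(1)])
  obtain A' where A': "A' \<subseteq> A" "infinite A'" "converges H A' x"
  proof (cases "countable H")
    case True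
    show thesis by (rule convergent_subset_countable[OF AH True]) (rule that)
  next
    case False
    then have "infinite H" by (auto dest: countable_finite)
    then show thesis
      by (rule convergent_subset_pseudointersection[OF AH]) (use False H'(2) in blast, rule that)
  qed
  have "converges G A' x"
  proof (rule converges_determined[OF K cont G H'(1) A'(3) x])
    fix y g assume "y \<in> topspace K" "\<And>h. h \<in> H \<Longrightarrow> fst h y = fst h x"
    then have "y = x" by (rule det)
    then show "fst g y = fst g x" by simp
  qed
  then show "\<exists>A'\<subseteq>A. infinite A' \<and> converges G A' x" using A' by blast
qed

section \<open>Weight at most \<open>\<omega>\<^sub>1\<close> and small character\<close>

lemma sequential_corona:
  fixes K :: "'a topology"
  assumes K: "compact_space K"
    and cont: "\<And>g. g \<in> G \<Longrightarrow> continuous_map K euclideanreal (fst g)"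
    and sep: "\<And>x y. x \<in> topspace K \<Longrightarrow> y \<in> topspace K \<Longrightarrow> (\<And>g. g \<in> G \<Longrightarrow> fst g x = fst g y) \<Longrightarrow> x = y"
    and G: "approx_in (topspace K) G" "approx_onto (topspace K) G"
    and seq: "sequential_clusters (topspace K) G"
  shows "(\<exists>\<E> :: (nat \<times> nat) set set. coarse_space UNIV \<E> \<and> finitary UNIV \<E> \<and> K homeomorphic_space higson_corona UNIV \<E>) \<and>
    (Delta_cellular =o continuum \<longrightarrow> (\<exists>\<E> :: (nat \<times> nat) set set. coarse_space UNIV \<E> \<and> finitary UNIV \<E> \<and> cellular UNIV \<E> \<and>
      K homeomorphic_space higson_corona UNIV \<E>))"
proof (intro conjI impI)
  show "\<exists>\<E> :: (nat \<times> nat) set set. coarse_space UNIV \<E> \<and> finitary UNIV \<E> \<and> K homeomorphic_space higson_corona UNIV \<E>"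
    by (rule finitary_corona[OF K cont sep G seq])
  assume Delta: "Delta_cellular =o continuum"
  show "\<exists>\<E> :: (nat \<times> nat) set set. coarse_space UNIV \<E> \<and> finitary UNIV \<E> \<and> cellular UNIV \<E> \<and>
      K homeomorphic_space higson_corona UNIV \<E>"
  proof (rule pairings_Delta[OF seq Delta])
    fix \<P> :: "(nat \<times> nat) set set"
    assume pf: "pairing_family \<P>" and sl: "\<And>g \<pi>. g \<in> G \<Longrightarrow> \<pi> \<in> \<P> \<Longrightarrow> slow_on (snd g) \<pi>"
      and lk: "\<And>x A B. x \<in> topspace K \<Longrightarrow> clusters G A x \<Longrightarrow> clusters G B x \<Longrightarrow> \<exists>\<pi>\<in>\<P>. infinite (\<pi> \<inter> A \<times> B)"
    show ?thesis by (rule cellular_corona[OF K cont sep G pf sl lk])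
  qed
qed

lemma compact_Hausdorff_Urysohn:
  assumes K: "compact_space K" "Hausdorff_space K" and C: "closedin K C" and U: "openin K U" "C \<subseteq> U"
  obtains u :: "'a \<Rightarrow> real" where "continuous_map K euclideanreal u" "\<And>y. y \<in> C \<Longrightarrow> u y = 0"
    "\<And>y. y \<in> topspace K \<Longrightarrow> y \<notin> U \<Longrightarrow> u y = 1"
proof -
  have n: "normal_space K" using K compact_Hausdorff_or_regular_imp_normal_space by blast
  have cl: "closedin K (topspace K - U)" using U(1) by blast
  have dj: "disjnt C (topspace K - U)" using U(2) by (auto simp: disjnt_def)
  obtain u where u: "continuous_map K (top_of_set {0..1::real}) u" "u ` C \<subseteq> {0}" "u ` (topspace K - U) \<subseteq> {1}"
    by (rule Urysohn_lemma[OF n C cl dj, of 0 1]) auto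
  show thesis
    by (rule that[of u]) (use u in \<open>auto simp: continuous_map_in_subtopology\<close>)
qed

text \<open>Each pair of basic open sets, the closure of the first inside the second, gets a Urysohn
  function; other pairs get the constant 0. There are at most \<open>\<omega>\<^sub>1\<close> pairs,
  and regularity of \<open>K\<close> yields one that separates two given points.\<close>

lemma weight_le_omega1_functions:
  fixes K :: "'a topology"
  assumes T: "topspace K \<noteq> {}" and K: "compact_space K" "Hausdorff_space K" and w: "weight K \<le>o \<omega>\<^sub>1"
  obtains f :: "nat set \<Rightarrow> 'a \<Rightarrow> real" where "\<And>\<alpha>. \<alpha> \<in> Field \<omega>\<^sub>1 \<Longrightarrow> continuous_map K euclideanreal (f \<alpha>)"
    "\<And>x y. x \<in> topspace K \<Longrightarrow> y \<in> topspace K \<Longrightarrow> \<forall>\<alpha>\<in>Field \<omega>\<^sub>1. f \<alpha> x = f \<alpha> y \<Longrightarrow> x = y"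
proof -
  have "topological_base K {U. openin K U}" unfolding topological_base_def by auto
  then have "{\<B>. topological_base K \<B>} \<noteq> {}" by blast
  then obtain \<B> where \<B>: "\<B> \<in> {\<B>. topological_base K \<B>}" "least_card {\<B>. topological_base K \<B>} = |\<B>|"
    by (rule least_card) blast
  then have base: "\<And>V. V \<in> \<B> \<Longrightarrow> openin K V" "\<And>U x. openin K U \<Longrightarrow> x \<in> U \<Longrightarrow> \<exists>V\<in>\<B>. x \<in> V \<and> V \<subseteq> U"
    unfolding topological_base_def by blast+
  have card: "|\<B>| \<le>o \<omega>\<^sub>1" using w \<B>(2) unfolding weight_def by simp
  have "infinite (Field \<omega>\<^sub>1)" using Field_omega1(3) by (auto dest: countable_finite)
  then have "|\<B> \<times> \<B>| \<le>o \<omega>\<^sub>1"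
    using card card_of_Times_ordLeq_infinite_Field[OF _ card card Card_order_omega1] by blast
  then have "|\<B> \<times> \<B>| \<le>o |Field \<omega>\<^sub>1|"
    using Field_omega1(1) ordIso_symmetric ordLeq_ordIso_trans by blast
  moreover have "\<B> \<times> \<B> \<noteq> {}"
  proof -
    obtain x where "x \<in> topspace K" using T by blast
    then show ?thesis using base(2)[OF openin_topspace] by blast
  qed
  ultimately obtain e where e: "e ` Field \<omega>\<^sub>1 = \<B> \<times> \<B>" by (rule ordLeq_surj)
  have "\<exists>u. continuous_map K euclideanreal u \<and> (K closure_of fst p \<subseteq> snd p \<longrightarrow>
      (\<forall>y\<in>fst p. u y = (0::real)) \<and> (\<forall>y\<in>topspace K - snd p. u y = 1))" if p: "p \<in> \<B> \<times> \<B>" for p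
  proof (cases "K closure_of fst p \<subseteq> snd p")
    case False
    have "continuous_map K euclideanreal (\<lambda>y. 0::real)" by simp
    then show ?thesis using False by blast
  next
    case True
    have op: "openin K (snd p)" "openin K (fst p)" using p base(1) by auto
    obtain u where u: "continuous_map K euclideanreal u" "\<And>y. y \<in> K closure_of fst p \<Longrightarrow> u y = (0::real)"
      "\<And>y. y \<in> topspace K \<Longrightarrow> y \<notin> snd p \<Longrightarrow> u y = 1"
      by (rule compact_Hausdorff_Urysohn[OF K closedin_closure_of op(1) True]) (rule that)
    have "fst p \<subseteq> K closure_of fst p" by (rule closure_of_subset[OF openin_subset[OF op(2)]])
    then show ?thesis using u by blast
  qed
  then obtain u :: "'a set \<times> 'a set \<Rightarrow> 'a \<Rightarrow> real" where u: "\<And>p. p \<in> \<B> \<times> \<B> \<Longrightarrow> continuous_map K euclideanreal (u p) \<and>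
      (K closure_of fst p \<subseteq> snd p \<longrightarrow> (\<forall>y\<in>fst p. u p y = 0) \<and> (\<forall>y\<in>topspace K - snd p. u p y = 1))"
    by metis
  show thesis
  proof (rule that[of "\<lambda>\<alpha>. u (e \<alpha>)"])
    show "continuous_map K euclideanreal (u (e \<alpha>))" if "\<alpha> \<in> Field \<omega>\<^sub>1" for \<alpha>
      using u[of "e \<alpha>"] e that by blast
    fix x y assume xy: "x \<in> topspace K" "y \<in> topspace K" "\<forall>\<alpha>\<in>Field \<omega>\<^sub>1. u (e \<alpha>) x = u (e \<alpha>) y"
    show "x = y"
    proof (rule ccontr)
      assume "x \<noteq> y"
      then obtain V0 where V0: "openin K V0" "x \<in> V0" "y \<notin> V0"
        using K(2) xy(1,2) unfolding Hausdorff_space_def disjnt_def by blast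
      obtain V where V: "V \<in> \<B>" "x \<in> V" "V \<subseteq> V0" using base(2)[OF V0(1,2)] by blast
      have nb: "neighbourhood_base_of (closedin K) K"
        using compact_Hausdorff_imp_regular_space[OF K] by (simp add: neighbourhood_base_of_closedin)
      have "\<exists>U C. openin K U \<and> closedin K C \<and> x \<in> U \<and> U \<subseteq> C \<and> C \<subseteq> V"
        by (rule nb[unfolded neighbourhood_base_of, rule_format]) (use base(1)[OF V(1)] V(2) in simp)
      then obtain U C where UC: "openin K U" "closedin K C" "x \<in> U" "U \<subseteq> C" "C \<subseteq> V" by blast
      obtain U' where U': "U' \<in> \<B>" "x \<in> U'" "U' \<subseteq> U" using base(2)[OF UC(1,3)] by blast
      have "K closure_of U' \<subseteq> V" using closure_of_minimal[of U' C K] U'(3) UC by blast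
      moreover have UV: "(U', V) \<in> \<B> \<times> \<B>" using U'(1) V(1) by simp
      ultimately have u01: "u (U', V) x = 0" "u (U', V) y = 1"
        using u[OF UV] U'(2) xy(2) V V0(3) by auto
      have "(U', V) \<in> e ` Field \<omega>\<^sub>1" unfolding e by (rule UV)
      then obtain \<alpha> where "\<alpha> \<in> Field \<omega>\<^sub>1" "(U', V) = e \<alpha>" by (rule imageE) blast
      then show False using xy(3) u01 by simp
    qed
  qed
qed

lemma corona_weight_le_omega1:
  fixes K :: "'a topology"
  assumes T: "topspace K \<noteq> {}" and K: "compact_space K" "Hausdorff_space K" and w: "weight K \<le>o \<omega>\<^sub>1"
    and p: "\<omega>\<^sub>1 <o pseudointersection_number"
  obtains G where "\<And>g. g \<in> G \<Longrightarrow> continuous_map K euclideanreal (fst g)"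
    "\<And>x y. x \<in> topspace K \<Longrightarrow> y \<in> topspace K \<Longrightarrow> (\<And>g. g \<in> G \<Longrightarrow> fst g x = fst g y) \<Longrightarrow> x = y"
    "approx_in (topspace K) G" "approx_onto (topspace K) G" "sequential_clusters (topspace K) G"
proof -
  obtain f :: "nat set \<Rightarrow> 'a \<Rightarrow> real" where f: "\<And>\<alpha>. \<alpha> \<in> Field \<omega>\<^sub>1 \<Longrightarrow> continuous_map K euclideanreal (f \<alpha>)"
    "\<And>x y. x \<in> topspace K \<Longrightarrow> y \<in> topspace K \<Longrightarrow> \<forall>\<alpha>\<in>Field \<omega>\<^sub>1. f \<alpha> x = f \<alpha> y \<Longrightarrow> x = y"
    by (rule weight_le_omega1_functions[OF T K w]) blast
  \<comment> \<open>Empty sets are passed for \<open>A\<close> and \<open>B\<close>, since only the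
    sequences are wanted here. The pairings come later, when the size of \<open>G\<close> has given
    convergent subsequences.\<close>
  obtain G :: "'a coding" where G: "approx_in (topspace K) G" "approx_onto (topspace K) G"
    "fst ` G = f ` Field \<omega>\<^sub>1" "|G| \<le>o \<omega>\<^sub>1"
    by (rule omega1_approximation[OF T, of f "\<lambda>_. {}" "\<lambda>_. {}"]) blast
  have cont: "continuous_map K euclideanreal (fst g)" if "g \<in> G" for g
  proof -
    have "fst g \<in> f ` Field \<omega>\<^sub>1" using that G(3) by blast
    then show ?thesis using f(1) by auto
  qed
  have sep: "x = y" if "x \<in> topspace K" "y \<in> topspace K" "\<forall>g\<in>G. fst g x = fst g y" for x y
  proof (rule f(2)[OF that(1,2)], rule ballI)
    fix \<alpha> assume "\<alpha> \<in> Field \<omega>\<^sub>1"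
    then have "f \<alpha> \<in> fst ` G" using G(3) by blast
    then show "f \<alpha> x = f \<alpha> y" using that(3) by auto
  qed
  have "|G| <o pseudointersection_number" using G(4) p ordLeq_ordLess_trans by blast
  then have "sequential_clusters (topspace K) G"
    by (intro sequential_clustersI[OF K(1) cont G(1)] exI[of _ G]) (use sep in auto)
  then show thesis using that[OF cont _ G(1,2)] sep by blast
qed

lemma cellular_corona_CH:
  fixes K :: "'a topology"
  assumes T: "topspace K \<noteq> {}" and K: "compact_space K" "Hausdorff_space K" and w: "weight K \<le>o \<omega>\<^sub>1"
    and CH: "\<omega>\<^sub>1 =o continuum"
  shows "\<exists>\<E> :: (nat \<times> nat) set set. coarse_space UNIV \<E> \<and> finitary UNIV \<E> \<and> cellular UNIV \<E> \<and>
    K homeomorphic_space higson_corona UNIV \<E>"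
proof -
  obtain f :: "nat set \<Rightarrow> 'a \<Rightarrow> real" where f: "\<And>\<alpha>. \<alpha> \<in> Field \<omega>\<^sub>1 \<Longrightarrow> continuous_map K euclideanreal (f \<alpha>)"
    "\<And>x y. x \<in> topspace K \<Longrightarrow> y \<in> topspace K \<Longrightarrow> \<forall>\<alpha>\<in>Field \<omega>\<^sub>1. f \<alpha> x = f \<alpha> y \<Longrightarrow> x = y"
    by (rule weight_le_omega1_functions[OF T K w]) blast
  have "continuum =o |Field \<omega>\<^sub>1|"
    using CH Field_omega1(1) ordIso_transitive ordIso_symmetric by blast
  then have "|UNIV :: (nat set \<times> nat set) set| \<le>o |Field \<omega>\<^sub>1|"
    using card_nat_set_pairs ordLeq_ordIso_trans by blast
  \<comment> \<open>Under CH all pairs of sets are enumerated in length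
    \<open>\<omega>\<^sub>1\<close>, so every pair is treated at a stage with a countable coding,
    where convergent subsequences exist by diagonalisation.\<close>
  then obtain e where e: "e ` Field \<omega>\<^sub>1 = (UNIV :: (nat set \<times> nat set) set)"
    by (rule ordLeq_surj) simp
  obtain G :: "'a coding" and \<P> where G: "approx_in (topspace K) G" "approx_onto (topspace K) G"
    and \<P>: "pairing_family \<P>" "\<And>g \<pi>. g \<in> G \<Longrightarrow> \<pi> \<in> \<P> \<Longrightarrow> slow_on (snd g) \<pi>"
    and fG: "fst ` G = f ` Field \<omega>\<^sub>1"
    and link: "\<And>x \<alpha>. x \<in> topspace K \<Longrightarrow> \<alpha> \<in> Field \<omega>\<^sub>1 \<Longrightarrow> clusters G (fst (e \<alpha>)) x \<Longrightarrow> clusters G (snd (e \<alpha>)) x \<Longrightarrow>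
      \<exists>\<pi>\<in>\<P>. infinite (\<pi> \<inter> fst (e \<alpha>) \<times> snd (e \<alpha>))"
    by (rule omega1_approximation[OF T, of f "\<lambda>\<alpha>. fst (e \<alpha>)" "\<lambda>\<alpha>. snd (e \<alpha>)"]) blast
  show ?thesis
  proof (rule cellular_corona[OF K(1) _ _ G \<P>])
    show "continuous_map K euclideanreal (fst g)" if "g \<in> G" for g
    proof -
      have "fst g \<in> f ` Field \<omega>\<^sub>1" using that fG by blast
      then show ?thesis using f(1) by auto
    qed
    show "x = y" if xy: "x \<in> topspace K" "y \<in> topspace K" "\<And>g. g \<in> G \<Longrightarrow> fst g x = fst g y" for x y
    proof (rule f(2)[OF xy(1,2)], rule ballI)
      fix \<alpha> assume "\<alpha> \<in> Field \<omega>\<^sub>1"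
      then have "f \<alpha> \<in> fst ` G" using fG by blast
      then show "f \<alpha> x = f \<alpha> y" using xy(3) by auto
    qed
    show "\<exists>\<pi>\<in>\<P>. infinite (\<pi> \<inter> A \<times> B)" if x: "x \<in> topspace K" "clusters G A x" "clusters G B x" for x A B
    proof -
      have "(A, B) \<in> e ` Field \<omega>\<^sub>1" using e by simp
      then obtain \<alpha> where \<alpha>: "\<alpha> \<in> Field \<omega>\<^sub>1" "e \<alpha> = (A, B)" by force
      show ?thesis using link[OF x(1) \<alpha>(1)] x(2,3) unfolding \<alpha>(2) by simp
    qed
  qed
qed

section \<open>Coronas of small character\<close>

lemma corona_approximation:
  fixes K :: "'a topology"
  assumes "is_corona K"
  obtains G where "\<And>g. g \<in> G \<Longrightarrow> continuous_map K euclideanreal (fst g)"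
    "\<And>f. continuous_map K euclideanreal f \<Longrightarrow> \<exists>s. (f, s) \<in> G"
    "approx_in (topspace K) G" "approx_onto (topspace K) G"
proof -
  obtain C :: "(nat + 'a) topology" where C: "compact_space C" "Hausdorff_space C"
    "range Inl = {x \<in> topspace C. openin C {x}}" "C closure_of range Inl = topspace C"
    "K homeomorphic_space subtopology C (topspace C - range Inl)"
    using assms unfolding is_corona_def by blast
  define R where "R = topspace C - range Inl"
  obtain h h' where hh: "homeomorphic_maps K (subtopology C R) h h'"
    using C(5) unfolding R_def homeomorphic_space_def by blast
  have h: "continuous_map K (subtopology C R) h" "continuous_map (subtopology C R) K h'"
    and hh': "\<And>x. x \<in> topspace K \<Longrightarrow> h' (h x) = x" "\<And>p. p \<in> R \<Longrightarrow> h (h' p) = p"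
    using hh unfolding homeomorphic_maps_def R_def by auto
  have hR: "h x \<in> R" if "x \<in> topspace K" for x
    using continuous_map_image_subset_topspace[OF h(1)] that unfolding R_def by auto
  have h'K: "h' p \<in> topspace K" if "p \<in> R" for p
    using continuous_map_image_subset_topspace[OF h(2)] that unfolding R_def by auto
  have iso: "openin C {Inl n}" "Inl n \<in> topspace C" for n using C(3) by blast+
  have "openin C (\<Union>n. {Inl n :: nat + 'a})" using iso by (intro openin_Union) auto
  moreover have "(\<Union>n. {Inl n :: nat + 'a}) = range Inl" by auto
  ultimately have "openin C (range Inl)" by simp
  then have Rcl: "closedin C R" unfolding R_def by blast
  define good where "good g F \<longleftrightarrow> continuous_map C euclideanreal F \<and> (\<forall>x\<in>topspace K. F (h x) = fst g x) \<and> snd g = (\<lambda>n. F (Inl n))"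
    for g :: "('a \<Rightarrow> real) \<times> (nat \<Rightarrow> real)" and F :: "nat + 'a \<Rightarrow> real"
  \<comment> \<open>Every continuous function on \<open>K\<close> is coded by the restrictions to
    the naturals of all its continuous extensions to \<open>C\<close>; Tietze's theorem provides at
    least one.\<close>
  define G where "G = {g. continuous_map K euclideanreal (fst g) \<and> (\<exists>F. good g F)}"
  have ex: "\<exists>s. (f, s) \<in> G" if f: "continuous_map K euclideanreal f" for f
  proof -
    have "normal_space C" using C(1,2) compact_Hausdorff_or_regular_imp_normal_space by blast
    moreover have "continuous_map (subtopology C R) euclideanreal (f \<circ> h')" using h(2) f by (rule continuous_map_compose)
    ultimately obtain F where F: "continuous_map C euclideanreal F" "\<And>p. p \<in> R \<Longrightarrow> F p = (f \<circ> h') p"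
      using Tietze_extension_realinterval[of C R UNIV "f \<circ> h'"] Rcl is_interval_univ by auto
    have "F (h x) = f x" if "x \<in> topspace K" for x using F(2)[OF hR[OF that]] hh'(1)[OF that] by simp
    then have "(f, \<lambda>n. F (Inl n)) \<in> G" unfolding G_def good_def using f F(1) by auto
    then show ?thesis by blast
  qed
  have op: "openin C {p \<in> topspace C. \<forall>g\<in>S. \<bar>F g p - fst g x\<bar> < \<epsilon>}"
    if S: "finite S" "\<And>g. g \<in> S \<Longrightarrow> good g (F g)" for S F x \<epsilon>
  proof -
    have "openin C {p \<in> topspace C. F g p \<in> ball (fst g x) \<epsilon>}" if "g \<in> S" for g
      using S(2)[OF that] unfolding good_def by (intro openin_continuous_map_preimage[where Y = euclideanreal]) auto
    then have "openin C (\<Inter>(insert (topspace C) ((\<lambda>g. {p \<in> topspace C. F g p \<in> ball (fst g x) \<epsilon>}) ` S)))"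
      using S(1) by (intro openin_Inter) (auto simp del: mem_ball)
    moreover have "\<Inter>(insert (topspace C) ((\<lambda>g. {p \<in> topspace C. F g p \<in> ball (fst g x) \<epsilon>}) ` S)) =
        {p \<in> topspace C. \<forall>g\<in>S. \<bar>F g p - fst g x\<bar> < \<epsilon>}"
      by (auto simp: dist_real_def abs_minus_commute)
    ultimately show ?thesis by simp
  qed
  have choice: "\<exists>F. \<forall>g\<in>S. good g (F g)" if "S \<subseteq> G" for S
    using that unfolding G_def by (intro bchoice) blast
  have "approx_in (topspace K) G"
    unfolding approx_in_def
  proof (intro allI impI)
    fix S and \<epsilon> :: real assume S: "S \<subseteq> G" "finite S" and \<epsilon>: "0 < \<epsilon>"
    obtain F where F: "\<And>g. g \<in> S \<Longrightarrow> good g (F g)" using choice[OF S(1)] by blast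
    define O' where "O' = (\<Union>x\<in>topspace K. {p \<in> topspace C. \<forall>g\<in>S. \<bar>F g p - fst g x\<bar> < \<epsilon>})"
    have O': "openin C O'" unfolding O'_def using op[OF S(2) F] by (intro openin_Union) auto
    have "R \<subseteq> O'"
    proof
      fix p assume p: "p \<in> R"
      have "F g p = fst g (h' p)" if "g \<in> S" for g
        using F[OF that] h'K[OF p] hh'(2)[OF p] unfolding good_def by metis
      then have "\<forall>g\<in>S. \<bar>F g p - fst g (h' p)\<bar> < \<epsilon>" using \<epsilon> by simp
      then show "p \<in> O'"
        unfolding O'_def using p unfolding R_def by (intro UN_I[OF h'K[OF p]]) blast
    qed
    \<comment> \<open>The complement of \<open>O'\<close> is a compact set of isolated points, hence
      finite, so almost all naturals lie in \<open>O'\<close>.\<close>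
    then have sub: "topspace C - O' \<subseteq> range Inl" unfolding R_def by auto
    have "closedin C (topspace C - O')" using O' by blast
    then have "compactin C (topspace C - O')" using C(1) by (rule closedin_compact_space[rotated])
    then have "\<exists>\<F>. finite \<F> \<and> \<F> \<subseteq> range (\<lambda>n. {Inl n}) \<and> topspace C - O' \<subseteq> \<Union>\<F>"
      by (rule compactinD) (use iso sub in auto)
    then obtain \<F> where \<F>: "finite \<F>" "\<F> \<subseteq> range (\<lambda>n. {Inl n})" "topspace C - O' \<subseteq> \<Union>\<F>" by blast
    have "finite (\<Union>\<F>)" using \<F>(1,2) by (intro finite_Union) auto
    then have "finite (topspace C - O')" using \<F>(3) finite_subset by blast
    moreover have "Inl ` {n. Inl n \<notin> O'} \<subseteq> topspace C - O'" using iso(2) by auto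
    ultimately have "finite {n. Inl n \<notin> O'}"
      by (meson finite_imageD finite_subset inj_Inl inj_on_subset subset_UNIV)
    then have "\<forall>\<^sub>F n in sequentially. Inl n \<in> O'"
      by (simp add: cofinite_eq_sequentially[symmetric] eventually_cofinite)
    then show "\<forall>\<^sub>F n in sequentially. \<exists>x\<in>topspace K. \<forall>g\<in>S. dev g n x < \<epsilon>"
    proof eventually_elim
      case (elim n)
      then show ?case unfolding O'_def using F unfolding good_def by auto
    qed
  qed
  moreover have "approx_onto (topspace K) G"
    unfolding approx_onto_def clusters_def
  proof (intro ballI allI impI)
    fix x S and \<epsilon> :: real assume x: "x \<in> topspace K" and S: "S \<subseteq> G" "finite S" and \<epsilon>: "0 < \<epsilon>"
    obtain F where F: "\<And>g. g \<in> S \<Longrightarrow> good g (F g)" using choice[OF S(1)] by blast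
    define O' where "O' = {p \<in> topspace C. \<forall>g\<in>S. \<bar>F g p - fst g x\<bar> < \<epsilon>}"
    have O': "openin C O'" unfolding O'_def using op[OF S(2) F] .
    have hx: "h x \<in> O'" "h x \<in> topspace C" "h x \<notin> range Inl"
      unfolding O'_def using hR[OF x] F x \<epsilon> unfolding R_def good_def by auto
    \<comment> \<open>A finite trace on the naturals could be removed from \<open>O'\<close>,
      leaving a neighbourhood of \<open>h x\<close> without naturals, against their density.\<close>
    have "infinite {n. Inl n \<in> O'}"
    proof
      assume fin: "finite {n. Inl n \<in> O'}"
      have "closedin C (Inl ` {n. Inl n \<in> O'})"
        using C(2) fin iso(2) by (intro closedin_Hausdorff_finite) auto
      then have "openin C (O' - Inl ` {n. Inl n \<in> O'})" using O' by (intro openin_diff)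
      moreover have "h x \<in> O' - Inl ` {n. Inl n \<in> O'}" using hx by auto
      moreover have "h x \<in> C closure_of range Inl" using hx(2) C(4) by simp
      ultimately have "\<exists>p\<in>range Inl. p \<in> O' - Inl ` {n. Inl n \<in> O'}" unfolding in_closure_of by blast
      then show False by blast
    qed
    moreover have "{n. Inl n \<in> O'} \<subseteq> {n. n \<in> UNIV \<and> (\<forall>g\<in>S. dev g n x < \<epsilon>)}"
      unfolding O'_def using F unfolding good_def by auto
    ultimately have "infinite {n. n \<in> UNIV \<and> (\<forall>g\<in>S. dev g n x < \<epsilon>)}" using finite_subset by blast
    then show "\<exists>\<^sub>F n in sequentially. n \<in> UNIV \<and> (\<forall>g\<in>S. dev g n x < \<epsilon>)"
      unfolding frequently_sequentially_infinite .
  qed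
  moreover have "continuous_map K euclideanreal (fst g)" if "g \<in> G" for g using that unfolding G_def by blast
  ultimately show thesis using that ex by blast
qed

text \<open>\<open>least_card\<close> is 0 on an empty class, so both classes must be shown nonempty
  before a bound on \<open>character\<close> yields an actual neighbourhood base.\<close>

lemma character_nbhd_base:
  fixes K :: "'a topology"
  assumes x: "x \<in> topspace K" and c: "character K <o r"
  obtains \<B> where "nbhd_base K x \<B>" "|\<B>| <o r"
proof -
  have ne: "{\<B>. nbhd_base K y \<B>} \<noteq> {}" if "y \<in> topspace K" for y
  proof -
    have "nbhd_base K y {V. openin K V \<and> y \<in> V}"
      unfolding nbhd_base_def using openin_subset by (auto simp: interior_of_openin)
    then show ?thesis by blast
  qed
  have "character_at K y \<le>o |UNIV :: 'a set set|" if y: "y \<in> topspace K" for y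
  proof -
    obtain \<B> where "character_at K y = |\<B> :: 'a set set|"
      unfolding character_at_def by (rule least_card[OF ne[OF y]]) blast
    then show ?thesis by (simp add: card_of_mono1)
  qed
  then have "{A. \<forall>x\<in>topspace K. character_at K x \<le>o |A :: 'a set set|} \<noteq> {}" by blast
  then obtain A :: "'a set set" where A: "\<forall>x\<in>topspace K. character_at K x \<le>o |A|" "character K = |A|"
    unfolding character_def by (rule least_card) blast
  obtain \<B> where \<B>: "nbhd_base K x \<B>" "character_at K x = |\<B> :: 'a set set|"
    unfolding character_at_def by (rule least_card[OF ne[OF x]]) blast
  have "|\<B>| <o r" using A x c \<B>(2) ordLeq_ordLess_trans by metis
  then show thesis using that \<B>(1) by blast
qed

text \<open>Urysohn functions for a small neighbourhood base at \<open>x\<close> tell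
  \<open>x\<close> from every other point, so fewer than \<open>pseudointersection_number\<close>
  coordinates decide convergence to \<open>x\<close>.\<close>

lemma corona_small_character:
  fixes K :: "'a topology"
  assumes K: "compact_space K" "Hausdorff_space K" and cor: "is_corona K"
    and c: "character K <o pseudointersection_number"
  obtains G where "\<And>g. g \<in> G \<Longrightarrow> continuous_map K euclideanreal (fst g)"
    "\<And>f. continuous_map K euclideanreal f \<Longrightarrow> \<exists>s. (f, s) \<in> G"
    "approx_in (topspace K) G" "approx_onto (topspace K) G" "sequential_clusters (topspace K) G"
proof -
  obtain G :: "'a coding" where G: "\<And>g. g \<in> G \<Longrightarrow> continuous_map K euclideanreal (fst g)"
    "\<And>f. continuous_map K euclideanreal f \<Longrightarrow> \<exists>s. (f, s) \<in> G"
    "approx_in (topspace K) G" "approx_onto (topspace K) G"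
    by (rule corona_approximation[OF cor]) blast
  have "sequential_clusters (topspace K) G"
  proof (rule sequential_clustersI[OF K(1) G(1,3)])
    fix x assume x: "x \<in> topspace K"
    obtain \<B> where \<B>: "nbhd_base K x \<B>" "|\<B>| <o pseudointersection_number"
      by (rule character_nbhd_base[OF x c])
    have "\<exists>g\<in>G. fst g x = 0 \<and> (\<forall>y\<in>topspace K - V. fst g y = 1)" if V: "V \<in> \<B>" for V
    proof -
      have "x \<in> K interior_of V" using \<B>(1) V unfolding nbhd_base_def by blast
      then have "{x} \<subseteq> K interior_of V" by simp
      moreover have "closedin K {x}" using K(2) x by (simp add: closedin_Hausdorff_sing_eq)
      ultimately obtain u where u: "continuous_map K euclideanreal u" "\<And>y. y \<in> {x} \<Longrightarrow> u y = 0"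
        "\<And>y. y \<in> topspace K \<Longrightarrow> y \<notin> K interior_of V \<Longrightarrow> u y = 1"
        using compact_Hausdorff_Urysohn[OF K _ openin_interior_of] by metis
      obtain s where "(u, s) \<in> G" using G(2)[OF u(1)] by blast
      moreover have "u y = 1" if "y \<in> topspace K - V" for y
        using u(3)[of y] that interior_of_subset[of K V] by blast
      ultimately show ?thesis using u(2) by (intro bexI[of _ "(u, s)"]) auto
    qed
    then obtain k where k: "\<And>V. V \<in> \<B> \<Longrightarrow> k V \<in> G" "\<And>V. V \<in> \<B> \<Longrightarrow> fst (k V) x = 0"
      "\<And>V y. V \<in> \<B> \<Longrightarrow> y \<in> topspace K - V \<Longrightarrow> fst (k V) y = 1" by metis
    have "|k ` \<B>| <o pseudointersection_number" using \<B>(2) card_of_image ordLeq_ordLess_trans by blast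
    moreover have "y = x" if y: "y \<in> topspace K" "\<forall>g\<in>k ` \<B>. fst g y = fst g x" for y
    proof (rule ccontr)
      assume "y \<noteq> x"
      then obtain U where U: "openin K U" "x \<in> U" "y \<notin> U"
        using K(2) x y(1) unfolding Hausdorff_space_def disjnt_def by blast
      then obtain V where V: "V \<in> \<B>" "V \<subseteq> U" using \<B>(1) unfolding nbhd_base_def by blast
      then have "fst (k V) y = 1" using k(3) U(3) y(1) by blast
      then show False using y(2) k(2)[OF V(1)] V(1) by auto
    qed
    ultimately show "\<exists>H\<subseteq>G. (countable H \<or> |H| <o pseudointersection_number) \<and>
        (\<forall>y\<in>topspace K. (\<forall>h\<in>H. fst h y = fst h x) \<longrightarrow> y = x)"
      using k(1) by (intro exI[of _ "k ` \<B>"]) auto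
  qed
  then show thesis using that G by blast
qed

lemma continuous_functions_separate:
  assumes K: "compact_space K" "Hausdorff_space K" and xy: "x \<in> topspace K" "y \<in> topspace K"
    and eq: "\<And>f :: 'a \<Rightarrow> real. continuous_map K euclideanreal f \<Longrightarrow> f x = f y"
  shows "x = y"
proof (rule ccontr)
  assume "x \<noteq> y"
  have "closedin K {x}" "closedin K {y}" using K(2) xy by (simp_all add: closedin_Hausdorff_sing_eq)
  then have "openin K (topspace K - {y})" by blast
  moreover have "{x} \<subseteq> topspace K - {y}" using xy(1) \<open>x \<noteq> y\<close> by auto
  ultimately obtain u :: "'a \<Rightarrow> real" where "continuous_map K euclideanreal u" "\<And>z. z \<in> {x} \<Longrightarrow> u z = 0"
    "\<And>z. z \<in> topspace K \<Longrightarrow> z \<notin> topspace K - {y} \<Longrightarrow> u z = 1"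
    using compact_Hausdorff_Urysohn[OF K \<open>closedin K {x}\<close>] by metis
  then show False using eq[of u] xy(2) by auto
qed

section \<open>Perfectly normal spaces\<close>

lemma perfectly_normal_closed:
  assumes "perfectly_normal_space K" "closedin K C"
  obtains \<U> where "countable \<U>" "\<And>U. U \<in> \<U> \<Longrightarrow> openin K U" "\<And>U. U \<in> \<U> \<Longrightarrow> C \<subseteq> U"
    "\<And>x. x \<in> topspace K \<Longrightarrow> x \<notin> C \<Longrightarrow> \<exists>U\<in>\<U>. x \<notin> U"
proof -
  have "gdelta_in K C" using assms unfolding perfectly_normal_space_def by blast
  then have "(countable intersection_of openin K) C" by (simp add: gdelta_in_alt)
  then obtain \<U> where \<U>: "countable \<U>" "\<U> \<subseteq> Collect (openin K)" "\<Inter>\<U> = C"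
    unfolding intersection_of_def by auto
  show thesis by (rule that[of \<U>]) (use \<U> in auto)
qed

text \<open>Points are G-delta sets, and one Urysohn function for each of countably many open sets
  with intersection \<open>{x}\<close> singles out \<open>x\<close>.\<close>

lemma perfectly_normal_point_functions:
  fixes K :: "'a topology"
  assumes K: "compact_space K" "Hausdorff_space K" "perfectly_normal_space K" and x: "x \<in> topspace K"
  obtains H :: "('a \<Rightarrow> real) set" where "countable H" "\<And>h. h \<in> H \<Longrightarrow> continuous_map K euclideanreal h"
    "\<And>y. y \<in> topspace K \<Longrightarrow> \<forall>h\<in>H. h y = h x \<Longrightarrow> y = x"
proof -
  have clx: "closedin K {x}" using K(2) x by (simp add: closedin_Hausdorff_sing_eq)
  obtain \<U> where \<U>: "countable \<U>" "\<And>U. U \<in> \<U> \<Longrightarrow> openin K U" "\<And>U. U \<in> \<U> \<Longrightarrow> {x} \<subseteq> U"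
    "\<And>y. y \<in> topspace K \<Longrightarrow> y \<notin> {x} \<Longrightarrow> \<exists>U\<in>\<U>. y \<notin> U"
    by (rule perfectly_normal_closed[OF K(3) clx]) blast
  have "\<exists>u. continuous_map K euclideanreal u \<and> u x = (0::real) \<and> (\<forall>y\<in>topspace K - U. u y = 1)" if U: "U \<in> \<U>" for U
  proof -
    obtain u :: "'a \<Rightarrow> real" where "continuous_map K euclideanreal u" "\<And>y. y \<in> {x} \<Longrightarrow> u y = 0"
      "\<And>y. y \<in> topspace K \<Longrightarrow> y \<notin> U \<Longrightarrow> u y = 1"
      by (rule compact_Hausdorff_Urysohn[OF K(1,2) clx \<U>(2,3)[OF U]]) (rule that)
    then show ?thesis by auto
  qed
  then obtain u :: "'a set \<Rightarrow> 'a \<Rightarrow> real" where u: "\<And>U. U \<in> \<U> \<Longrightarrow> continuous_map K euclideanreal (u U)"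
    "\<And>U. U \<in> \<U> \<Longrightarrow> u U x = 0" "\<And>U y. U \<in> \<U> \<Longrightarrow> y \<in> topspace K - U \<Longrightarrow> u U y = 1" by metis
  show thesis
  proof (rule that[of "u ` \<U>"])
    show "countable (u ` \<U>)" using \<U>(1) by simp
    show "continuous_map K euclideanreal h" if "h \<in> u ` \<U>" for h using that u(1) by auto
    fix y assume y: "y \<in> topspace K" "\<forall>h\<in>u ` \<U>. h y = h x"
    show "y = x"
    proof (rule ccontr)
      assume "y \<noteq> x"
      then obtain U where U: "U \<in> \<U>" "y \<notin> U" using \<U>(4)[OF y(1)] by blast
      then have "u U y = 1" using u(3) y(1) by blast
      then show False using y(2) u(2)[OF U(1)] U(1) by auto
    qed
  qed
qed

lemma open_contains_basic_neighbourhood: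
  fixes H :: "('a \<Rightarrow> real) set"
  assumes K: "compact_space K" and H: "\<And>h. h \<in> H \<Longrightarrow> continuous_map K euclideanreal h"
    and sep: "\<And>y. y \<in> topspace K \<Longrightarrow> \<forall>h\<in>H. h y = h x \<Longrightarrow> y = x" and U: "openin K U" "x \<in> U"
  obtains S \<delta> where "S \<subseteq> H" "finite S" "\<delta> > 0"
    "\<And>y. y \<in> topspace K \<Longrightarrow> \<forall>h\<in>S. \<bar>h y - h x\<bar> < \<delta> \<Longrightarrow> y \<in> U"
proof -
  define H' where "H' = (\<lambda>h y. h y - h x) ` H"
  have cH: "continuous_map K euclideanreal h" if "h \<in> H'" for h
    using that H unfolding H'_def by (auto intro!: continuous_intros)
  obtain S' \<delta> where S': "S' \<subseteq> H'" "finite S'" "\<delta> > 0"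
    "\<And>y. y \<in> topspace K \<Longrightarrow> \<forall>h\<in>S'. \<bar>h y\<bar> < \<delta> \<Longrightarrow> y \<in> U"
  proof (rule compact_zero_set_in_open[OF K cH U(1)])
    fix y assume y: "y \<in> topspace K" "\<forall>h\<in>H'. h y = 0"
    have "\<forall>h\<in>H. h y = h x" using y(2) unfolding H'_def by auto
    then show "y \<in> U" using sep[OF y(1)] U(2) by blast
  qed (assumption, rule that)
  obtain S where S: "S \<subseteq> H" "finite S" "S' = (\<lambda>h y. h y - h x) ` S"
    using finite_subset_image[OF S'(2)] S'(1) unfolding H'_def by blast
  show thesis
  proof (rule that[OF S(1,2) S'(3)])
    fix y assume "y \<in> topspace K" "\<forall>h\<in>S. \<bar>h y - h x\<bar> < \<delta>"
    then show "y \<in> U" using S'(4)[of y] unfolding S(3) by simp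
  qed
qed

text \<open>By compactness, countably many functions that single out \<open>y\<close> define a
  countable neighbourhood base at \<open>y\<close>; one point of \<open>D\<close> in each basic set
  suffices.\<close>

lemma perfectly_normal_closure_countable:
  fixes K :: "'a topology"
  assumes K: "compact_space K" "Hausdorff_space K" "perfectly_normal_space K" and y: "y \<in> K closure_of D"
  obtains D' where "countable D'" "D' \<subseteq> D" "y \<in> K closure_of D'"
proof -
  have yK: "y \<in> topspace K" using y by (simp add: in_closure_of)
  obtain H :: "('a \<Rightarrow> real) set" where H: "countable H" "\<And>h. h \<in> H \<Longrightarrow> continuous_map K euclideanreal h"
    "\<And>z. z \<in> topspace K \<Longrightarrow> \<forall>h\<in>H. h z = h y \<Longrightarrow> z = y"
    by (rule perfectly_normal_point_functions[OF K yK]) blast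
  obtain S :: "nat \<Rightarrow> ('a \<Rightarrow> real) set" where S: "\<And>i j. i \<le> j \<Longrightarrow> S i \<subseteq> S j" "\<And>k. finite (S k)" "\<And>k. S k \<subseteq> H"
    "\<And>F. F \<subseteq> H \<Longrightarrow> finite F \<Longrightarrow> \<exists>k. F \<subseteq> S k"
    by (rule countable_exhaustion[OF H(1)]) (rule that)
  have "\<exists>d\<in>D. d \<in> topspace K \<and> (\<forall>h\<in>S k. \<bar>h d - h y\<bar> < 1 / real (k + 1))" for k
  proof -
    have "openin K {z \<in> topspace K. h z \<in> ball (h y) (1 / real (k + 1))}" if "h \<in> S k" for h
      using H(2)[of h] S(3) that by (intro openin_continuous_map_preimage[where Y = euclideanreal]) auto
    then have "openin K (\<Inter>(insert (topspace K) ((\<lambda>h. {z \<in> topspace K. h z \<in> ball (h y) (1 / real (k + 1))}) ` S k)))"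
      using S(2) by (intro openin_Inter) (auto simp del: mem_ball)
    moreover have "y \<in> \<Inter>(insert (topspace K) ((\<lambda>h. {z \<in> topspace K. h z \<in> ball (h y) (1 / real (k + 1))}) ` S k))"
      using yK by auto
    ultimately obtain d where "d \<in> D" "d \<in> \<Inter>(insert (topspace K) ((\<lambda>h. {z \<in> topspace K. h z \<in> ball (h y) (1 / real (k + 1))}) ` S k))"
      using y unfolding in_closure_of by blast
    then show ?thesis by (intro bexI[of _ d]) (auto simp: dist_real_def abs_minus_commute)
  qed
  then obtain d where d: "\<And>k. d k \<in> D" "\<And>k. d k \<in> topspace K" "\<And>k h. h \<in> S k \<Longrightarrow> \<bar>h (d k) - h y\<bar> < 1 / real (k + 1)" by metis
  have "y \<in> K closure_of range d"
    unfolding in_closure_of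
  proof (intro conjI allI impI yK)
    fix U assume U: "y \<in> U \<and> openin K U"
    obtain F \<delta> where F: "F \<subseteq> H" "finite F" "\<delta> > 0" "\<And>z. z \<in> topspace K \<Longrightarrow> \<forall>h\<in>F. \<bar>h z - h y\<bar> < \<delta> \<Longrightarrow> z \<in> U"
    proof (rule open_contains_basic_neighbourhood[OF K(1) H(2,3)])
      show "openin K U" "y \<in> U" using U by auto
    qed (assumption | rule that)+
    obtain k0 where k0: "F \<subseteq> S k0" using S(4)[OF F(1,2)] by blast
    obtain k1 where k1: "1 / real (k1 + 1) < \<delta>" using F(3) nat_approx_posE by (metis Suc_eq_plus1)
    define k where "k = max k0 k1"
    have "\<bar>h (d k) - h y\<bar> < \<delta>" if "h \<in> F" for h
    proof -
      have "h \<in> S k" using that k0 S(1)[of k0 k] unfolding k_def by auto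
      then have "\<bar>h (d k) - h y\<bar> < 1 / real (k + 1)" by (rule d(3))
      also have "\<dots> \<le> 1 / real (k1 + 1)" unfolding k_def by (intro divide_left_mono) auto
      also have "\<dots> < \<delta>" by (rule k1)
      finally show ?thesis .
    qed
    then have "d k \<in> U" using F(4)[OF d(2)] by blast
    then show "\<exists>z. z \<in> range d \<and> z \<in> U" by blast
  qed
  then show thesis using d(1) by (intro that[of "range d"]) auto
qed

text \<open>The dense set is the union of countable sets indexed by \<open>\<omega>\<^sub>1\<close>: each stage meets the
  complement of every non-covering finite union of neighbourhoods from countable outer bases of
  the closures of the earlier stages. If a point were outside the closure, such neighbourhoods
  missing the point would cover the closure, hence finitely many of them would.\<close>

lemma perfectly_normal_dense_omega1:
  fixes K :: "'a topology"
  assumes K: "compact_space K" "Hausdorff_space K" "perfectly_normal_space K" and T: "topspace K \<noteq> {}"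
  obtains D where "D \<subseteq> topspace K" "|D| \<le>o \<omega>\<^sub>1" "K closure_of D = topspace K"
proof -
  \<comment> \<open>In a stage \<open>v\<close>, the first component collects open neighbourhoods of
    the closure of the earlier points, with that closure as intersection; the second holds the
    points added.\<close>
  define Inv where "Inv X \<longleftrightarrow> (\<forall>v\<in>X. countable (fst v) \<and> countable (snd v) \<and> snd v \<subseteq> topspace K \<and> (\<forall>U\<in>fst v. openin K U))"
    for X :: "('a set set \<times> 'a set) set"
  define Q where "Q \<alpha> X v \<longleftrightarrow> (\<forall>U\<in>fst v. K closure_of (\<Union>(snd ` X)) \<subseteq> U) \<and>
      (\<forall>x\<in>topspace K. x \<notin> K closure_of (\<Union>(snd ` X)) \<longrightarrow> (\<exists>U\<in>fst v. x \<notin> U)) \<and>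
      (\<forall>\<G>. finite \<G> \<longrightarrow> \<G> \<subseteq> fst v \<union> \<Union>(fst ` X) \<longrightarrow> topspace K - \<Union>\<G> \<noteq> {} \<longrightarrow> snd v - \<Union>\<G> \<noteq> {})"
    for \<alpha> :: "nat set" and X :: "('a set set \<times> 'a set) set" and v :: "'a set set \<times> 'a set"
  obtain g where g: "Inv (g ` Field \<omega>\<^sub>1)" "\<And>\<alpha>. \<alpha> \<in> Field \<omega>\<^sub>1 \<Longrightarrow> Q \<alpha> (g ` underS \<omega>\<^sub>1 \<alpha>) (g \<alpha>)"
  proof (rule transfinite_extension[of \<omega>\<^sub>1 Inv Q])
    show "Well_order \<omega>\<^sub>1" by (rule Well_order_omega1)
    show "Inv {}" unfolding Inv_def by simp
    show "Inv X \<longleftrightarrow> (\<forall>S\<subseteq>X. finite S \<longrightarrow> Inv S)" for X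
    proof
      show "Inv X \<Longrightarrow> \<forall>S\<subseteq>X. finite S \<longrightarrow> Inv S" unfolding Inv_def by auto
      assume *: "\<forall>S\<subseteq>X. finite S \<longrightarrow> Inv S"
      show "Inv X"
        unfolding Inv_def
      proof
        fix v assume "v \<in> X"
        then have "Inv {v}" using * by simp
        then show "countable (fst v) \<and> countable (snd v) \<and> snd v \<subseteq> topspace K \<and> (\<forall>U\<in>fst v. openin K U)"
          unfolding Inv_def by simp
      qed
    qed
    show "\<exists>v. Inv (insert v X) \<and> Q \<alpha> X v" if \<alpha>: "\<alpha> \<in> Field \<omega>\<^sub>1" and X: "Inv X" "|X| \<le>o |underS \<omega>\<^sub>1 \<alpha>|" for \<alpha> X
    proof -
      have cX: "countable X" using countable_ordLeq[OF X(2) countable_underS_omega1[OF \<alpha>]] .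
      obtain \<U> where \<U>: "countable \<U>" "\<And>U. U \<in> \<U> \<Longrightarrow> openin K U" "\<And>U. U \<in> \<U> \<Longrightarrow> K closure_of (\<Union>(snd ` X)) \<subseteq> U"
        "\<And>x. x \<in> topspace K \<Longrightarrow> x \<notin> K closure_of (\<Union>(snd ` X)) \<Longrightarrow> \<exists>U\<in>\<U>. x \<notin> U"
        by (rule perfectly_normal_closed[OF K(3), of "K closure_of (\<Union>(snd ` X))"]) (simp, rule that)
      define V where "V = \<U> \<union> \<Union>(fst ` X)"
      have "countable (\<Union>(fst ` X))" using X(1) cX unfolding Inv_def by auto
      then have cV: "countable V" unfolding V_def using \<U>(1) by simp
      define \<F> where "\<F> = {\<G>. \<G> \<subseteq> V \<and> finite \<G> \<and> topspace K - \<Union>\<G> \<noteq> {}}"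
      have "\<F> \<subseteq> {\<G>. finite \<G> \<and> \<G> \<subseteq> V}" unfolding \<F>_def by auto
      then have cF: "countable \<F>" using countable_Collect_finite_subset[OF cV] by (rule countable_subset)
      define pick where "pick \<G> = (SOME x. x \<in> topspace K - \<Union>\<G>)" for \<G>
      have pick: "pick \<G> \<in> topspace K - \<Union>\<G>" if "\<G> \<in> \<F>" for \<G>
      proof -
        have "\<exists>x. x \<in> topspace K - \<Union>\<G>" using that unfolding \<F>_def by auto
        then show ?thesis unfolding pick_def by (rule someI_ex)
      qed
      have "Inv (insert (\<U>, pick ` \<F>) X)"
        using X(1) \<U>(1,2) cF pick unfolding Inv_def by auto
      moreover have "Q \<alpha> X (\<U>, pick ` \<F>)"
        unfolding Q_def
      proof (intro conjI ballI allI impI)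
        show "K closure_of (\<Union>(snd ` X)) \<subseteq> U" if "U \<in> fst (\<U>, pick ` \<F>)" for U using \<U>(3) that by simp
        show "\<exists>U\<in>fst (\<U>, pick ` \<F>). x \<notin> U" if "x \<in> topspace K" "x \<notin> K closure_of (\<Union>(snd ` X))" for x
          using \<U>(4)[OF that] by simp
        fix \<G> assume G: "finite \<G>" "\<G> \<subseteq> fst (\<U>, pick ` \<F>) \<union> \<Union>(fst ` X)" "topspace K - \<Union>\<G> \<noteq> {}"
        then have "\<G> \<in> \<F>" unfolding \<F>_def V_def by simp
        then have "pick \<G> \<in> snd (\<U>, pick ` \<F>) - \<Union>\<G>" using pick by auto
        then show "snd (\<U>, pick ` \<F>) - \<Union>\<G> \<noteq> {}" by blast
      qed
      ultimately show ?thesis by blast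
    qed
  qed (rule that)
  define D where "D = (\<Union>\<alpha>\<in>Field \<omega>\<^sub>1. snd (g \<alpha>))"
  have Iv: "countable (fst (g \<alpha>))" "countable (snd (g \<alpha>))" "snd (g \<alpha>) \<subseteq> topspace K" "\<And>U. U \<in> fst (g \<alpha>) \<Longrightarrow> openin K U"
    if "\<alpha> \<in> Field \<omega>\<^sub>1" for \<alpha> using g(1) that unfolding Inv_def by auto
  have DK: "D \<subseteq> topspace K" unfolding D_def using Iv(3) by blast
  define Y where "Y \<alpha> = K closure_of (\<Union>(snd ` g ` underS \<omega>\<^sub>1 \<alpha>))" for \<alpha>
  have "topspace K \<subseteq> K closure_of D"
  proof (rule ccontr)
    assume "\<not> ?thesis"
    then obtain z where z: "z \<in> topspace K" "z \<notin> K closure_of D" by blast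
    have uF: "underS \<omega>\<^sub>1 \<alpha> \<subseteq> Field \<omega>\<^sub>1" for \<alpha> unfolding underS_def Field_def by auto
    have YD: "Y \<alpha> \<subseteq> K closure_of D" for \<alpha>
      unfolding Y_def D_def using uF by (intro closure_of_mono) blast
    have "\<exists>U\<in>fst (g \<alpha>). z \<notin> U \<and> Y \<alpha> \<subseteq> U" if \<alpha>: "\<alpha> \<in> Field \<omega>\<^sub>1" for \<alpha>
    proof -
      have "z \<notin> Y \<alpha>" using YD z(2) by blast
      note q = g(2)[OF \<alpha>, unfolded Q_def, folded Y_def]
      obtain U where "U \<in> fst (g \<alpha>)" "z \<notin> U"
        using q[THEN conjunct2, THEN conjunct1, rule_format, OF z(1) \<open>z \<notin> Y \<alpha>\<close>] by blast
      then show ?thesis using q[THEN conjunct1] by blast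
    qed
    then obtain U where U: "\<And>\<alpha>. \<alpha> \<in> Field \<omega>\<^sub>1 \<Longrightarrow> U \<alpha> \<in> fst (g \<alpha>)" "\<And>\<alpha>. \<alpha> \<in> Field \<omega>\<^sub>1 \<Longrightarrow> z \<notin> U \<alpha>"
      "\<And>\<alpha>. \<alpha> \<in> Field \<omega>\<^sub>1 \<Longrightarrow> Y \<alpha> \<subseteq> U \<alpha>" by metis
    \<comment> \<open>Countable tightness together with regularity of
      \<open>\<omega>\<^sub>1\<close>: a point of the closure of \<open>D\<close> is already in the
      closure of the points from one initial segment.\<close>
    have cover: "K closure_of D \<subseteq> \<Union>(U ` Field \<omega>\<^sub>1)"
    proof
      fix y assume "y \<in> K closure_of D"
      then obtain D' where D': "countable D'" "D' \<subseteq> D" "y \<in> K closure_of D'"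
        by (rule perfectly_normal_closure_countable[OF K])
      have "\<forall>d\<in>D'. \<exists>\<alpha>\<in>Field \<omega>\<^sub>1. d \<in> snd (g \<alpha>)" using D'(2) unfolding D_def by blast
      then obtain a where a: "\<And>d. d \<in> D' \<Longrightarrow> a d \<in> Field \<omega>\<^sub>1" "\<And>d. d \<in> D' \<Longrightarrow> d \<in> snd (g (a d))" by metis
      have ca: "countable (a ` D')" "a ` D' \<subseteq> Field \<omega>\<^sub>1" using D'(1) a(1) by auto
      obtain \<alpha> where \<alpha>: "\<alpha> \<in> Field \<omega>\<^sub>1" "a ` D' \<subseteq> underS \<omega>\<^sub>1 \<alpha>"
        by (rule countable_bounded_omega1[OF ca])
      have "D' \<subseteq> \<Union>(snd ` g ` underS \<omega>\<^sub>1 \<alpha>)" using a(2) \<alpha>(2) by blast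
      then have "y \<in> Y \<alpha>" unfolding Y_def using D'(3) closure_of_mono by blast
      then show "y \<in> \<Union>(U ` Field \<omega>\<^sub>1)" using U(3)[OF \<alpha>(1)] \<alpha>(1) by blast
    qed
    have "compactin K (K closure_of D)" using K(1) by (simp add: closedin_compact_space)
    then have "\<exists>\<F>. finite \<F> \<and> \<F> \<subseteq> U ` Field \<omega>\<^sub>1 \<and> K closure_of D \<subseteq> \<Union>\<F>"
      by (rule compactinD) (use U(1) Iv(4) cover in auto)
    then obtain \<F> where \<F>: "finite \<F>" "\<F> \<subseteq> U ` Field \<omega>\<^sub>1" "K closure_of D \<subseteq> \<Union>\<F>" by blast
    obtain J0 where J0: "J0 \<subseteq> Field \<omega>\<^sub>1" "finite J0" "\<F> = U ` J0" using finite_subset_image[OF \<F>(1,2)] by blast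
    obtain \<alpha>0 where \<alpha>0: "\<alpha>0 \<in> Field \<omega>\<^sub>1" using Field_omega1(2) by blast
    have J: "finite (insert \<alpha>0 J0)" "insert \<alpha>0 J0 \<noteq> {}" "insert \<alpha>0 J0 \<subseteq> Field \<omega>\<^sub>1" using J0 \<alpha>0 by auto
    obtain m where m: "m \<in> insert \<alpha>0 J0" "insert \<alpha>0 J0 \<subseteq> insert m (underS \<omega>\<^sub>1 m)"
      by (rule Well_order_finite_max[OF Well_order_omega1 J])
    have mF: "m \<in> Field \<omega>\<^sub>1" using m(1) J(3) by blast
    \<comment> \<open>All members of the finite cover are known at stage \<open>m\<close>, so this
      stage added a point outside the cover, although every added point lies in
      \<open>D\<close>.\<close>
    have "\<F> \<subseteq> fst (g m) \<union> \<Union>(fst ` g ` underS \<omega>\<^sub>1 m)"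
    proof
      fix F assume "F \<in> \<F>"
      then obtain j where j: "j \<in> J0" "F = U j" unfolding J0(3) by blast
      then have "F \<in> fst (g j)" "j \<in> insert m (underS \<omega>\<^sub>1 m)" using U(1) J0(1) m(2) by auto
      then show "F \<in> fst (g m) \<union> \<Union>(fst ` g ` underS \<omega>\<^sub>1 m)" by blast
    qed
    moreover have "topspace K - \<Union>\<F> \<noteq> {}" using z(1) U(2) \<F>(2) by blast
    ultimately have "snd (g m) - \<Union>\<F> \<noteq> {}"
      using g(2)[OF mF, unfolded Q_def, THEN conjunct2, THEN conjunct2, rule_format, OF \<F>(1)] by simp
    moreover have "snd (g m) \<subseteq> D" unfolding D_def using mF by blast
    ultimately show False using subset_trans[OF closure_of_subset[OF DK] \<F>(3)] by blast
  qed
  then have dense: "K closure_of D = topspace K" by (intro equalityI closure_of_subset_topspace)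
  have inf: "infinite (Field \<omega>\<^sub>1)" using Field_omega1(3) by (auto dest: countable_finite)
  have "|snd (g \<alpha>)| \<le>o \<omega>\<^sub>1" if "\<alpha> \<in> Field \<omega>\<^sub>1" for \<alpha>
  proof -
    have "|snd (g \<alpha>)| \<le>o natLeq" using Iv(2)[OF that] by (simp add: countable_card_le_natLeq)
    then show ?thesis using cardSuc_greater[OF natLeq_Card_order] ordLeq_ordLess_trans ordLess_imp_ordLeq by blast
  qed
  then have "|D| \<le>o \<omega>\<^sub>1"
    unfolding D_def using Field_omega1(1) inf
    by (intro card_of_UNION_ordLeq_infinite_Field[OF inf Card_order_omega1]) (auto dest: ordIso_imp_ordLeq)
  then show thesis using that DK dense by blast
qed

section \<open>Coding all continuous functions on a perfectly normal compact space\<close>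

lemma continuous_map_diff_prod:
  assumes "continuous_map K euclideanreal f"
  shows "continuous_map (prod_topology K K) euclideanreal (\<lambda>p. f (fst p) - f (snd p))"
proof -
  have "continuous_map (prod_topology K K) euclideanreal (f \<circ> fst)"
    using continuous_map_fst assms by (rule continuous_map_compose)
  moreover have "continuous_map (prod_topology K K) euclideanreal (f \<circ> snd)"
    using continuous_map_snd assms by (rule continuous_map_compose)
  ultimately have "continuous_map (prod_topology K K) euclideanreal (\<lambda>p. (f \<circ> fst) p - (f \<circ> snd) p)"
    by (rule continuous_map_diff)
  then show ?thesis by (simp add: o_def)
qed

text \<open>Perfect normality enters here: the saturation of a closed set with respect to \<open>H\<close> is closed,
  so its complement is a countable union of compact sets, and each of these is separated from \<open>A\<close>
  by finitely many members of \<open>H\<close>.\<close>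

lemma perfectly_normal_countable_saturation:
  fixes K :: "'a topology" and H :: "('a \<Rightarrow> real) set"
  assumes K: "compact_space K" "Hausdorff_space K" "perfectly_normal_space K"
    and H: "\<And>h. h \<in> H \<Longrightarrow> continuous_map K euclideanreal h" and A: "closedin K A"
  obtains W where "W \<subseteq> H" "countable W"
    "\<And>x y. x \<in> topspace K \<Longrightarrow> y \<in> A \<Longrightarrow> \<forall>h\<in>W. h x = h y \<Longrightarrow> \<exists>z\<in>A. \<forall>h\<in>H. h z = h x"
proof -
  define KK where "KK = prod_topology K K"
  have cKK: "compact_space KK" unfolding KK_def using K(1) by (simp add: compact_space_prod_topology)
  define D where "D = (\<lambda>h p. h (fst p) - h (snd p)) ` H"
  have cD: "continuous_map KK euclideanreal d" if "d \<in> D" for d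
    using that H continuous_map_diff_prod unfolding D_def KK_def by auto
  \<comment> \<open>The first projection of \<open>R\<close> is the saturation of \<open>A\<close>;
    it is compact, hence closed and a G-delta set.\<close>
  define R where "R = topspace K \<times> A \<inter> {p \<in> topspace KK. \<forall>d\<in>D. d p = 0}"
  have "closedin KK {p \<in> topspace KK. d p \<in> {0}}" if "d \<in> D" for d
    by (rule closedin_continuous_map_preimage[OF cD[OF that]]) simp
  then have "closedin KK (\<Inter>(insert (topspace KK) ((\<lambda>d. {p \<in> topspace KK. d p \<in> {0}}) ` D)))"
    by (intro closedin_Inter) auto
  moreover have "\<Inter>(insert (topspace KK) ((\<lambda>d. {p \<in> topspace KK. d p \<in> {0}}) ` D)) = {p \<in> topspace KK. \<forall>d\<in>D. d p = 0}" by auto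
  moreover have "closedin KK (topspace K \<times> A)"
    unfolding KK_def using A by (simp add: closedin_prod_Times_iff)
  ultimately have "closedin KK R" unfolding R_def by (simp add: closedin_Int)
  then have "compactin KK R" using cKK by (rule closedin_compact_space[rotated])
  then have "compactin K (fst ` R)" unfolding KK_def by (rule image_compactin) (rule continuous_map_fst)
  then have sat: "closedin K (fst ` R)" using K(2) compactin_imp_closedin by blast
  obtain \<U> where \<U>: "countable \<U>" "\<And>U. U \<in> \<U> \<Longrightarrow> openin K U" "\<And>U. U \<in> \<U> \<Longrightarrow> fst ` R \<subseteq> U"
    "\<And>x. x \<in> topspace K \<Longrightarrow> x \<notin> fst ` R \<Longrightarrow> \<exists>U\<in>\<U>. x \<notin> U"
    by (rule perfectly_normal_closed[OF K(3) sat]) (rule that)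
  have "\<exists>S\<subseteq>H. finite S \<and> (\<forall>x\<in>topspace K - U. \<forall>y\<in>A. \<not> (\<forall>h\<in>S. h x = h y))" if U: "U \<in> \<U>" for U
  proof -
    define P where "P = topspace KK - (topspace K - U) \<times> A"
    have "closedin KK ((topspace K - U) \<times> A)"
      unfolding KK_def using A \<U>(2)[OF U] by (auto simp: closedin_prod_Times_iff)
    then have P: "openin KK P" unfolding P_def by blast
    have zero: "p \<in> P" if p: "p \<in> topspace KK" "\<forall>d\<in>D. d p = 0" for p
    proof (rule ccontr)
      assume "p \<notin> P"
      then have q: "fst p \<in> topspace K - U" "snd p \<in> A" using p(1) unfolding P_def by auto
      then have "p \<in> R" unfolding R_def using p by (cases p) auto
      then have "fst p \<in> U" using \<U>(3)[OF U] by blast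
      then show False using q(1) by blast
    qed
    obtain S' \<delta> where S': "S' \<subseteq> D" "finite S'" "\<delta> > 0"
      "\<And>p. p \<in> topspace KK \<Longrightarrow> \<forall>d\<in>S'. \<bar>d p\<bar> < \<delta> \<Longrightarrow> p \<in> P"
      by (rule compact_zero_set_in_open[OF cKK cD P zero]) (assumption | rule that)+
    obtain S where S: "S \<subseteq> H" "finite S" "S' = (\<lambda>h p. h (fst p) - h (snd p)) ` S"
      using finite_subset_image[OF S'(2)] S'(1) unfolding D_def by blast
    have "\<not> (\<forall>h\<in>S. h x = h y)" if xy: "x \<in> topspace K - U" "y \<in> A" for x y
    proof
      assume eq: "\<forall>h\<in>S. h x = h y"
      have "y \<in> topspace K" using xy(2) closedin_subset[OF A] by blast
      then have "(x, y) \<in> topspace KK" unfolding KK_def using xy(1) by simp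
      moreover have "\<forall>d\<in>S'. \<bar>d (x, y)\<bar> < \<delta>" unfolding S(3) using eq S'(3) by auto
      ultimately have "(x, y) \<in> P" by (rule S'(4))
      then show False using xy unfolding P_def by simp
    qed
    then show ?thesis using S(1,2) by blast
  qed
  then obtain S where S: "\<And>U. U \<in> \<U> \<Longrightarrow> S U \<subseteq> H" "\<And>U. U \<in> \<U> \<Longrightarrow> finite (S U)"
    "\<And>U. U \<in> \<U> \<Longrightarrow> \<forall>x\<in>topspace K - U. \<forall>y\<in>A. \<not> (\<forall>h\<in>S U. h x = h y)" by metis
  define W where "W = (\<Union>U\<in>\<U>. S U)"
  show thesis
  proof (rule that[of W])
    show "W \<subseteq> H" unfolding W_def using S(1) by blast
    show "countable W" unfolding W_def using \<U>(1) S(2) by (intro countable_UN) (auto intro: countable_finite)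
    fix x y assume xy: "x \<in> topspace K" "y \<in> A" "\<forall>h\<in>W. h x = h y"
    have "x \<in> fst ` R"
    proof (rule ccontr)
      assume "x \<notin> fst ` R"
      then obtain U where U: "U \<in> \<U>" "x \<notin> U" using \<U>(4)[OF xy(1)] by blast
      have "\<forall>h\<in>S U. h x = h y" using xy(3) U(1) unfolding W_def by blast
      then show False using S(3)[OF U(1)] xy(1,2) U(2) by blast
    qed
    then obtain z where z: "(x, z) \<in> R" by auto
    then have "z \<in> A" "\<forall>d\<in>D. d (x, z) = 0" unfolding R_def by auto
    then have "\<forall>h\<in>H. h z = h x" unfolding D_def by auto
    then show "\<exists>z\<in>A. \<forall>h\<in>H. h z = h x" using \<open>z \<in> A\<close> by blast
  qed
qed

text \<open>Apply the saturation lemma to the preimages under \<open>f\<close> of all closed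
  intervals with rational endpoints. The countable set \<open>W\<close> then decides the closure of
  the set of values that \<open>f\<close> takes on a fibre of \<open>H\<close>.\<close>

lemma perfectly_normal_countable_fibres:
  fixes K :: "'a topology" and H :: "('a \<Rightarrow> real) set"
  assumes K: "compact_space K" "Hausdorff_space K" "perfectly_normal_space K"
    and H: "\<And>h. h \<in> H \<Longrightarrow> continuous_map K euclideanreal h" and f: "continuous_map K euclideanreal f"
  obtains W where "W \<subseteq> H" "countable W"
    "\<And>x y \<epsilon>. x \<in> topspace K \<Longrightarrow> y \<in> topspace K \<Longrightarrow> \<forall>h\<in>W. h x = h y \<Longrightarrow> \<epsilon> > 0 \<Longrightarrow>
      \<exists>z\<in>topspace K. \<bar>f z - f y\<bar> < \<epsilon> \<and> (\<forall>h\<in>H. h z = h x)"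
proof -
  define A where "A q = {y \<in> topspace K. f y \<in> {real_of_rat (fst q)..real_of_rat (snd q)}}" for q
  have A: "closedin K (A q)" for q
    unfolding A_def by (rule closedin_continuous_map_preimage[OF f]) simp
  have "\<exists>W\<subseteq>H. countable W \<and> (\<forall>x\<in>topspace K. \<forall>y\<in>A q. (\<forall>h\<in>W. h x = h y) \<longrightarrow> (\<exists>z\<in>A q. \<forall>h\<in>H. h z = h x))" for q
  proof -
    obtain W where "W \<subseteq> H" "countable W"
      "\<And>x y. x \<in> topspace K \<Longrightarrow> y \<in> A q \<Longrightarrow> \<forall>h\<in>W. h x = h y \<Longrightarrow> \<exists>z\<in>A q. \<forall>h\<in>H. h z = h x"
      by (rule perfectly_normal_countable_saturation[OF K H A]) (assumption | rule that)+
    then show ?thesis by blast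
  qed
  then obtain W where W: "\<And>q. W q \<subseteq> H" "\<And>q. countable (W q)"
    "\<And>q. \<forall>x\<in>topspace K. \<forall>y\<in>A q. (\<forall>h\<in>W q. h x = h y) \<longrightarrow> (\<exists>z\<in>A q. \<forall>h\<in>H. h z = h x)"
    by metis
  show thesis
  proof (rule that[of "\<Union>q. W q"])
    show "(\<Union>q. W q) \<subseteq> H" using W(1) by blast
    show "countable (\<Union>q. W q)" using W(2) by (intro countable_UN) auto
    fix x y and \<epsilon> :: real
    assume xy: "x \<in> topspace K" "y \<in> topspace K" "\<forall>h\<in>(\<Union>q. W q). h x = h y" and \<epsilon>: "\<epsilon> > 0"
    obtain a where a: "f y - \<epsilon>/2 < real_of_rat a" "real_of_rat a < f y" using of_rat_dense[of "f y - \<epsilon>/2" "f y"] \<epsilon> by auto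
    obtain b where b: "f y < real_of_rat b" "real_of_rat b < f y + \<epsilon>/2" using of_rat_dense[of "f y" "f y + \<epsilon>/2"] \<epsilon> by auto
    have "y \<in> A (a, b)" unfolding A_def using xy(2) a b by auto
    moreover have "\<forall>h\<in>W (a, b). h x = h y" using xy(3) by blast
    ultimately obtain z where z: "z \<in> A (a, b)" "\<forall>h\<in>H. h z = h x" using W(3)[of "(a, b)"] xy(1) by blast
    have "\<bar>f z - f y\<bar> < \<epsilon>" using z(1) a b unfolding A_def by (simp add: abs_less_iff)
    then show "\<exists>z\<in>topspace K. \<bar>f z - f y\<bar> < \<epsilon> \<and> (\<forall>h\<in>H. h z = h x)" using z unfolding A_def by blast
  qed
qed

text \<open>The sequence for \<open>f\<close> is read off points \<open>y n\<close> that follow only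
  the countably many coordinates coding \<open>W\<close>. Given finitely many further coordinates, a
  point \<open>x\<close> realising them near \<open>n\<close> is almost equivalent to
  \<open>y n\<close> under \<open>W\<close>; then some \<open>z\<close> has these coordinates of
  \<open>x\<close> and the \<open>f\<close>-value of \<open>y n\<close>, up to a small
  error.\<close>

lemma perfectly_normal_extension:
  fixes K :: "'a topology"
  assumes T: "topspace K \<noteq> {}" and K: "compact_space K" "Hausdorff_space K" "perfectly_normal_space K"
    and cont: "\<And>g. g \<in> G \<Longrightarrow> continuous_map K euclideanreal (fst g)"
    and G: "approx_in (topspace K) G" and f: "continuous_map K euclideanreal f"
  obtains s where "approx_in (topspace K) (insert (f, s) G)"
proof -
  have cH: "continuous_map K euclideanreal h" if "h \<in> fst ` G" for h using that cont by auto
  obtain W where W: "W \<subseteq> fst ` G" "countable W"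
    "\<And>x y \<epsilon>. x \<in> topspace K \<Longrightarrow> y \<in> topspace K \<Longrightarrow> \<forall>h\<in>W. h x = h y \<Longrightarrow> \<epsilon> > 0 \<Longrightarrow>
      \<exists>z\<in>topspace K. \<bar>f z - f y\<bar> < \<epsilon> \<and> (\<forall>h\<in>fst ` G. h z = h x)"
    by (rule perfectly_normal_countable_fibres[OF K cH f]) (assumption | rule that)+
  obtain G' where G': "G' \<subseteq> G" "countable G'" "fst ` G' = W"
  proof -
    have "\<forall>w\<in>W. \<exists>g\<in>G. fst g = w" using W(1) by blast
    then obtain k where "\<forall>w\<in>W. k w \<in> G \<and> fst (k w) = w" by metis
    then show thesis using that[of "k ` W"] W(2) by (auto simp: image_image image_iff)
  qed
  obtain y where y: "\<And>n. y n \<in> topspace K"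
    "\<And>g \<epsilon>. g \<in> G' \<Longrightarrow> \<epsilon> > 0 \<Longrightarrow> \<forall>\<^sub>F n in sequentially. dev g n (y n) < \<epsilon>"
    by (rule approx_in_pointwise[OF T G'(2) approx_in_subset[OF G G'(1)]]) (rule that)
  define s where "s n = f (y n)" for n
  define KK where "KK = prod_topology K K"
  have cKK: "compact_space KK" unfolding KK_def using K(1) by (simp add: compact_space_prod_topology)
  define D where "D = (\<lambda>h p. h (fst p) - h (snd p)) ` W"
  have cD: "continuous_map KK euclideanreal d" if d: "d \<in> D" for d
  proof -
    obtain h where h: "h \<in> W" "d = (\<lambda>p. h (fst p) - h (snd p))" using d unfolding D_def by auto
    show ?thesis
      unfolding KK_def h(2) using h(1) W(1) by (intro continuous_map_diff_prod cH) blast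
  qed
  have "approx_in (topspace K) (insert (f, s) G)"
    unfolding approx_in_def
  proof (intro allI impI)
    fix S0 and \<epsilon> :: real assume S0: "S0 \<subseteq> insert (f, s) G" "finite S0" and \<epsilon>: "0 < \<epsilon>"
    define S where "S = S0 - {(f, s)}"
    have S: "S \<subseteq> G" "finite S" unfolding S_def using S0 by auto
    \<comment> \<open>Pairs for which \<open>z\<close> can stand in: it is close to the first point
      on \<open>S\<close> and to the second under \<open>f\<close>. Pairs with equal values under
      \<open>W\<close> lie in some \<open>B z\<close>; compactness extends this to pairs with nearly
      equal values on a finite part of \<open>W\<close>.\<close>
    define B where "B z = {p \<in> topspace KK. f (snd p) \<in> ball (f z) (\<epsilon>/2)} \<inter>
      \<Inter>(insert (topspace KK) ((\<lambda>g. {p \<in> topspace KK. fst g (fst p) \<in> ball (fst g z) (\<epsilon>/2)}) ` S))" for z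
    have B: "openin KK (B z)" for z
    proof -
      have "continuous_map KK euclideanreal (\<lambda>p. f (snd p))"
        unfolding KK_def using continuous_map_compose[OF continuous_map_snd f] by (simp add: o_def)
      then have 1: "openin KK {p \<in> topspace KK. f (snd p) \<in> ball (f z) (\<epsilon>/2)}"
        by (rule openin_continuous_map_preimage) simp
      have "openin KK {p \<in> topspace KK. fst g (fst p) \<in> ball (fst g z) (\<epsilon>/2)}" if "g \<in> S" for g
      proof -
        have "continuous_map K euclideanreal (fst g)" using cont S(1) that by blast
        then have "continuous_map KK euclideanreal (\<lambda>p. fst g (fst p))"
          unfolding KK_def using continuous_map_compose[OF continuous_map_fst] by (fastforce simp: o_def)
        then show ?thesis by (rule openin_continuous_map_preimage) simp
      qed
      then have "openin KK (\<Inter>(insert (topspace KK) ((\<lambda>g. {p \<in> topspace KK. fst g (fst p) \<in> ball (fst g z) (\<epsilon>/2)}) ` S)))"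
        using S(2) by (intro openin_Inter) (auto simp del: mem_ball)
      with 1 show ?thesis unfolding B_def by (rule openin_Int)
    qed
    define P where "P = (\<Union>z\<in>topspace K. B z)"
    have P: "openin KK P" unfolding P_def using B by (intro openin_Union) auto
    have zero: "p \<in> P" if p: "p \<in> topspace KK" "\<forall>d\<in>D. d p = 0" for p
    proof -
      obtain a b where ab: "p = (a, b)" by (cases p)
      have "a \<in> topspace K" "b \<in> topspace K" "\<forall>h\<in>W. h a = h b" using p unfolding ab KK_def D_def by auto
      then obtain z where z: "z \<in> topspace K" "\<bar>f z - f b\<bar> < \<epsilon>/2" "\<forall>h\<in>fst ` G. h z = h a"
        using W(3)[of a b "\<epsilon>/2"] \<epsilon> by auto
      have "fst g a = fst g z" if "g \<in> S" for g using z(3) S(1) that by auto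
      then have "p \<in> B z" unfolding B_def using p(1) z(2) \<epsilon> by (auto simp: ab dist_real_def)
      then show ?thesis unfolding P_def using z(1) by blast
    qed
    obtain S' \<delta> where S': "S' \<subseteq> D" "finite S'" "\<delta> > 0"
      "\<And>p. p \<in> topspace KK \<Longrightarrow> \<forall>d\<in>S'. \<bar>d p\<bar> < \<delta> \<Longrightarrow> p \<in> P"
      by (rule compact_zero_set_in_open[OF cKK cD P zero]) (assumption | rule that)+
    have "D = (\<lambda>g p. fst g (fst p) - fst g (snd p)) ` G'" unfolding D_def G'(3)[symmetric] image_image ..
    then have "S' \<subseteq> (\<lambda>g p. fst g (fst p) - fst g (snd p)) ` G'" using S'(1) by simp
    from finite_subset_image[OF S'(2) this]
    obtain V where V: "V \<subseteq> G'" "finite V" "S' = (\<lambda>g p. fst g (fst p) - fst g (snd p)) ` V"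
      by (elim exE conjE)
    define \<eta> where "\<eta> = min (\<epsilon>/2) (\<delta>/2)"
    have \<eta>: "\<eta> > 0" unfolding \<eta>_def using \<epsilon> S'(3) by simp
    have "\<forall>\<^sub>F n in sequentially. \<exists>x\<in>topspace K. \<forall>g\<in>S \<union> V. dev g n x < \<eta>"
      using S V G'(1) \<eta> by (intro approx_inD[OF G]) auto
    moreover have "\<forall>\<^sub>F n in sequentially. \<forall>g\<in>V. dev g n (y n) < \<eta>"
      using V \<eta> by (intro eventually_ball_finite ballI y(2)) auto
    ultimately show "\<forall>\<^sub>F n in sequentially. \<exists>x\<in>topspace K. \<forall>g\<in>S0. dev g n x < \<epsilon>"
    proof eventually_elim
      case (elim n)
      obtain x where x: "x \<in> topspace K" "\<And>g. g \<in> S \<union> V \<Longrightarrow> dev g n x < \<eta>" using elim(1) by blast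
      have "\<forall>d\<in>S'. \<bar>d (x, y n)\<bar> < \<delta>"
      proof
        fix d assume "d \<in> S'"
        then obtain g where g: "g \<in> V" "d = (\<lambda>p. fst g (fst p) - fst g (snd p))" using V(3) by auto
        have "dev g n x < \<eta>" "dev g n (y n) < \<eta>" using x(2)[of g] elim(2) g(1) by auto
        moreover have "\<eta> \<le> \<delta>/2" unfolding \<eta>_def by simp
        ultimately show "\<bar>d (x, y n)\<bar> < \<delta>" unfolding g(2) fst_conv snd_conv by linarith
      qed
      then have "(x, y n) \<in> P" using x(1) y(1) by (intro S'(4)) (auto simp: KK_def)
      then obtain z where z: "z \<in> topspace K" "(x, y n) \<in> B z" unfolding P_def by blast
      have "dev g n z < \<epsilon>" if g: "g \<in> S0" for g
      proof (cases "g = (f, s)")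
        case True
        have "dist (f z) (f (y n)) < \<epsilon>/2" using z(2) unfolding B_def by simp
        then show ?thesis unfolding True s_def fst_conv snd_conv dist_real_def using \<epsilon> by linarith
      next
        case False
        then have gS: "g \<in> S" using g unfolding S_def by simp
        then have "dist (fst g z) (fst g x) < \<epsilon>/2" using z(2) unfolding B_def by auto
        moreover have "dev g n x < \<epsilon>/2" using x(2)[of g] gS unfolding \<eta>_def by auto
        ultimately show ?thesis unfolding dist_real_def by linarith
      qed
      then show ?case using z(1) by blast
    qed
  qed
  then show thesis by (rule that)
qed

lemma perfectly_normal_approximation:
  fixes K :: "'a topology"
  assumes T: "topspace K \<noteq> {}" and K: "compact_space K" "Hausdorff_space K" "perfectly_normal_space K"
  obtains G where "\<And>g. g \<in> G \<Longrightarrow> continuous_map K euclideanreal (fst g)"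
    "\<And>f. continuous_map K euclideanreal f \<Longrightarrow> \<exists>s. (f, s) \<in> G"
    "approx_in (topspace K) G" "approx_onto (topspace K) G" "sequential_clusters (topspace K) G"
proof -
  have "\<exists>H. countable H \<and> (\<forall>h\<in>H. continuous_map K euclideanreal h) \<and>
      (\<forall>y\<in>topspace K. (\<forall>h\<in>H. h y = h x) \<longrightarrow> y = x)" if x: "x \<in> topspace K" for x
  proof -
    obtain H :: "('a \<Rightarrow> real) set" where "countable H" "\<And>h. h \<in> H \<Longrightarrow> continuous_map K euclideanreal h"
      "\<And>y. y \<in> topspace K \<Longrightarrow> \<forall>h\<in>H. h y = h x \<Longrightarrow> y = x"
      by (rule perfectly_normal_point_functions[OF K x]) blast
    then show ?thesis by blast
  qed
  then obtain H :: "'a \<Rightarrow> ('a \<Rightarrow> real) set" where H: "\<And>x. x \<in> topspace K \<Longrightarrow> countable (H x)"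
    "\<And>x h. x \<in> topspace K \<Longrightarrow> h \<in> H x \<Longrightarrow> continuous_map K euclideanreal h"
    "\<And>x y. x \<in> topspace K \<Longrightarrow> y \<in> topspace K \<Longrightarrow> \<forall>h\<in>H x. h y = h x \<Longrightarrow> y = x" by metis
  obtain D where D: "D \<subseteq> topspace K" "|D| \<le>o \<omega>\<^sub>1" "K closure_of D = topspace K"
    by (rule perfectly_normal_dense_omega1[OF K T])
  \<comment> \<open>Functions that single out each point of the dense set. The constant 0 guarantees
    that \<open>W\<close> is nonempty and so can be enumerated along
    \<open>\<omega>\<^sub>1\<close>.\<close>
  define W where "W = insert (\<lambda>_. 0) (\<Union>x\<in>D. H x)"
  have cW: "continuous_map K euclideanreal h" if "h \<in> W" for h
    using that H(2) D(1) unfolding W_def by auto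
  have inf: "infinite (Field \<omega>\<^sub>1)" using Field_omega1(3) by (auto dest: countable_finite)
  have small: "|X| \<le>o \<omega>\<^sub>1" if "countable X" for X :: "('a \<Rightarrow> real) set"
  proof -
    have "|X| \<le>o natLeq" using that by (simp add: countable_card_le_natLeq)
    then show ?thesis using cardSuc_greater[OF natLeq_Card_order] ordLeq_ordLess_trans ordLess_imp_ordLeq by blast
  qed
  have "|\<Union>x\<in>D. H x| \<le>o \<omega>\<^sub>1"
    using small H(1) D(1) by (intro card_of_UNION_ordLeq_infinite_Field[OF inf Card_order_omega1 D(2)]) auto
  then have "|{\<lambda>_. 0} \<union> (\<Union>x\<in>D. H x)| \<le>o \<omega>\<^sub>1"
    using small[of "{\<lambda>_. 0}"] by (intro card_of_Un_ordLeq_infinite_Field[OF inf _ _ Card_order_omega1]) auto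
  then have "|W| \<le>o |Field \<omega>\<^sub>1|"
    unfolding W_def using Field_omega1(1) ordIso_symmetric ordLeq_ordIso_trans by (metis insert_is_Un)
  then obtain f where f: "f ` Field \<omega>\<^sub>1 = W" by (rule ordLeq_surj) (simp add: W_def)
  obtain G0 :: "'a coding" where G0: "approx_in (topspace K) G0" "approx_onto (topspace K) G0"
    "fst ` G0 = f ` Field \<omega>\<^sub>1"
    by (rule omega1_approximation[OF T, of f "\<lambda>_. {}" "\<lambda>_. {}"]) blast
  have G0W: "fst ` G0 = W" using G0(3) f by simp
  \<comment> \<open>Zorn's lemma is applied to \<open>approx_in\<close> alone. Unions of chains
    preserve it, and by \<open>perfectly_normal_extension\<close> a maximal coding contains every
    continuous function.\<close>
  define \<A> where "\<A> = {G. G0 \<subseteq> G \<and> approx_in (topspace K) G \<and> (\<forall>g\<in>G. continuous_map K euclideanreal (fst g))}"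
  have "\<exists>M\<in>\<A>. \<forall>X\<in>\<A>. M \<subseteq> X \<longrightarrow> X = M"
  proof (rule subset_Zorn_nonempty)
    have "G0 \<in> \<A>" unfolding \<A>_def using G0(1) G0W cW by auto
    then show "\<A> \<noteq> {}" by blast
    fix \<C> assume \<C>: "\<C> \<noteq> {}" "subset.chain \<A> \<C>"
    have sub: "\<C> \<subseteq> \<A>" using \<C>(2) unfolding subset.chain_def by blast
    have "approx_in (topspace K) (\<Union>\<C>)"
      unfolding approx_in_def
    proof (intro allI impI)
      fix S and \<epsilon> :: real assume S: "S \<subseteq> \<Union>\<C>" "finite S" "0 < \<epsilon>"
      obtain G where "G \<in> \<C>" "S \<subseteq> G" using finite_subset_Union_chain[OF S(2,1) \<C>] by blast
      then show "\<forall>\<^sub>F n in sequentially. \<exists>x\<in>topspace K. \<forall>g\<in>S. dev g n x < \<epsilon>"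
        using sub S(2,3) unfolding \<A>_def by (intro approx_inD[of _ G]) auto
    qed
    then show "\<Union>\<C> \<in> \<A>" using \<C>(1) sub unfolding \<A>_def by blast
  qed
  then obtain M where M: "M \<in> \<A>" "\<And>X. X \<in> \<A> \<Longrightarrow> M \<subseteq> X \<Longrightarrow> X = M" by blast
  have M0: "G0 \<subseteq> M" and Min: "approx_in (topspace K) M" and Mc: "\<And>g. g \<in> M \<Longrightarrow> continuous_map K euclideanreal (fst g)"
    using M(1) unfolding \<A>_def by auto
  have all: "\<exists>s. (h, s) \<in> M" if h: "continuous_map K euclideanreal h" for h
  proof -
    obtain s where s: "approx_in (topspace K) (insert (h, s) M)"
      by (rule perfectly_normal_extension[OF T K Mc Min h])
    have "insert (h, s) M = M" by (rule M(2)) (use M0 Mc s h in \<open>auto simp: \<A>_def\<close>)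
    then show ?thesis by blast
  qed
  \<comment> \<open>A neighbourhood \<open>U\<close> of \<open>x\<close> contains a point
    \<open>d\<close> of \<open>D\<close>, and finitely many functions coded in \<open>G0\<close>
    force every point with nearly the values of \<open>d\<close> into \<open>U\<close>. So any large
    \<open>n\<close> that is close to \<open>d\<close> on these codes is represented by points of
    \<open>U\<close>, and its codes in \<open>S\<close> are near those of \<open>x\<close>.\<close>
  have "approx_onto (topspace K) M"
    unfolding approx_onto_def clusters_def
  proof (intro ballI allI impI)
    fix x S and \<epsilon> :: real assume x: "x \<in> topspace K" and S: "S \<subseteq> M" "finite S" and \<epsilon>: "0 < \<epsilon>"
    define U where "U = \<Inter>(insert (topspace K) ((\<lambda>g. {y \<in> topspace K. fst g y \<in> ball (fst g x) (\<epsilon>/2)}) ` S))"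
    have "openin K {y \<in> topspace K. fst g y \<in> ball (fst g x) (\<epsilon>/2)}" if "g \<in> S" for g
      using S(1) that by (intro openin_continuous_map_preimage[OF Mc]) auto
    then have oU: "openin K U" unfolding U_def using S(2) by (intro openin_Inter) (auto simp del: mem_ball)
    have "x \<in> U" unfolding U_def using x \<epsilon> by auto
    then obtain d where d: "d \<in> D" "d \<in> U" using x D(3) oU unfolding in_closure_of by (metis in_closure_of)
    have dK: "d \<in> topspace K" using d(1) D(1) by blast
    obtain F \<delta> where F: "F \<subseteq> H d" "finite F" "\<delta> > 0"
      "\<And>y. y \<in> topspace K \<Longrightarrow> \<forall>h\<in>F. \<bar>h y - h d\<bar> < \<delta> \<Longrightarrow> y \<in> U"
      by (rule open_contains_basic_neighbourhood[OF K(1) H(2)[OF dK] H(3)[OF dK] oU d(2)]) (assumption | rule that)+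
    have "F \<subseteq> fst ` G0" unfolding G0W W_def using F(1) d(1) by blast
    then obtain S' where S': "S' \<subseteq> G0" "finite S'" "F = fst ` S'" using finite_subset_image[OF F(2)] by blast
    have "\<exists>\<^sub>F n in sequentially. n \<in> UNIV \<and> (\<forall>g\<in>S'. dev g n d < \<delta>/2)"
      using G0(2) dK S' F(3) unfolding approx_onto_def by (intro clustersD[of G0]) auto
    moreover have "\<forall>\<^sub>F n in sequentially. \<exists>y\<in>topspace K. \<forall>g\<in>S \<union> S'. dev g n y < min (\<delta>/2) (\<epsilon>/2)"
      using S S' M0 \<epsilon> F(3) by (intro approx_inD[OF Min]) auto
    ultimately have "\<exists>\<^sub>F n in sequentially. (n \<in> UNIV \<and> (\<forall>g\<in>S'. dev g n d < \<delta>/2)) \<and>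
        (\<exists>y\<in>topspace K. \<forall>g\<in>S \<union> S'. dev g n y < min (\<delta>/2) (\<epsilon>/2))"
      by (rule frequently_eventually_frequently)
    then show "\<exists>\<^sub>F n in sequentially. n \<in> UNIV \<and> (\<forall>g\<in>S. dev g n x < \<epsilon>)"
    proof (rule frequently_elim1)
      fix n assume n: "(n \<in> UNIV \<and> (\<forall>g\<in>S'. dev g n d < \<delta>/2)) \<and>
        (\<exists>y\<in>topspace K. \<forall>g\<in>S \<union> S'. dev g n y < min (\<delta>/2) (\<epsilon>/2))"
      then obtain y where y: "y \<in> topspace K" "\<And>g. g \<in> S \<union> S' \<Longrightarrow> dev g n y < min (\<delta>/2) (\<epsilon>/2)" by blast
      have "\<forall>h\<in>F. \<bar>h y - h d\<bar> < \<delta>"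
      proof
        fix h assume "h \<in> F"
        then obtain g where g: "g \<in> S'" "h = fst g" using S'(3) by auto
        have "dev g n y < \<delta>/2" "dev g n d < \<delta>/2" using y(2)[of g] n g(1) by auto
        then show "\<bar>h y - h d\<bar> < \<delta>" unfolding g(2) by linarith
      qed
      then have yU: "y \<in> U" by (rule F(4)[OF y(1)])
      show "n \<in> UNIV \<and> (\<forall>g\<in>S. dev g n x < \<epsilon>)"
      proof (intro conjI ballI UNIV_I)
        fix g assume g: "g \<in> S"
        have "dist (fst g x) (fst g y) < \<epsilon>/2" using yU g unfolding U_def by auto
        moreover have "dev g n y < \<epsilon>/2" using y(2)[of g] g by auto
        ultimately show "dev g n x < \<epsilon>" unfolding dist_real_def by linarith
      qed
    qed
  qed
  moreover have "sequential_clusters (topspace K) M"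
  proof (rule sequential_clustersI[OF K(1) Mc Min])
    fix x assume x: "x \<in> topspace K"
    have "\<forall>h\<in>H x. \<exists>s. (h, s) \<in> M" using all H(2)[OF x] by blast
    then obtain k where k: "\<forall>h\<in>H x. (h, k h) \<in> M" by metis
    show "\<exists>H'\<subseteq>M. (countable H' \<or> |H'| <o pseudointersection_number) \<and>
        (\<forall>y\<in>topspace K. (\<forall>h\<in>H'. fst h y = fst h x) \<longrightarrow> y = x)"
    proof (intro exI[of _ "(\<lambda>h. (h, k h)) ` H x"] conjI ballI impI)
      show "(\<lambda>h. (h, k h)) ` H x \<subseteq> M" using k by auto
      show "countable ((\<lambda>h. (h, k h)) ` H x) \<or> |(\<lambda>h. (h, k h)) ` H x| <o pseudointersection_number"
        using H(1)[OF x] by simp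
      show "y = x" if "y \<in> topspace K" "\<forall>h\<in>(\<lambda>h. (h, k h)) ` H x. fst h y = fst h x" for y
        using that by (intro H(3)[OF x]) auto
    qed
  qed
  ultimately show thesis using that[OF Mc all Min] by blast
qed

theorem corollary9p6:
  fixes K :: "'a topology"
  assumes "topspace K \<noteq> {}" and "compact_space K" and "Hausdorff_space K"
    and "(is_corona K \<and> character K <o pseudointersection_number) \<or>
         perfectly_normal_space K \<or>
         (weight K \<le>o \<omega>\<^sub>1 \<and> \<omega>\<^sub>1 <o pseudointersection_number) \<or>
         (weight K \<le>o \<omega>\<^sub>1 \<and> \<omega>\<^sub>1 =o continuum)"
  shows "(\<exists>(X::nat set) \<E>. |X| =o natLeq \<and> coarse_space X \<E> \<and> finitary X \<E> \<and>
            K homeomorphic_space higson_corona X \<E>) \<and>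
         (Delta_cellular =o continuum \<longrightarrow>
          (\<exists>(X::nat set) \<E>. |X| =o natLeq \<and> coarse_space X \<E> \<and> finitary X \<E> \<and> cellular X \<E> \<and>
            K homeomorphic_space higson_corona X \<E>))"
proof -
  note T = assms(1) and K = assms(2,3)
  have "(\<exists>\<E> :: (nat \<times> nat) set set. coarse_space UNIV \<E> \<and> finitary UNIV \<E> \<and> K homeomorphic_space higson_corona UNIV \<E>) \<and>
    (Delta_cellular =o continuum \<longrightarrow> (\<exists>\<E> :: (nat \<times> nat) set set. coarse_space UNIV \<E> \<and> finitary UNIV \<E> \<and> cellular UNIV \<E> \<and>
      K homeomorphic_space higson_corona UNIV \<E>))" (is ?main)
    using assms(4)
  proof (elim disjE conjE)
    assume c: "is_corona K" "character K <o pseudointersection_number"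
    obtain G where G: "\<And>g. g \<in> G \<Longrightarrow> continuous_map K euclideanreal (fst g)"
      "\<And>f. continuous_map K euclideanreal f \<Longrightarrow> \<exists>s. (f, s) \<in> G"
      "approx_in (topspace K) G" "approx_onto (topspace K) G" "sequential_clusters (topspace K) G"
      by (rule corona_small_character[OF K c]) blast
    show ?main
    proof (rule sequential_corona[OF K(1) G(1) _ G(3,4,5)])
      show "x = y" if xy: "x \<in> topspace K" "y \<in> topspace K" "\<And>g. g \<in> G \<Longrightarrow> fst g x = fst g y" for x y
        by (rule continuous_functions_separate[OF K xy(1,2)]) (use G(2) xy(3) in fastforce)
    qed
  next
    assume p: "perfectly_normal_space K"
    obtain G where G: "\<And>g. g \<in> G \<Longrightarrow> continuous_map K euclideanreal (fst g)"
      "\<And>f. continuous_map K euclideanreal f \<Longrightarrow> \<exists>s. (f, s) \<in> G"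
      "approx_in (topspace K) G" "approx_onto (topspace K) G" "sequential_clusters (topspace K) G"
      by (rule perfectly_normal_approximation[OF T K p]) blast
    show ?main
    proof (rule sequential_corona[OF K(1) G(1) _ G(3,4,5)])
      show "x = y" if xy: "x \<in> topspace K" "y \<in> topspace K" "\<And>g. g \<in> G \<Longrightarrow> fst g x = fst g y" for x y
        by (rule continuous_functions_separate[OF K xy(1,2)]) (use G(2) xy(3) in fastforce)
    qed
  next
    assume w: "weight K \<le>o \<omega>\<^sub>1" "\<omega>\<^sub>1 <o pseudointersection_number"
    show ?main
    proof (rule corona_weight_le_omega1[OF T K w])
      fix G :: "'a coding"
      assume G: "\<And>g. g \<in> G \<Longrightarrow> continuous_map K euclideanreal (fst g)"
        and sep: "\<And>x y. x \<in> topspace K \<Longrightarrow> y \<in> topspace K \<Longrightarrow> (\<And>g. g \<in> G \<Longrightarrow> fst g x = fst g y) \<Longrightarrow> x = y"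
        and app: "approx_in (topspace K) G" "approx_onto (topspace K) G" "sequential_clusters (topspace K) G"
      show ?main
      proof (rule sequential_corona[OF K(1) G _ app])
        show "x = y" if "x \<in> topspace K" "y \<in> topspace K" "\<And>g. g \<in> G \<Longrightarrow> fst g x = fst g y" for x y
          using that by (rule sep)
      qed
    qed
  next
    assume w: "weight K \<le>o \<omega>\<^sub>1" "\<omega>\<^sub>1 =o continuum"
    \<comment> \<open>The structure obtained under CH is already cellular and serves for both
      conclusions.\<close>
    show ?main using cellular_corona_CH[OF T K w] by blast
  qed
  moreover have "|UNIV :: nat set| =o natLeq" by (rule card_of_nat)
  ultimately show ?thesis by blast
qed

end
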